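(* Let $n\ge 2$, $\delta>0$ and $\eta>0$. There exist $N_0=N_0(n)$ and $A_0=A_0(\delta,n,\eta)$ such that the following holds. Let $A>A_0$ be an integer such that $2A+1$ is a power of $3$, and let $N>N_0$ be a real number. Let $Q=[-1/2,1/2]^n$ and let $u$ be a nonconstant harmonic function on an open set containing $100Q$ and all balls $B(x,20n)$ with $x\in 2Q$, such that $N(2Q)\le 2N$. Divide $Q$ into $(2A+1)^n$ equal (closed, axis-parallel) subcubes $q_i$ of side length $\frac{1}{2A+1}$, and denote by $q_{i,0}$ those subcubes which have nonempty intersection with the hyperplane $\{x_n=0\}$. Then the number of cubes $q_{i,0}$ satisfying $N(q_{i,0})>N$ is smaller than $\eta(2A+1)^{n-2+\delta}$.
   Context: For a cube $Q'$ with side length $\ell(Q')$, and $k>0$, $kQ'$ denotes the concentric cube with parallel sides and side length $k\,\ell(Q')$. For a nonconstant harmonic function $u$, the (maximal normalized) doubling index of a cube $Q'$ is $$N(Q')=\sup_{x\in Q',\ 0<r\le \ell(Q')}\log\frac{\sup_{B(x,10nr)}|\nabla u|}{\sup_{B(x,r)}|\nabla u|},$$ where $B(x,r)$ is the ball of center $x$ and radius $r$. Note that $N$ without an argument is a real number, whereas $N(\cdot)$ applied to a cube is the doubling index of $u$ on that cube. *)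

theory Defs
  imports "HOL-Analysis.Analysis"
begin

definition partial_deriv :: "'n::finite \<Rightarrow> (real^'n \<Rightarrow> real) \<Rightarrow> real^'n \<Rightarrow> real" where
  "partial_deriv i f x = frechet_derivative f (at x) (axis i 1)"

definition gradient :: "(real^'n::finite \<Rightarrow> real) \<Rightarrow> real^'n \<Rightarrow> real^'n" where
  "gradient f x = (\<chi> i. partial_deriv i f x)"

definition C2_on :: "(real^'n::finite) set \<Rightarrow> (real^'n \<Rightarrow> real) \<Rightarrow> bool" where
  "C2_on S f \<longleftrightarrow>
     (\<forall>x\<in>S. f differentiable at x) \<and>
     (\<forall>i. \<forall>x\<in>S. partial_deriv i f differentiable at x) \<and>
     (\<forall>i j. continuous_on S (partial_deriv j (partial_deriv i f)))"

definition laplacian :: "(real^'n::finite \<Rightarrow> real) \<Rightarrow> real^'n \<Rightarrow> real" where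
  "laplacian f x = (\<Sum>i\<in>UNIV. partial_deriv i (partial_deriv i f) x)"

definition harmonic_on :: "(real^'n::finite) set \<Rightarrow> (real^'n \<Rightarrow> real) \<Rightarrow> bool" where
  "harmonic_on S f \<longleftrightarrow> open S \<and> C2_on S f \<and> (\<forall>x\<in>S. laplacian f x = 0)"

text \<open>A closed axis-parallel cube is the pair of its centre and its side length, so that
  the side length can be read off without recovering it from the point set.\<close>

type_synonym 'n cube = "(real^'n) \<times> real"

abbreviation center :: "'n::finite cube \<Rightarrow> real^'n" where "center \<equiv> fst"
abbreviation side :: "'n::finite cube \<Rightarrow> real" where "side \<equiv> snd"

definition cube_set :: "'n::finite cube \<Rightarrow> (real^'n) set" where
  "cube_set q = {x. \<forall>i. \<bar>x $ i - center q $ i\<bar> \<le> side q / 2}"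

definition dilate :: "real \<Rightarrow> 'n::finite cube \<Rightarrow> 'n cube" where
  "dilate k q = (center q, k * side q)"

definition unit_cube :: "'n::finite cube" where
  "unit_cube = (0, 1)"

text \<open>The \<open>M ^ n\<close> equal subcubes of a cube; the multi-index \<open>m\<close> gives the position of the
  subcube, and \<open>1 / 2\<close> moves from the lower corner of the subcube to its centre.\<close>

definition subcubes :: "nat \<Rightarrow> 'n::finite cube \<Rightarrow> 'n cube set" where
  "subcubes M q =
     {(\<chi> i. center q $ i - side q / 2 + (real (m i) + 1 / 2) * (side q / real M), side q / real M)
      | m :: 'n \<Rightarrow> nat. \<forall>i. m i < M}"

definition ereal_ln :: "ereal \<Rightarrow> ereal" where
  "ereal_ln x = (if x = \<infinity> then \<infinity> else if x \<le> 0 then -\<infinity> else ereal (ln (real_of_ereal x)))"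

definition sup_grad :: "(real^'n::finite \<Rightarrow> real) \<Rightarrow> real^'n \<Rightarrow> real \<Rightarrow> ereal" where
  "sup_grad u x r = (SUP y\<in>ball x r. ereal (norm (gradient u y)))"

text \<open>Suprema are taken in the extended reals, so that an unbounded family has supremum
  \<open>\<infinity>\<close> rather than an unspecified value. The quotient \<open>0 / 0\<close>, which is \<open>0\<close> in
  \<^typ>\<open>ereal\<close>, arises only if \<open>u\<close> is constant near \<open>x\<close>.\<close>

definition doubling_index :: "(real^'n::finite \<Rightarrow> real) \<Rightarrow> 'n cube \<Rightarrow> ereal" where
  "doubling_index u q =
     (SUP (x, r) \<in> cube_set q \<times> {0 <.. side q}.
        ereal_ln (sup_grad u x (10 * real CARD('n) * r) / sup_grad u x r))"

end

theory Submission
  imports Defs "HOL-Complex_Analysis.Complex_Analysis"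
begin

text \<open>
  On a real line, a derivative of a harmonic function extends to a holomorphic function of a
  complex parameter, with bounds coming from interior gradient estimates. Comparing Taylor
  coefficients shows that a doubling exponent above \<open>N\<close> at one scale makes \<open>\<nabla>u\<close> at most
  \<open>h powr (c N)\<close>, up to normalization, near a bad cube of side \<open>h\<close>. If there are too many bad
  cubes, some triadic cube contains a set of bad cubes whose counting measure is Frostman of
  dimension larger than \<open>n - 2\<close>, over many scales. Averaging over slopes produces a direction in
  which a positive proportion of the parallel tubes meet this set in a subset of bounded
  logarithmic energy; by the maximum principle in the complexified line, smallness spreads along
  each such tube, then along the coordinate directions of the hyperplane, and finally off the
  hyperplane, because \<open>\<Delta>u = 0\<close> expresses the normal derivatives through the tangential ones. The
  loss in the exponent does not depend on \<open>h\<close>, so for small \<open>h\<close> the result contradicts the bound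
  \<open>2 N\<close> on the doubling index of the large cube.
\<close>

text \<open>The exponent n - 2 comes from the average over slopes. Two cells whose indices are d
  apart share a tube for at most (3 D / d)^(n-2) of the D^(n-2) slopes, so the averaged energy is a
  Riesz energy of order n - 2 with an extra logarithm; a Frostman dimension above n - 2 bounds it.
  The gradient is propagated instead of \<open>u\<close>. Values on a hyperplane leave the odd
  normal derivatives of a harmonic function free, as the coordinate x_k shows, whereas vanishing
  divergence and curl of the gradient determine all of them. Gain and loss are both linear in N: on
  a grid of mesh 3^-L the gradient is of size exp(- \<gamma> N L), and a fixed number J of doublings
  costs exp(2 N J). Hence L, and with it the threshold for A, does not depend on N. Triadic grids
  are nested with the hyperplane always in the middle layer, so a selected cube rescales to the unit
  cube with the same hyperplane. As \<open>harmonic_on\<close> provides two derivatives only,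
  interior estimates start from the maximum principle and further smoothness from difference
  quotients.\<close>

definition jet2 :: "(real^'n::finite) set \<Rightarrow> (real^'n \<Rightarrow> real) \<Rightarrow> ('n \<Rightarrow> real^'n \<Rightarrow> real) \<Rightarrow>
    ('n \<Rightarrow> 'n \<Rightarrow> real^'n \<Rightarrow> real) \<Rightarrow> bool" where
  "jet2 S f g H \<longleftrightarrow> open S \<and>
     (\<forall>x\<in>S. (f has_derivative (\<lambda>w. \<Sum>i\<in>UNIV. w $ i * g i x)) (at x)) \<and>
     (\<forall>x\<in>S. \<forall>i. (g i has_derivative (\<lambda>w. \<Sum>j\<in>UNIV. w $ j * H i j x)) (at x)) \<and>
     (\<forall>i j. continuous_on S (H i j))"

lemma sum_axis: "(\<Sum>i\<in>UNIV. axis j (1::real) $ i * c i) = c (j::'n::finite)"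
proof -
  have "(\<Sum>i\<in>UNIV. axis j (1::real) $ i * c i) = (\<Sum>i\<in>UNIV. if j = i then c i else 0)"
    by (intro sum.cong) (auto simp: axis_def)
  then show ?thesis by simp
qed

lemma partial_deriv_eqI:
  assumes "(f has_derivative (\<lambda>w. \<Sum>i\<in>UNIV. w $ i * c i)) (at (x::real^'n::finite))"
  shows "partial_deriv j f x = c j"
  unfolding partial_deriv_def frechet_derivative_at[OF assms, symmetric] by (rule sum_axis)

lemma frechet_derivative_sum_partial:
  assumes "f differentiable at (x::real^'n::finite)"
  shows "frechet_derivative f (at x) = (\<lambda>w. \<Sum>i\<in>UNIV. w $ i * partial_deriv i f x)"
proof
  fix w :: "real^'n"
  have lin: "linear (frechet_derivative f (at x))"
    using assms by (rule linear_frechet_derivative)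
  have w: "(\<Sum>i\<in>UNIV. w $ i *\<^sub>R axis i 1) = w"
    using basis_expansion[of w] by (simp add: scalar_mult_eq_scaleR)
  have "frechet_derivative f (at x) w = frechet_derivative f (at x) (\<Sum>i\<in>UNIV. w $ i *\<^sub>R axis i 1)"
    unfolding w by (rule refl)
  also have "\<dots> = (\<Sum>i\<in>UNIV. w $ i * partial_deriv i f x)"
    unfolding partial_deriv_def by (subst linear_sum[OF lin]) (simp add: linear_cmul[OF lin])
  finally show "frechet_derivative f (at x) w = (\<Sum>i\<in>UNIV. w $ i * partial_deriv i f x)" .
qed

lemma has_derivative_sum_partial:
  assumes "f differentiable at (x::real^'n::finite)"
  shows "(f has_derivative (\<lambda>w. \<Sum>i\<in>UNIV. w $ i * partial_deriv i f x)) (at x)"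
  using assms unfolding frechet_derivative_works frechet_derivative_sum_partial[OF assms] .

lemma jet2_first:
  assumes "jet2 S f g H" "x \<in> S"
  shows "(f has_derivative (\<lambda>w. \<Sum>i\<in>UNIV. w $ i * g i x)) (at x)"
    and "(g i has_derivative (\<lambda>w. \<Sum>j\<in>UNIV. w $ j * H i j x)) (at x)"
    and "open S" "continuous_on S (H i j)"
  using assms by (auto simp: jet2_def)

lemma has_derivative_cong_open:
  assumes "open S" "x \<in> S" "\<And>y. y \<in> S \<Longrightarrow> f y = g y" "(f has_derivative D) (at x)"
  shows "(g has_derivative D) (at x)"
  using has_derivative_transform_within_open[OF assms(4,1,2)] assms(3) by blast

lemma jet2_partial:
  assumes "jet2 S f g H" "x \<in> S"
  shows "partial_deriv i f x = g i x" "partial_deriv j (partial_deriv i f) x = H i j x"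
proof -
  have 1: "partial_deriv i f y = g i y" if "y \<in> S" for y i
    using partial_deriv_eqI[OF jet2_first(1)[OF assms(1) that]] .
  show "partial_deriv i f x = g i x" using 1 assms by auto
  have "((partial_deriv i f) has_derivative (\<lambda>w. \<Sum>j\<in>UNIV. w $ j * H i j x)) (at x)"
    using has_derivative_cong_open[OF jet2_first(3)[OF assms] assms(2) _ jet2_first(2)[OF assms, of i]] 1
    by auto
  then show "partial_deriv j (partial_deriv i f) x = H i j x" by (rule partial_deriv_eqI)
qed

text \<open>\<open>C2_on\<close> speaks through \<open>frechet_derivative\<close>, which is awkward
  to compute with. \<open>jet2\<close> carries explicit candidates for gradient and Hessian, so that
  closure properties reduce to derivative rules; this lemma is the way back.\<close>

lemma jet2_harmonic:
  assumes "jet2 S f g H" "\<And>x. x \<in> S \<Longrightarrow> (\<Sum>i\<in>UNIV. H i i x) = 0"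
  shows "harmonic_on S f"
proof -
  have op: "open S" using assms(1) by (simp add: jet2_def)
  have d2: "((partial_deriv i f) has_derivative (\<lambda>w. \<Sum>j\<in>UNIV. w $ j * H i j x)) (at x)" if "x \<in> S" for i x
    using has_derivative_cong_open[OF op that _ jet2_first(2)[OF assms(1) that, of i]]
      jet2_partial(1)[OF assms(1)] by auto
  have "C2_on S f"
    unfolding C2_on_def
  proof (intro conjI allI ballI)
    show "f differentiable at x" if "x \<in> S" for x
      using jet2_first(1)[OF assms(1) that] by (auto simp: differentiable_def)
    show "partial_deriv i f differentiable at x" if "x \<in> S" for x i
      using d2[OF that] by (auto simp: differentiable_def)
    show "continuous_on S (partial_deriv j (partial_deriv i f))" for i j
    proof -
      have "continuous_on S (H i j)" using assms(1) by (auto simp: jet2_def)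
      then show ?thesis
        by (rule continuous_on_eq) (simp add: jet2_partial(2)[OF assms(1)])
    qed
  qed
  then show ?thesis using op assms(2)
    by (auto simp: harmonic_on_def laplacian_def jet2_partial[OF assms(1)])
qed

lemma harmonic_jet2:
  assumes "harmonic_on S f"
  shows "jet2 S f (\<lambda>i. partial_deriv i f) (\<lambda>i j. partial_deriv j (partial_deriv i f))"
  using assms unfolding harmonic_on_def C2_on_def jet2_def by (auto intro: has_derivative_sum_partial)

lemma harmonic_open: "harmonic_on S f \<Longrightarrow> open S"
  by (simp add: harmonic_on_def)

lemma harmonic_trace: "harmonic_on S f \<Longrightarrow> x \<in> S \<Longrightarrow> (\<Sum>i\<in>UNIV. partial_deriv i (partial_deriv i f) x) = 0"
  by (simp add: harmonic_on_def laplacian_def)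

lemma harmonic_has_derivative:
  assumes "harmonic_on S f" "x \<in> S"
  shows "(f has_derivative (\<lambda>w. \<Sum>i\<in>UNIV. w $ i * partial_deriv i f x)) (at x)"
  using jet2_first(1)[OF harmonic_jet2[OF assms(1)] assms(2)] .

lemma harmonic_continuous:
  assumes "harmonic_on S f" shows "continuous_on S f"
  by (intro continuous_at_imp_continuous_on ballI has_derivative_continuous[OF harmonic_has_derivative[OF assms]])

lemma harmonic_subset:
  assumes "harmonic_on S f" "open T" "T \<subseteq> S" shows "harmonic_on T f"
  using assms continuous_on_subset[of S "_ :: _ \<Rightarrow> real", OF _ assms(3)] unfolding harmonic_on_def C2_on_def
  by (simp add: subset_iff)

lemma harmonic_cong:
  assumes "harmonic_on S f" "\<And>x. x \<in> S \<Longrightarrow> f x = f' x"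
  shows "harmonic_on S f'"
proof -
  have j: "jet2 S f (\<lambda>i. partial_deriv i f) (\<lambda>i j. partial_deriv j (partial_deriv i f))"
    by (rule harmonic_jet2[OF assms(1)])
  then have "jet2 S f' (\<lambda>i. partial_deriv i f) (\<lambda>i j. partial_deriv j (partial_deriv i f))"
    unfolding jet2_def using has_derivative_cong_open[of S _ f f'] assms(2) by blast
  then show ?thesis
    by (rule jet2_harmonic) (rule harmonic_trace[OF assms(1)])
qed

lemma jet2_lin:
  assumes "jet2 S f g H" "jet2 S f' g' H'"
  shows "jet2 S (\<lambda>x. a * f x + b * f' x) (\<lambda>i x. a * g i x + b * g' i x)
           (\<lambda>i j x. a * H i j x + b * H' i j x)"
proof -
  have e: "(\<lambda>w. \<Sum>i\<in>UNIV. w $ i * (a * c i + b * d i)) =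
     (\<lambda>w::real^'a. a * (\<Sum>i\<in>UNIV. w $ i * c i) + b * (\<Sum>i\<in>UNIV. w $ i * d i))" for c d :: "'a \<Rightarrow> real"
    by (simp add: fun_eq_iff algebra_simps sum.distrib sum_distrib_left)
  show ?thesis
    using assms unfolding jet2_def e
    by (auto intro!: derivative_intros continuous_intros)
qed

lemma harmonic_lin:
  assumes "harmonic_on S f" "harmonic_on S f'"
  shows "harmonic_on S (\<lambda>x. a * f x + b * f' x)"
proof (rule jet2_harmonic[OF jet2_lin[OF assms[THEN harmonic_jet2]]])
  fix x assume x: "x \<in> S"
  have "(\<Sum>i\<in>UNIV. a * partial_deriv i (partial_deriv i f) x + b * partial_deriv i (partial_deriv i f') x)
    = a * (\<Sum>i\<in>UNIV. partial_deriv i (partial_deriv i f) x) + b * (\<Sum>i\<in>UNIV. partial_deriv i (partial_deriv i f') x)"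
    by (simp add: sum.distrib sum_distrib_left)
  then show "(\<Sum>i\<in>UNIV. a * partial_deriv i (partial_deriv i f) x + b * partial_deriv i (partial_deriv i f') x) = 0"
    using harmonic_trace[OF assms(1) x] harmonic_trace[OF assms(2) x] by simp
qed

lemma partial_deriv_lin:
  assumes "harmonic_on S f" "harmonic_on S f'" "x \<in> S"
  shows "partial_deriv i (\<lambda>x. a * f x + b * f' x) x = a * partial_deriv i f x + b * partial_deriv i f' x"
  using jet2_partial(1)[OF jet2_lin[OF assms(1,2)[THEN harmonic_jet2]] assms(3)] .

lemma partial_deriv_lin2:
  assumes "harmonic_on S f" "harmonic_on S f'" "x \<in> S"
  shows "partial_deriv j (partial_deriv i (\<lambda>x. a * f x + b * f' x)) x =
     a * partial_deriv j (partial_deriv i f) x + b * partial_deriv j (partial_deriv i f') x"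
  using jet2_partial(2)[OF jet2_lin[OF assms(1,2)[THEN harmonic_jet2]] assms(3)] .

lemma harmonic_zero: "open S \<Longrightarrow> harmonic_on S (\<lambda>x. 0)"
  by (rule jet2_harmonic[of _ _ "\<lambda>_ _. 0" "\<lambda>_ _ _. 0"]) (auto simp: jet2_def)

lemma harmonic_cmult: "harmonic_on S f \<Longrightarrow> harmonic_on S (\<lambda>x. a * f x)"
  using harmonic_lin[of S f f a 0] by simp

lemma harmonic_sum:
  assumes "finite I" "open S" "\<And>i. i \<in> I \<Longrightarrow> harmonic_on S (f i)"
  shows "harmonic_on S (\<lambda>x. \<Sum>i\<in>I. c i * f i x)"
  using assms(1,3)
proof (induction I)
  case empty then show ?case by (simp add: harmonic_zero[OF assms(2)])
next
  case (insert i I)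
  then have "harmonic_on S (\<lambda>x. c i * f i x + 1 * (\<Sum>i\<in>I. c i * f i x))"
    by (intro harmonic_lin) auto
  then show ?case using insert by simp
qed

subsection \<open>Affine changes of variables\<close>

definition aff :: "real^'n \<Rightarrow> ('n \<Rightarrow> real) \<Rightarrow> real^'n \<Rightarrow> real^'n::finite" where
  "aff a s y = a + (\<chi> j. s j * y $ j)"

lemma aff_has_derivative: "(aff a s has_derivative (\<lambda>w. \<chi> j. s j * w $ j)) (at y)"
proof -
  have "linear (\<lambda>w::real^'a. \<chi> j. s j * w $ j)"
    by (rule linearI) (auto simp: vec_eq_iff algebra_simps)
  then have "bounded_linear (\<lambda>w::real^'a. \<chi> j. s j * w $ j)"
    by (rule linear_conv_bounded_linear[THEN iffD1])
  then have "((\<lambda>y. a + (\<chi> j. s j * y $ j)) has_derivative (\<lambda>w. 0 + (\<chi> j. s j * w $ j))) (at y)"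
    by (intro has_derivative_add has_derivative_const bounded_linear_imp_has_derivative)
  then show ?thesis by (simp add: aff_def[abs_def])
qed

lemma aff_continuous: "continuous_on S (aff a s)"
  by (intro continuous_at_imp_continuous_on ballI has_derivative_continuous[OF aff_has_derivative])

lemma aff_compose_deriv:
  assumes "(f has_derivative (\<lambda>w. \<Sum>i\<in>UNIV. w $ i * c i)) (at (aff a s y))"
  shows "((\<lambda>y. f (aff a s y)) has_derivative (\<lambda>w. \<Sum>i\<in>UNIV. w $ i * (s i * c i))) (at y)"
proof -
  have "((f \<circ> aff a s) has_derivative ((\<lambda>w. \<Sum>i\<in>UNIV. w $ i * c i) \<circ> (\<lambda>w. \<chi> j. s j * w $ j))) (at y)"
    by (rule diff_chain_at[OF aff_has_derivative assms])
  moreover have "((\<lambda>w. \<Sum>i\<in>UNIV. w $ i * c i) \<circ> (\<lambda>w. \<chi> j. s j * w $ j)) = (\<lambda>w. \<Sum>i\<in>UNIV. w $ i * (s i * c i))"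
    by (auto simp: fun_eq_iff intro!: sum.cong)
  ultimately show ?thesis by (simp add: o_def)
qed

lemma jet2_aff:
  assumes "jet2 S f g H" "open T" "\<And>y. y \<in> T \<Longrightarrow> aff a s y \<in> S"
  shows "jet2 T (\<lambda>y. f (aff a s y)) (\<lambda>i y. s i * g i (aff a s y)) (\<lambda>i j y. s i * (s j * H i j (aff a s y)))"
  unfolding jet2_def
proof (intro conjI ballI allI)
  show "open T" by fact
  fix y assume y: "y \<in> T"
  show "((\<lambda>y. f (aff a s y)) has_derivative (\<lambda>w. \<Sum>i\<in>UNIV. w $ i * (s i * g i (aff a s y)))) (at y)"
    by (rule aff_compose_deriv[OF jet2_first(1)[OF assms(1) assms(3)[OF y]]])
  fix i
  have "((\<lambda>y. s i * g i (aff a s y)) has_derivative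
     (\<lambda>w. s i * (\<Sum>j\<in>UNIV. w $ j * (s j * H i j (aff a s y))))) (at y)"
    by (intro has_derivative_mult_right aff_compose_deriv[OF jet2_first(2)[OF assms(1) assms(3)[OF y]]])
  then show "((\<lambda>y. s i * g i (aff a s y)) has_derivative
     (\<lambda>w. \<Sum>j\<in>UNIV. w $ j * (s i * (s j * H i j (aff a s y))))) (at y)"
    by (simp add: sum_distrib_left algebra_simps)
next
  fix i j
  have "continuous_on T (\<lambda>y. H i j (aff a s y))"
    using assms(1,3) by (intro continuous_on_compose2[OF _ aff_continuous]) (auto simp: jet2_def)
  then show "continuous_on T (\<lambda>y. s i * (s j * H i j (aff a s y)))"
    by (intro continuous_intros)
qed

text \<open>A diagonal map with entries of equal modulus is conformal, so the Laplacian only picks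
  up the factor \<open>r * r\<close>. Translations, dilations and the reflection in one coordinate
  are all instances.\<close>

lemma harmonic_aff:
  assumes "harmonic_on S f" "open T" "\<And>y. y \<in> T \<Longrightarrow> aff a s y \<in> S" "\<And>i. \<bar>s i\<bar> = r"
  shows "harmonic_on T (\<lambda>y. f (aff a s y))"
proof (rule jet2_harmonic[OF jet2_aff[OF harmonic_jet2[OF assms(1)] assms(2,3)]])
  fix y assume y: "y \<in> T"
  have s: "s i * s i = r * r" for i
    using assms(4)[of i] by (metis abs_mult_self_eq)
  have "(\<Sum>i\<in>UNIV. s i * (s i * partial_deriv i (partial_deriv i f) (aff a s y)))
      = (r * r) * (\<Sum>i\<in>UNIV. partial_deriv i (partial_deriv i f) (aff a s y))"
    by (simp add: sum_distrib_left mult.assoc[symmetric] s)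
  then show "(\<Sum>i\<in>UNIV. s i * (s i * partial_deriv i (partial_deriv i f) (aff a s y))) = 0"
    using harmonic_trace[OF assms(1) assms(3)[OF y]] by simp
qed

lemma partial_deriv_aff:
  assumes "harmonic_on S f" "aff a s y \<in> S"
  shows "partial_deriv i (\<lambda>y. f (aff a s y)) y = s i * partial_deriv i f (aff a s y)"
  by (rule partial_deriv_eqI[OF aff_compose_deriv[OF harmonic_has_derivative[OF assms]]])

lemma aff_translate: "aff h (\<lambda>_. 1) y = y + (h::real^'n::finite)"
  by (simp add: aff_def vec_eq_iff)

lemma harmonic_translate:
  assumes "harmonic_on S f" "open T" "\<And>y. y \<in> T \<Longrightarrow> y + h \<in> S"
  shows "harmonic_on T (\<lambda>y. f (y + h))"
  using harmonic_aff[OF assms(1,2), of h "\<lambda>_. 1" 1] assms(3) by (simp add: aff_translate)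

lemma partial_deriv_translate:
  assumes "harmonic_on S f" "y + h \<in> S"
  shows "partial_deriv i (\<lambda>y. f (y + h)) y = partial_deriv i f (y + h)"
  using partial_deriv_aff[OF assms(1), of h "\<lambda>_. 1" y i] assms(2) by (simp add: aff_translate)

subsection \<open>The maximum principle and the gradient estimate\<close>

lemma second_deriv_local_max:
  fixes f :: "real \<Rightarrow> real"
  assumes d: "d > 0" and f': "\<And>t. \<bar>t\<bar> < d \<Longrightarrow> (f has_real_derivative f' t) (at t)"
    and f'': "(f' has_real_derivative c) (at 0)" and max: "\<And>t. \<bar>t\<bar> < d \<Longrightarrow> f t \<le> f 0"
  shows "c \<le> 0"
proof (rule ccontr)
  assume "\<not> c \<le> 0" then have c: "c > 0" by simp
  have f0: "f' 0 = 0"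
    by (rule DERIV_local_max[OF f'[of 0] d]) (use d max in auto)
  obtain e where e: "e > 0" "\<And>h. 0 < h \<Longrightarrow> h < e \<Longrightarrow> f' 0 < f' (0 + h)"
    using DERIV_pos_inc_right[OF f'' c] by auto
  define t where "t = min d e / 2"
  have t: "0 < t" "t < d" "t < e" using d e by (auto simp: t_def)
  obtain z where z: "0 < z" "z < t" "f t - f 0 = (t - 0) * f' z"
    using MVT2[of 0 t f f'] t f' by force
  have "f' z > 0" using e(2)[of z] z t f0 by simp
  then have "t * f' z > 0" using t by (intro mult_pos_pos)
  then have "f t > f 0" using z by simp
  then show False using max[of t] t by simp
qed

lemma line_deriv:
  assumes "(f has_derivative (\<lambda>w. \<Sum>i\<in>UNIV. w $ i * c i)) (at (p + t *\<^sub>R w :: real^'n::finite))"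
  shows "((\<lambda>t. f (p + t *\<^sub>R w)) has_real_derivative (\<Sum>i\<in>UNIV. w $ i * c i)) (at t)"
proof -
  have "((\<lambda>t. p + t *\<^sub>R w) has_derivative (\<lambda>h. h *\<^sub>R w)) (at t)"
    by (auto intro!: derivative_eq_intros)
  from diff_chain_at[OF this assms]
  have "((\<lambda>t. f (p + t *\<^sub>R w)) has_derivative (\<lambda>h. \<Sum>i\<in>UNIV. (h *\<^sub>R w) $ i * c i)) (at t)"
    by (simp add: o_def)
  moreover have "(\<lambda>h. \<Sum>i\<in>UNIV. (h *\<^sub>R w) $ i * c i) = (*) (\<Sum>i\<in>UNIV. w $ i * c i)"
    by (simp add: fun_eq_iff sum_distrib_right sum_distrib_left ac_simps)
  ultimately show ?thesis by (simp add: has_field_derivative_def)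
qed

lemma jet2_local_max:
  assumes j: "jet2 S f g H" and x: "x \<in> S" and max: "\<And>y. y \<in> S \<Longrightarrow> f y \<le> f x"
  shows "H i i x \<le> 0"
proof -
  have op: "open S" using j by (simp add: jet2_def)
  then obtain d where d: "d > 0" "ball x d \<subseteq> S" using x openE by blast
  have inS: "x + t *\<^sub>R axis i 1 \<in> S" if "\<bar>t\<bar> < d" for t
    using that d by (auto simp: subset_iff dist_norm)
  show ?thesis
  proof (rule second_deriv_local_max[OF d(1), of "\<lambda>t. f (x + t *\<^sub>R axis i 1)" "\<lambda>t. g i (x + t *\<^sub>R axis i 1)"])
    show "((\<lambda>t. f (x + t *\<^sub>R axis i 1)) has_real_derivative g i (x + t *\<^sub>R axis i 1)) (at t)" if "\<bar>t\<bar> < d" for t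
      using line_deriv[OF jet2_first(1)[OF j inS[OF that]]] by (simp add: sum_axis)
    show "((\<lambda>t. g i (x + t *\<^sub>R axis i 1)) has_real_derivative H i i x) (at 0)"
      using line_deriv[of "g i" "\<lambda>j. H i j x" x 0 "axis i 1"] jet2_first(2)[OF j x, of i] by (simp add: sum_axis)
  qed (use max inS in auto)
qed

lemma jet2_norm_sq:
  assumes "open S"
  shows "jet2 S (\<lambda>x::real^'n::finite. x \<bullet> x) (\<lambda>i x. 2 * x $ i) (\<lambda>i j x. if i = j then 2 else 0)"
  unfolding jet2_def
proof (intro conjI ballI allI)
  fix x :: "real^'n" 
  show "((\<lambda>x. x \<bullet> x) has_derivative (\<lambda>w. \<Sum>i\<in>UNIV. w $ i * (2 * x $ i))) (at x)"
    by (rule has_derivative_eq_rhs[OF has_derivative_inner[OF has_derivative_ident has_derivative_ident]])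
       (auto simp: inner_vec_def fun_eq_iff sum.distrib[symmetric] sum_distrib_left intro!: sum.cong)
  fix i
  have "((\<lambda>x::real^'n. 2 * x $ i) has_derivative (\<lambda>w. 2 * w $ i)) (at x)"
    by (intro has_derivative_mult_right bounded_linear_imp_has_derivative bounded_linear_vec_nth)
  moreover have "(\<lambda>w::real^'n. \<Sum>j\<in>UNIV. w $ j * (if i = j then 2 else 0)) = (\<lambda>w. 2 * w $ i)"
    by (auto simp: fun_eq_iff if_distrib cong: if_cong)
  ultimately show "((\<lambda>x. 2 * x $ i) has_derivative (\<lambda>w. \<Sum>j\<in>UNIV. w $ j * (if i = j then 2 else 0))) (at x)"
    by simp
qed (use assms in auto)

text \<open>Adding \<open>e * (y \<bullet> y)\<close> makes the Laplacian positive, while at an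
  interior maximum every pure second derivative is nonpositive. The perturbed function therefore
  attains its maximum on the frontier, and \<open>e\<close> tends to 0.\<close>

lemma max_principle:
  fixes w :: "real^'n::finite \<Rightarrow> real"
  assumes j: "harmonic_on U w" and U: "bounded U" and cont: "continuous_on (closure U) w"
    and fr: "\<And>x. x \<in> frontier U \<Longrightarrow> w x \<le> 0" and x: "x \<in> U"
  shows "w x \<le> 0"
proof -
  have op: "open U" using j by (rule harmonic_open)
  obtain D where D: "\<And>y. y \<in> closure U \<Longrightarrow> norm y \<le> D"
    using U by (metis bounded_closure bounded_iff)
  have D2: "y \<bullet> y \<le> D\<^sup>2" if "y \<in> closure U" for y
    using D[OF that] by (simp add: dot_square_norm power_mono)
  have *: "w x \<le> e * D\<^sup>2" if e: "e > 0" for e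
  proof -
    define f where "f y = 1 * w y + e * (y \<bullet> y)" for y
    have jf: "jet2 U f (\<lambda>i x. 1 * partial_deriv i w x + e * (2 * x $ i))
       (\<lambda>i k x. 1 * partial_deriv k (partial_deriv i w) x + e * (if i = k then 2 else 0))"
      unfolding f_def using jet2_lin[OF harmonic_jet2[OF j] jet2_norm_sq[OF op]] .
    have "continuous_on (closure U) f"
      unfolding f_def by (intro continuous_intros cont)
    moreover have "compact (closure U)" using U by simp
    moreover have "closure U \<noteq> {}" using x closure_subset by blast
    ultimately obtain z where z: "z \<in> closure U" "\<And>y. y \<in> closure U \<Longrightarrow> f y \<le> f z"
      using continuous_attains_sup by metis
    have "z \<notin> U"
    proof
      assume zU: "z \<in> U"
      have "1 * partial_deriv i (partial_deriv i w) z + e * (if i = i then 2 else 0) \<le> 0" for i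
        by (rule jet2_local_max[OF jf zU]) (use z closure_subset in blast)
      then have "(\<Sum>i\<in>UNIV. partial_deriv i (partial_deriv i w) z + e * 2) \<le> 0"
        by (intro sum_nonpos) auto
      then have "(\<Sum>i\<in>UNIV. partial_deriv i (partial_deriv i w) z) + real CARD('n) * (e * 2) \<le> 0"
        by (simp add: sum.distrib)
      moreover have "real CARD('n) * (e * 2) > 0" using e by simp
      ultimately show False using harmonic_trace[OF j zU] by simp
    qed
    then have "z \<in> frontier U" using z op by (simp add: frontier_def interior_open)
    then have "w z \<le> 0" by (rule fr)
    moreover have "e * (z \<bullet> z) \<le> e * D\<^sup>2" using D2[OF z(1)] e by (intro mult_left_mono) auto
    ultimately have "f z \<le> e * D\<^sup>2" by (simp add: f_def)
    moreover have "f x \<le> f z" using z x closure_subset by blast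
    moreover have "w x \<le> f x" using e by (simp add: f_def)
    ultimately show ?thesis by simp
  qed
  show ?thesis
  proof (rule field_le_epsilon)
    fix e :: real assume e: "e > 0"
    have "w x \<le> e / (D\<^sup>2 + 1) * D\<^sup>2" by (rule *) (use e in \<open>simp add: add_nonneg_pos\<close>)
    also have "\<dots> \<le> e" using e by (simp add: divide_le_eq add_nonneg_pos algebra_simps not_less)
    finally show "w x \<le> 0 + e" by simp
  qed
qed

lemma jet2_coord_quad:
  assumes "open S"
  shows "jet2 S (\<lambda>x::real^'n::finite. d * x $ i - (x $ i)\<^sup>2) (\<lambda>j x. if j = i then d - 2 * x $ i else 0)
           (\<lambda>j l x. if j = i \<and> l = i then - 2 else 0)"
  unfolding jet2_def
proof (intro conjI ballI allI)
  fix x :: "real^'n"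
  have nth: "((\<lambda>x::real^'n. x $ i) has_derivative (\<lambda>w. w $ i)) (at x)"
    by (intro bounded_linear_imp_has_derivative bounded_linear_vec_nth)
  have "((\<lambda>x. d * x $ i - (x $ i)\<^sup>2) has_derivative (\<lambda>w. w $ i * (d - 2 * x $ i))) (at x)"
    by (auto intro!: derivative_eq_intros nth simp: fun_eq_iff algebra_simps)
  moreover have "(\<lambda>w::real^'n. \<Sum>j\<in>UNIV. w $ j * (if j = i then d - 2 * x $ i else 0)) = (\<lambda>w. w $ i * (d - 2 * x $ i))"
    by (auto simp: fun_eq_iff if_distrib cong: if_cong)
  ultimately show "((\<lambda>x. d * x $ i - (x $ i)\<^sup>2) has_derivative
      (\<lambda>w. \<Sum>j\<in>UNIV. w $ j * (if j = i then d - 2 * x $ i else 0))) (at x)" by simp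
  fix j
  have "((\<lambda>x. if j = i then d - 2 * x $ i else 0) has_derivative (\<lambda>w. if j = i then - 2 * w $ i else 0)) (at x)"
    by (cases "j = i") (auto intro!: derivative_eq_intros nth simp: fun_eq_iff)
  moreover have "(\<lambda>w::real^'n. \<Sum>l\<in>UNIV. w $ l * (if j = i \<and> l = i then - 2 else 0)) = (\<lambda>w. if j = i then - 2 * w $ i else 0)"
    by (auto simp: fun_eq_iff if_distrib cong: if_cong)
  ultimately show "((\<lambda>x. if j = i then d - 2 * x $ i else 0) has_derivative
      (\<lambda>w. \<Sum>l\<in>UNIV. w $ l * (if j = i \<and> l = i then - 2 else 0))) (at x)" by simp
qed (use assms in auto)

text \<open>Comparison function for the gradient estimate. The Laplacian of
  \<open>x \<bullet> x\<close> is twice the dimension, and the concave quadratic in coordinate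
  \<open>i\<close>, which vanishes at 0 and \<open>d\<close>, is scaled to cancel exactly
  that.\<close>

lemma harmonic_barrier:
  assumes "open S"
  shows "harmonic_on S (\<lambda>x::real^'n::finite. 1 * (x \<bullet> x) + real CARD('n) * (d * x $ i - (x $ i)\<^sup>2))"
proof (rule jet2_harmonic[OF jet2_lin[OF jet2_norm_sq jet2_coord_quad]])
  fix x :: "real^'n"
  have "(\<Sum>j\<in>UNIV. 1 * (if j = j then 2 else 0) + real CARD('n) * (if j = i \<and> j = i then - 2 else 0)) =
     (\<Sum>j\<in>(UNIV::'n set). 2 + (if j = i then - 2 * real CARD('n) else 0))"
    by (intro sum.cong) auto
  also have "\<dots> = 0" by (simp add: sum.distrib)
  finally show "(\<Sum>j\<in>UNIV. 1 * (if j = j then 2 else 0) + real CARD('n) * (if j = i \<and> j = i then - 2 else 0)) = 0" .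
qed (use assms in auto)

text \<open>The odd part of \<open>u\<close> in the \<open>i\<close>-th variable is compared on a half cube with a harmonic
  quadratic polynomial that vanishes at the centre.\<close>

lemma odd_part_bound:
  fixes u :: "real^'n::finite \<Rightarrow> real"
  assumes u: "harmonic_on S u" and d: "d > 0"
    and cube: "\<And>y. (\<And>j. \<bar>y $ j - c $ j\<bar> \<le> d) \<Longrightarrow> y \<in> S \<and> \<bar>u y\<bar> \<le> M"
    and t: "0 < t" "t < d"
  shows "u (c + t *\<^sub>R axis i 1) - u (c - t *\<^sub>R axis i 1) \<le> 2 * (real CARD('n) * M / d * t)"
proof -
  let ?n = "real CARD('n)"
  define s :: "'n \<Rightarrow> real" where "s j = (if j = i then - 1 else 1)" for j
  define lo hi :: "real^'n" where "lo = (\<chi> j. if j = i then 0 else - d)" and "hi = (\<chi> j. d)"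
  define U where "U = box lo hi"
  define q where "q y = 1 * (y \<bullet> y) + ?n * (d * y $ i - (y $ i)\<^sup>2)" for y :: "real^'n"
  define w where "w y = 1 * (1/2 * u (aff c (\<lambda>_. 1) y) + (- 1/2) * u (aff c s y)) + (- M / d\<^sup>2) * q y" for y
  have M: "0 \<le> M" using cube[of c] d by force
  have cl: "y \<in> cbox lo hi \<longleftrightarrow> (\<forall>j. \<bar>y $ j\<bar> \<le> d) \<and> 0 \<le> y $ i" for y
  proof -
    have "(lo $ j \<le> y $ j \<and> y $ j \<le> hi $ j) = (\<bar>y $ j\<bar> \<le> d \<and> (j = i \<longrightarrow> 0 \<le> y $ i))" for j
      using d by (auto simp: lo_def hi_def)
    then show ?thesis unfolding mem_box_cart by auto
  qed
  have inU: "y \<in> U \<longleftrightarrow> (\<forall>j. \<bar>y $ j\<bar> < d) \<and> 0 < y $ i" for y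
  proof -
    have "(lo $ j < y $ j \<and> y $ j < hi $ j) = (\<bar>y $ j\<bar> < d \<and> (j = i \<longrightarrow> 0 < y $ i))" for j
      using d by (auto simp: lo_def hi_def)
    then show ?thesis unfolding U_def mem_box_cart by auto
  qed
  have affS: "aff c (\<lambda>_. 1) y \<in> S \<and> \<bar>u (aff c (\<lambda>_. 1) y)\<bar> \<le> M" "aff c s y \<in> S \<and> \<bar>u (aff c s y)\<bar> \<le> M"
    if "y \<in> cbox lo hi" for y
  proof -
    have a: "\<bar>y $ j\<bar> \<le> d" for j using that unfolding cl by blast
    then have "\<bar>s j * y $ j\<bar> \<le> d" for j by (simp add: s_def abs_mult)
    then show "aff c (\<lambda>_. 1) y \<in> S \<and> \<bar>u (aff c (\<lambda>_. 1) y)\<bar> \<le> M" "aff c s y \<in> S \<and> \<bar>u (aff c s y)\<bar> \<le> M"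
      using a by (intro cube; simp add: aff_def)+
  qed
  have Ucl: "U \<subseteq> cbox lo hi" unfolding U_def by (rule box_subset_cbox)
  have opU: "open U" by (simp add: U_def open_box)
  have tU: "t *\<^sub>R axis i 1 \<in> U" unfolding inU using t by (auto simp: axis_def)
  have clU: "closure U = cbox lo hi" using tU by (auto simp: U_def intro!: closure_box)
  have wh: "harmonic_on U w"
    unfolding w_def q_def
    by (intro harmonic_lin harmonic_barrier opU harmonic_aff[OF u opU, of _ _ 1]) (use affS Ucl in \<open>auto simp: s_def\<close>)
  have cont: "continuous_on (closure U) w"
    unfolding w_def q_def clU
    by (intro continuous_intros continuous_on_compose2[OF harmonic_continuous[OF u] aff_continuous]) (use affS in auto)
  have "w (t *\<^sub>R axis i 1) \<le> 0"
  proof (rule max_principle[OF wh _ cont _ tU])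
    show "bounded U" by (simp add: U_def)
    fix y assume "y \<in> frontier U"
    then have y: "y \<in> cbox lo hi" "y \<notin> U" using tU by (auto simp: U_def frontier_box split: if_splits)
    \<comment> \<open>The frontier has two kinds of points. On the face \<open>y $ i = 0\<close> the
      odd part vanishes; on a face at distance \<open>d\<close> this inequality gives
      \<open>q y \<ge> d\<^sup>2\<close>, so that the multiple \<open>M / d\<^sup>2\<close> of
      \<open>q\<close> absorbs the bound \<open>M\<close>.\<close>
    have qp: "q y \<ge> y \<bullet> y"
    proof -
      have "\<bar>y $ i\<bar> \<le> d" "0 \<le> y $ i" using y(1) unfolding cl by blast+
      then have "0 \<le> d - y $ i" "0 \<le> y $ i" by linarith+
      then have "0 \<le> y $ i * (d - y $ i)" by (intro mult_nonneg_nonneg) auto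
      then have "0 \<le> d * y $ i - (y $ i)\<^sup>2" by (simp add: algebra_simps power2_eq_square)
      then have "0 \<le> ?n * (d * y $ i - (y $ i)\<^sup>2)" by simp
      then show ?thesis by (simp add: q_def)
    qed
    show "w y \<le> 0"
    proof (cases "y $ i = 0")
      case True
      then have "aff c s y = aff c (\<lambda>_. 1) y" by (simp add: aff_def vec_eq_iff s_def)
      moreover have "0 \<le> M / d\<^sup>2 * q y" using M by (intro mult_nonneg_nonneg order_trans[OF inner_ge_zero qp]) auto
      ultimately show ?thesis by (simp add: w_def)
    next
      case False
      then obtain j where j: "\<bar>y $ j\<bar> = d" using y unfolding cl inU by (metis order_le_less)
      have "d\<^sup>2 = (y $ j)\<^sup>2" using j by (metis power2_abs)
      also have "\<dots> \<le> y \<bullet> y" unfolding inner_vec_def power2_eq_square inner_real_def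
        by (rule member_le_sum[of j UNIV "\<lambda>i. y $ i * y $ i"]) auto
      finally have "d\<^sup>2 \<le> q y" using qp by simp
      then have "M / d\<^sup>2 * d\<^sup>2 \<le> M / d\<^sup>2 * q y" using M by (intro mult_left_mono) auto
      then have "M \<le> M / d\<^sup>2 * q y" using d by simp
      then show ?thesis using affS[OF y(1)] by (simp add: w_def abs_le_iff)
    qed
  qed
  moreover have "aff c (\<lambda>_. 1) (t *\<^sub>R axis i 1) = c + t *\<^sub>R axis i 1" "aff c s (t *\<^sub>R axis i 1) = c - t *\<^sub>R axis i 1"
    by (auto simp: aff_def vec_eq_iff s_def axis_def)
  moreover have "M / d\<^sup>2 * q (t *\<^sub>R axis i 1) \<le> ?n * M / d * t"
  proof -
    have n1: "?n \<ge> 1" by (simp add: Suc_leI)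
    have "q (t *\<^sub>R axis i 1) = t * t + ?n * (d * t - t\<^sup>2)" by (simp add: q_def inner_axis_axis)
    also have "\<dots> \<le> ?n * d * t"
      using mult_right_mono[OF n1, of "t * t"] by (simp add: algebra_simps power2_eq_square)
    finally have "M / d\<^sup>2 * q (t *\<^sub>R axis i 1) \<le> M / d\<^sup>2 * (?n * d * t)" using M by (intro mult_left_mono) auto
    also have "\<dots> = ?n * M / d * t" using d by (simp add: power2_eq_square field_simps)
    finally show ?thesis .
  qed
  ultimately show ?thesis by (simp add: w_def)
qed

text \<open>Derivative of \<open>odd_part_bound\<close> at \<open>t = 0\<close>: the odd difference
  has slope twice the partial derivative, so a larger slope would violate the bound for small
  \<open>t\<close>.\<close>

lemma partial_deriv_cube_upper:
  fixes u :: "real^'n::finite \<Rightarrow> real"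
  assumes u: "harmonic_on S u" and d: "d > 0"
    and cube: "\<And>y. (\<And>j. \<bar>y $ j - c $ j\<bar> \<le> d) \<Longrightarrow> y \<in> S \<and> \<bar>u y\<bar> \<le> M"
  shows "partial_deriv i u c \<le> real CARD('n) * M / d"
proof (rule ccontr)
  let ?L = "real CARD('n) * M / d"
  assume "\<not> partial_deriv i u c \<le> ?L"
  define F where "F t = u (c + t *\<^sub>R axis i 1) - u (c + t *\<^sub>R (- axis i 1)) - 2 * ?L * t" for t
  have c: "c \<in> S" using cube[of c] d by force
  have 1: "((\<lambda>t. u (c + t *\<^sub>R axis i 1)) has_real_derivative partial_deriv i u c) (at 0)"
    using line_deriv[where f=u and p=c and t=0 and w="axis i 1"] harmonic_has_derivative[OF u c] by (simp add: sum_axis)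
  have 2: "((\<lambda>t. u (c + t *\<^sub>R (- axis i 1))) has_real_derivative - partial_deriv i u c) (at 0)"
    using line_deriv[where f=u and p=c and t=0 and w="- axis i 1"] harmonic_has_derivative[OF u c] by (simp add: sum_axis sum_negf)
  have "(F has_real_derivative 2 * (partial_deriv i u c - ?L)) (at 0)"
    unfolding F_def by (rule derivative_eq_intros 1 2 refl)+ simp
  moreover have "2 * (partial_deriv i u c - ?L) > 0" using \<open>\<not> partial_deriv i u c \<le> ?L\<close> by simp
  ultimately obtain e where e: "e > 0" "\<And>h. 0 < h \<Longrightarrow> h < e \<Longrightarrow> F 0 < F (0 + h)"
    using DERIV_pos_inc_right by blast
  define t where "t = min d e / 2"
  have t: "0 < t" "t < d" "t < e" using d e by (auto simp: t_def)
  have "F t > 0" using e(2)[OF t(1,3)] by (simp add: F_def)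
  moreover have "F t \<le> 0" using odd_part_bound[OF u d cube t(1,2), where i=i and c=c] by (simp add: F_def)
  ultimately show False by simp
qed

lemma partial_deriv_cube:
  fixes u :: "real^'n::finite \<Rightarrow> real"
  assumes u: "harmonic_on S u" and d: "d > 0"
    and cube: "\<And>y. (\<And>j. \<bar>y $ j - c $ j\<bar> \<le> d) \<Longrightarrow> y \<in> S \<and> \<bar>u y\<bar> \<le> M"
  shows "\<bar>partial_deriv i u c\<bar> \<le> real CARD('n) * M / d"
proof -
  have c: "c \<in> S" using cube[of c] d by force
  have "partial_deriv i (\<lambda>x. - 1 * u x) c \<le> real CARD('n) * M / d"
    by (rule partial_deriv_cube_upper[OF harmonic_cmult[OF u] d]) (use cube in auto)
  moreover have "partial_deriv i (\<lambda>x. - 1 * u x) c = - partial_deriv i u c"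
    using partial_deriv_lin[OF u u c, of i "- 1" 0] by simp
  ultimately show ?thesis using partial_deriv_cube_upper[OF u d cube, where i=i and c=c] by (simp add: abs_le_iff)
qed

lemma partial_deriv_ball:
  fixes u :: "real^'n::finite \<Rightarrow> real"
  assumes u: "harmonic_on S u" and r: "r > 0" "ball c r \<subseteq> S" and M: "\<And>y. y \<in> ball c r \<Longrightarrow> \<bar>u y\<bar> \<le> M"
  shows "\<bar>partial_deriv i u c\<bar> \<le> 2 * (real CARD('n))\<^sup>2 / r * M"
proof -
  let ?n = "real CARD('n)"
  have n: "?n > 0" by simp
  \<comment> \<open>The cube of half side \<open>d\<close> has radius \<open>r / 2\<close> in the l1
    norm and hence lies in the ball; this costs the second factor of the dimension.\<close>
  define d where "d = r / (2 * ?n)"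
  have d: "d > 0" using r n by (simp add: d_def)
  have "y \<in> ball c r" if "\<And>j. \<bar>y $ j - c $ j\<bar> \<le> d" for y
  proof -
    have "norm (y - c) \<le> (\<Sum>j\<in>UNIV. \<bar>(y - c) $ j\<bar>)" by (rule norm_le_l1_cart)
    also have "\<dots> \<le> (\<Sum>j\<in>(UNIV::'n set). d)" using that by (intro sum_mono) auto
    also have "\<dots> = r / 2" using n by (simp add: d_def)
    finally show ?thesis using r by (simp add: dist_norm norm_minus_commute)
  qed
  then have "\<bar>partial_deriv i u c\<bar> \<le> ?n * M / d"
    by (intro partial_deriv_cube[OF u d]) (use r M in blast)
  also have "\<dots> = 2 * ?n\<^sup>2 / r * M" using n r by (simp add: d_def power2_eq_square field_simps)
  finally show ?thesis .
qed

section \<open>Partial derivatives of harmonic functions are harmonic\<close>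

lemma harmonic_local:
  assumes "open S" "\<And>x. x \<in> S \<Longrightarrow> \<exists>T. x \<in> T \<and> harmonic_on T f"
  shows "harmonic_on S f"
  unfolding harmonic_on_def C2_on_def
proof (intro conjI ballI allI)
  fix x assume "x \<in> S"
  then obtain T where "x \<in> T" "harmonic_on T f" using assms(2) by blast
  then show "f differentiable at x" "laplacian f x = 0" "\<And>i. partial_deriv i f differentiable at x"
    by (auto simp: harmonic_on_def C2_on_def)
next
  fix i j
  show "continuous_on S (partial_deriv j (partial_deriv i f))"
    unfolding continuous_on_eq_continuous_at[OF assms(1)]
  proof
    fix x assume "x \<in> S"
    then obtain T where "x \<in> T" "harmonic_on T f" using assms(2) by blast
    then show "isCont (partial_deriv j (partial_deriv i f)) x"
      by (auto simp: harmonic_on_def C2_on_def continuous_on_eq_continuous_at)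
  qed
qed (rule assms(1))

text \<open>Written as a linear combination of a translate and the function itself, so that
  \<open>harmonic_lin\<close> and \<open>partial_deriv_lin\<close> apply literally.\<close>

definition diffq :: "'n::finite \<Rightarrow> real \<Rightarrow> (real^'n \<Rightarrow> real) \<Rightarrow> real^'n \<Rightarrow> real" where
  "diffq j h f x = 1 / h * f (x + h *\<^sub>R axis j 1) + (- 1 / h) * f x"

lemma norm_add_axis: "y \<in> ball c r \<Longrightarrow> \<bar>h\<bar> \<le> s \<Longrightarrow> y + h *\<^sub>R axis j (1::real) \<in> ball c (r + s)"
proof -
  assume a: "y \<in> ball c r" "\<bar>h\<bar> \<le> s"
  have "norm (y + h *\<^sub>R axis j (1::real) - c) \<le> norm (y - c) + norm (h *\<^sub>R axis j (1::real) :: real^'a)"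
    by (metis add_diff_eq add.commute diff_add_eq norm_triangle_ineq)
  also have "\<dots> < r + s" using a by (simp add: dist_norm norm_minus_commute)
  finally show ?thesis by (simp add: dist_norm norm_minus_commute)
qed

lemma harmonic_diffq:
  assumes f: "harmonic_on S f" and S: "ball c (r + s) \<subseteq> S" and h: "\<bar>h\<bar> \<le> s"
  shows "harmonic_on (ball c r) (diffq j h f)"
    and "x \<in> ball c r \<Longrightarrow> partial_deriv i (diffq j h f) x = diffq j h (partial_deriv i f) x"
proof -
  have s: "s \<ge> 0" using h by linarith
  have in1: "y + h *\<^sub>R axis j 1 \<in> S" if "y \<in> ball c r" for y using norm_add_axis[OF that h] S by blast
  have t: "harmonic_on (ball c r) (\<lambda>y. f (y + h *\<^sub>R axis j 1))"
    by (rule harmonic_translate[OF f]) (use in1 in auto)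
  have sub: "ball c r \<subseteq> S" using S s by (metis subset_ball le_add_same_cancel1 order_trans)
  have f': "harmonic_on (ball c r) f" by (rule harmonic_subset[OF f _ sub]) simp
  show "harmonic_on (ball c r) (diffq j h f)"
    unfolding diffq_def[abs_def] by (rule harmonic_lin[OF t f'])
  show "partial_deriv i (diffq j h f) x = diffq j h (partial_deriv i f) x" if "x \<in> ball c r"
    unfolding diffq_def[abs_def] partial_deriv_lin[OF t f' that] partial_deriv_translate[OF f in1[OF that]] ..
qed

lemma diffq_mean_value:
  assumes f: "\<And>t. \<bar>t\<bar> \<le> \<bar>h\<bar> \<Longrightarrow> f differentiable at (x + t *\<^sub>R axis j 1)" and h: "h \<noteq> 0"
  obtains t where "\<bar>t\<bar> \<le> \<bar>h\<bar>" "diffq j h f x = partial_deriv j f (x + t *\<^sub>R axis j 1)"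
proof -
  define g where "g t = f (x + t *\<^sub>R axis j 1)" for t
  have g: "(g has_real_derivative partial_deriv j f (x + t *\<^sub>R axis j 1)) (at t)" if "\<bar>t\<bar> \<le> \<bar>h\<bar>" for t
    unfolding g_def using line_deriv[OF has_derivative_sum_partial[OF f[OF that]]] by (simp add: sum_axis)
  have "\<exists>t. \<bar>t\<bar> \<le> \<bar>h\<bar> \<and> g h - g 0 = h * partial_deriv j f (x + t *\<^sub>R axis j 1)"
  proof (cases "h > 0")
    case True
    then obtain z where "0 < z" "z < h" "g h - g 0 = (h - 0) * partial_deriv j f (x + z *\<^sub>R axis j 1)"
      using MVT2[of 0 h g "\<lambda>t. partial_deriv j f (x + t *\<^sub>R axis j 1)"] g by force
    then show ?thesis by (intro exI[of _ z]) auto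
  next
    case False
    then have "h < 0" using h by simp
    then obtain z where "h < z" "z < 0" "g 0 - g h = (0 - h) * partial_deriv j f (x + z *\<^sub>R axis j 1)"
      using MVT2[of h 0 g "\<lambda>t. partial_deriv j f (x + t *\<^sub>R axis j 1)"] g by force
    then show ?thesis by (intro exI[of _ z]) auto
  qed
  then obtain t where "\<bar>t\<bar> \<le> \<bar>h\<bar>" "g h - g 0 = h * partial_deriv j f (x + t *\<^sub>R axis j 1)" by blast
  then show ?thesis using that[of t] h by (simp add: diffq_def g_def field_simps)
qed

lemma diffq_tendsto:
  assumes f: "f differentiable at x" and h: "h \<longlonglongrightarrow> 0" "\<And>k. h k \<noteq> 0"
  shows "(\<lambda>k. diffq j (h k) f x) \<longlonglongrightarrow> partial_deriv j f x"
proof -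
  have "((\<lambda>t. f (x + t *\<^sub>R axis j 1)) has_real_derivative partial_deriv j f x) (at 0)"
    using line_deriv[where f=f and p=x and t=0 and w="axis j 1"] has_derivative_sum_partial[OF f] by (simp add: sum_axis)
  then have "(\<lambda>t. (f (x + t *\<^sub>R axis j 1) - f x) / t) \<midarrow>0\<rightarrow> partial_deriv j f x"
    by (simp add: DERIV_def)
  then have "(\<lambda>k. (f (x + h k *\<^sub>R axis j 1) - f x) / h k) \<longlonglongrightarrow> partial_deriv j f x"
    using h by (auto simp: tendsto_at_iff_sequentially o_def)
  then show ?thesis by (simp add: diffq_def diff_divide_distrib)
qed

text \<open>The gradient estimate cannot simply be iterated, because the partial derivative of a C2
  harmonic function is not known to be harmonic at this stage. It is applied to difference quotients
  of \<open>v\<close>, which are harmonic and, by the mean value theorem, bounded uniformly in the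
  step.\<close>

lemma second_partial_ball:
  fixes v :: "real^'n::finite \<Rightarrow> real"
  assumes v: "harmonic_on S v" and r: "r > 0" "ball c (2 * r) \<subseteq> S" and M: "\<And>y. y \<in> ball c (2 * r) \<Longrightarrow> \<bar>v y\<bar> \<le> M"
  shows "\<bar>partial_deriv l (partial_deriv i v) c\<bar> \<le> 2 * (2 * (real CARD('n))\<^sup>2 / r)\<^sup>2 * M"
proof -
  define C where "C = 2 * (real CARD('n))\<^sup>2"
  have d1: "\<bar>partial_deriv l v x\<bar> \<le> C / r * M" if "x \<in> ball c r" for x
  proof -
    have "ball x r \<subseteq> ball c (2 * r)" using that by (intro ball_subset_ball_iff[THEN iffD2]) (auto simp: dist_commute)
    then show ?thesis unfolding C_def using r M by (intro partial_deriv_ball[OF v]) auto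
  qed
  have d2: "\<bar>diffq l h (partial_deriv i v) c\<bar> \<le> 2 * (C / r)\<^sup>2 * M" if h: "h \<noteq> 0" "\<bar>h\<bar> < r / 2" for h
  proof -
    have sub: "ball c (r / 2 + r / 2) \<subseteq> S" using r by (auto simp: subset_iff)
    have hq: "harmonic_on (ball c (r / 2)) (diffq l h v)"
      "partial_deriv i (diffq l h v) c = diffq l h (partial_deriv i v) c"
      using harmonic_diffq[OF v sub, where h=h and j=l] h r by auto
    have "\<bar>partial_deriv i (diffq l h v) c\<bar> \<le> 2 * (real CARD('n))\<^sup>2 / (r / 2) * (C / r * M)"
    proof (rule partial_deriv_ball[OF hq(1)])
      fix y assume y: "y \<in> ball c (r / 2)"
      have yt: "y + t *\<^sub>R axis l 1 \<in> ball c r" if "\<bar>t\<bar> \<le> \<bar>h\<bar>" for t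
        using norm_add_axis[OF y, where h=t and s="r/2" and j=l] that h by simp
      obtain t where "\<bar>t\<bar> \<le> \<bar>h\<bar>" "diffq l h v y = partial_deriv l v (y + t *\<^sub>R axis l 1)"
      proof (rule diffq_mean_value)
        show "v differentiable at (y + t *\<^sub>R axis l 1)" if "\<bar>t\<bar> \<le> \<bar>h\<bar>" for t
          using v yt[OF that] r by (auto simp: harmonic_on_def C2_on_def subset_iff)
      qed (use h in auto)
      then show "\<bar>diffq l h v y\<bar> \<le> C / r * M" using d1[OF yt] by simp
    qed (use r in auto)
    also have "\<dots> = 2 * (C / r)\<^sup>2 * M" by (simp add: C_def power2_eq_square)
    finally show ?thesis by (simp add: hq)
  qed
  \<comment> \<open>Two successors keep \<open>h k\<close> strictly below \<open>r / 2\<close>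
    already at \<open>k = 0\<close>.\<close>
  define h where "h k = r / (2 * real (Suc (Suc k)))" for k
  have h: "h k \<noteq> 0" "\<bar>h k\<bar> < r / 2" for k using r by (auto simp: h_def divide_simps intro!: add_pos_nonneg)
  have "(\<lambda>k. r / 2 * inverse (real (Suc (Suc k)))) \<longlonglongrightarrow> r / 2 * 0"
    by (intro tendsto_mult tendsto_const LIMSEQ_Suc[OF LIMSEQ_inverse_real_of_nat])
  then have h0: "h \<longlonglongrightarrow> 0" by (simp add: h_def[abs_def] field_simps)
  have "partial_deriv i v differentiable at c" using v r by (auto simp: harmonic_on_def C2_on_def subset_iff)
  then have "(\<lambda>k. \<bar>diffq l (h k) (partial_deriv i v) c\<bar>) \<longlonglongrightarrow> \<bar>partial_deriv l (partial_deriv i v) c\<bar>"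
    by (intro tendsto_rabs diffq_tendsto h0 h)
  then show ?thesis unfolding C_def[symmetric]
    by (rule tendsto_upperbound) (use d2 h in auto)
qed

text \<open>Coordinate form of the theorem on sequences with uniformly convergent derivatives:
  uniform convergence of each partial derivative bounds the difference of the linear maps by
  \<open>e * norm w\<close>.\<close>

lemma sum_partial_limit:
  fixes f :: "nat \<Rightarrow> real^'n::finite \<Rightarrow> real"
  assumes B: "open B" "convex B"
    and d: "\<And>k x. x \<in> B \<Longrightarrow> (f k has_derivative (\<lambda>w. \<Sum>i\<in>UNIV. w $ i * g k i x)) (at x)"
    and u: "\<And>i. uniform_limit B (\<lambda>k. g k i) (G i) sequentially"
    and l: "\<And>x. x \<in> B \<Longrightarrow> (\<lambda>k. f k x) \<longlonglongrightarrow> F x"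
    and x: "x \<in> B"
  shows "(F has_derivative (\<lambda>w. \<Sum>i\<in>UNIV. w $ i * G i x)) (at x)"
proof -
  have "\<exists>F'. \<forall>x\<in>B. (\<lambda>k. f k x) \<longlonglongrightarrow> F' x \<and> (F' has_derivative (\<lambda>w. \<Sum>i\<in>UNIV. w $ i * G i x)) (at x within B)"
  proof (rule has_derivative_sequence[OF B(2)])
    show "(f k has_derivative (\<lambda>w. \<Sum>i\<in>UNIV. w $ i * g k i x)) (at x within B)" if "x \<in> B" for k x
      using d[OF that] has_derivative_at_withinI by blast
    show "\<forall>\<^sub>F k in sequentially. \<forall>x\<in>B. \<forall>w. norm ((\<Sum>i\<in>UNIV. w $ i * g k i x) - (\<Sum>i\<in>UNIV. w $ i * G i x)) \<le> e * norm w"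
      if e: "e > 0" for e
    proof -
      have "\<forall>\<^sub>F k in sequentially. \<forall>i\<in>UNIV. \<forall>x\<in>B. dist (g k i x) (G i x) < e / real CARD('n)"
        using e by (intro eventually_ball_finite ballI uniform_limitD[OF u]) auto
      then show ?thesis
      proof eventually_elim
        case (elim k)
        show ?case
        proof (intro ballI allI)
          fix x and w :: "real^'n" assume x: "x \<in> B"
          have "norm ((\<Sum>i\<in>UNIV. w $ i * g k i x) - (\<Sum>i\<in>UNIV. w $ i * G i x))
             = \<bar>\<Sum>i\<in>UNIV. w $ i * (g k i x - G i x)\<bar>"
            by (simp add: sum_subtractf right_diff_distrib)
          also have "\<dots> \<le> (\<Sum>i\<in>UNIV. \<bar>w $ i * (g k i x - G i x)\<bar>)" by (rule sum_abs)
          also have "\<dots> \<le> (\<Sum>i\<in>(UNIV::'n set). norm w * (e / real CARD('n)))"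
          proof (rule sum_mono)
            fix i
            have "\<bar>g k i x - G i x\<bar> \<le> e / real CARD('n)" using elim x by (simp add: dist_real_def less_imp_le)
            then show "\<bar>w $ i * (g k i x - G i x)\<bar> \<le> norm w * (e / real CARD('n))"
              unfolding abs_mult by (intro mult_mono component_le_norm_cart) auto
          qed
          also have "\<dots> = e * norm w" by simp
          finally show "norm ((\<Sum>i\<in>UNIV. w $ i * g k i x) - (\<Sum>i\<in>UNIV. w $ i * G i x)) \<le> e * norm w" .
        qed
      qed
    qed
  qed (use x l in auto)
  then obtain F' where F': "\<And>x. x \<in> B \<Longrightarrow> (\<lambda>k. f k x) \<longlonglongrightarrow> F' x"
    "\<And>x. x \<in> B \<Longrightarrow> (F' has_derivative (\<lambda>w. \<Sum>i\<in>UNIV. w $ i * G i x)) (at x within B)" by blast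
  have "F' y = F y" if "y \<in> B" for y using LIMSEQ_unique F'(1) l that by blast
  then show ?thesis
    using has_derivative_cong_open[OF B(1) x, of F' F] F'(2)[OF x] at_within_open[OF x B(1)] by auto
qed

text \<open>The difference quotients in direction \<open>j\<close> converge uniformly to the partial
  derivative. Interior estimates for their differences carry the convergence over to first and
  second derivatives, so the limit is C2 and harmonic. Identifying the limit of the first
  derivatives by \<open>diffq_tendsto\<close> yields the symmetry of second derivatives as a
  by-product.\<close>

lemma harmonic_partial_local:
  fixes v :: "real^'n::finite \<Rightarrow> real"
  assumes v: "harmonic_on S v" and r: "r > 0" "ball x0 (5 * r) \<subseteq> S"
  shows "harmonic_on (ball x0 r) (partial_deriv j v)
    \<and> (\<forall>x\<in>ball x0 r. \<forall>i. partial_deriv i (partial_deriv j v) x = partial_deriv j (partial_deriv i v) x)"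
proof -
  define B where "B = ball x0 r"
  define h where "h k = r / (real (Suc (Suc k)))" for k
  have h: "h k \<noteq> 0" "0 < h k" "\<bar>h k\<bar> \<le> r" for k using r by (auto simp: h_def field_simps)
  have "(\<lambda>k. r * inverse (real (Suc (Suc k)))) \<longlonglongrightarrow> r * 0"
    by (intro tendsto_mult tendsto_const LIMSEQ_Suc[OF LIMSEQ_inverse_real_of_nat])
  then have h0: "h \<longlonglongrightarrow> 0" by (simp add: h_def[abs_def] field_simps)
  define w where "w k = diffq j (h k) v" for k
  have sub: "ball x0 (3 * r + r) \<subseteq> S" using r by (auto simp: subset_iff)
  have wh: "harmonic_on (ball x0 (3 * r)) (w k)" for k
    unfolding w_def by (rule harmonic_diffq(1)[OF v sub h(3)])
  have wp: "partial_deriv i (w k) x = diffq j (h k) (partial_deriv i v) x" if "x \<in> ball x0 (3 * r)" for i k x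
    unfolding w_def by (rule harmonic_diffq(2)[OF v sub h(3) that])
  have vdiff: "v differentiable at x" "partial_deriv i v differentiable at x" if "x \<in> ball x0 (5 * r)" for x i
    using v r that by (auto simp: harmonic_on_def C2_on_def subset_iff)
  have uc: "\<exists>K. \<forall>k\<ge>K. \<forall>x\<in>ball x0 (3 * r). \<bar>w k x - partial_deriv j v x\<bar> \<le> e" if e: "e > 0" for e
  proof -
    have "continuous_on (cball x0 (4 * r)) (partial_deriv j v)"
      by (intro continuous_at_imp_continuous_on ballI differentiable_imp_continuous_within vdiff) (use r in auto)
    then have "uniformly_continuous_on (cball x0 (4 * r)) (partial_deriv j v)"
      by (rule compact_uniformly_continuous) simp
    then obtain d where d: "d > 0" "\<And>x y. x \<in> cball x0 (4 * r) \<Longrightarrow> y \<in> cball x0 (4 * r) \<Longrightarrow> dist y x < d \<Longrightarrow>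
        dist (partial_deriv j v y) (partial_deriv j v x) < e"
      using e unfolding uniformly_continuous_on_def by metis
    obtain K where K: "\<And>k. k \<ge> K \<Longrightarrow> \<bar>h k\<bar> < d"
      using h0 d(1) unfolding LIMSEQ_iff by auto
    show ?thesis
    proof (intro exI allI impI ballI)
      fix k x assume k: "k \<ge> K" and x: "x \<in> ball x0 (3 * r)"
      have xt: "x + t *\<^sub>R axis j 1 \<in> ball x0 (4 * r)" if "\<bar>t\<bar> \<le> \<bar>h k\<bar>" for t
        using norm_add_axis[OF x, where h=t and s=r and j=j] that h(3)[of k] by simp
      obtain t where t: "\<bar>t\<bar> \<le> \<bar>h k\<bar>" "diffq j (h k) v x = partial_deriv j v (x + t *\<^sub>R axis j 1)"
      proof (rule diffq_mean_value)
        show "v differentiable at (x + t *\<^sub>R axis j 1)" if "\<bar>t\<bar> \<le> \<bar>h k\<bar>" for t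
          using xt[OF that] r by (intro vdiff) auto
      qed (use h in auto)
      have "dist (partial_deriv j v (x + t *\<^sub>R axis j 1)) (partial_deriv j v x) < e"
        by (rule d(2)) (use xt[OF t(1)] x r K[OF k] t in \<open>auto simp: dist_norm\<close>)
      then show "\<bar>w k x - partial_deriv j v x\<bar> \<le> e" using t by (simp add: w_def dist_real_def)
    qed
  qed
  \<comment> \<open>The bracket dominates the constants of both interior estimates; the last factor
    2 pays for the triangle inequality between two quotients and the limit.\<close>
  define C where "C = (2 * (2 * (real CARD('n))\<^sup>2 / r)\<^sup>2 + 2 * (real CARD('n))\<^sup>2 / r + 1) * 2"
  have C: "C > 0" unfolding C_def using r by (intro mult_pos_pos add_nonneg_pos add_nonneg_nonneg) auto
  have cau: "\<exists>K. \<forall>k\<ge>K. \<forall>m\<ge>K. \<forall>x\<in>B. \<forall>i l. \<bar>partial_deriv i (w k) x - partial_deriv i (w m) x\<bar> \<le> e \<and>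
     \<bar>partial_deriv l (partial_deriv i (w k)) x - partial_deriv l (partial_deriv i (w m)) x\<bar> \<le> e" if e: "e > 0" for e
  proof -
    obtain K where K: "\<And>k x. k\<ge>K \<Longrightarrow> x\<in>ball x0 (3 * r) \<Longrightarrow> \<bar>w k x - partial_deriv j v x\<bar> \<le> e / C"
      using uc[of "e / C"] e C by (meson divide_pos_pos)
    show ?thesis
    proof (intro exI allI impI ballI)
      fix k m x i l assume k: "K \<le> k" and m: "K \<le> m" and x: "x \<in> B"
      have xb: "ball x (2 * r) \<subseteq> ball x0 (3 * r)"
        using x by (intro ball_subset_ball_iff[THEN iffD2]) (auto simp: B_def dist_commute)
      have x3: "x \<in> ball x0 (3 * r)" using x r by (auto simp: B_def)
      have hm: "harmonic_on (ball x0 (3 * r)) (\<lambda>y. 1 * w k y + (- 1) * w m y)"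
        by (rule harmonic_lin[OF wh wh])
      have M: "\<bar>1 * w k y + (- 1) * w m y\<bar> \<le> 2 * (e / C)" if "y \<in> ball x (2 * r)" for y
        using K[OF k, of y] K[OF m, of y] that xb by (auto simp: abs_le_iff subset_iff)
      have M': "\<bar>1 * w k y + (- 1) * w m y\<bar> \<le> 2 * (e / C)" if "y \<in> ball x r" for y
        by (rule M) (use that r in auto)
      have "\<bar>partial_deriv i (\<lambda>y. 1 * w k y + (- 1) * w m y) x\<bar> \<le> 2 * (real CARD('n))\<^sup>2 / r * (2 * (e / C))"
        by (rule partial_deriv_ball[OF hm r(1) _ M']) (use xb r subset_ball[of r "2 * r" x] in \<open>auto intro: order_trans\<close>)
      also have "\<dots> \<le> e"
        using C e r by (simp add: divide_simps) (simp add: C_def field_simps)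
      finally have 1: "\<bar>partial_deriv i (w k) x - partial_deriv i (w m) x\<bar> \<le> e"
        unfolding partial_deriv_lin[OF wh wh x3] by simp
      have "\<bar>partial_deriv l (partial_deriv i (\<lambda>y. 1 * w k y + (- 1) * w m y)) x\<bar> \<le> 2 * (2 * (real CARD('n))\<^sup>2 / r)\<^sup>2 * (2 * (e / C))"
        by (rule second_partial_ball[OF hm r(1) _ M]) (use xb in \<open>auto simp: subset_iff\<close>)
      also have "\<dots> = (2 * (2 * (real CARD('n))\<^sup>2 / r)\<^sup>2 * 2) / C * e" by simp
      also have "\<dots> \<le> 1 * e"
      proof (rule mult_right_mono)
        show "2 * (2 * (real CARD('n))\<^sup>2 / r)\<^sup>2 * 2 / C \<le> 1"
          using C r by (simp add: divide_le_eq) (simp add: C_def algebra_simps)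
      qed (use e in simp)
      finally show "\<bar>partial_deriv i (w k) x - partial_deriv i (w m) x\<bar> \<le> e \<and>
         \<bar>partial_deriv l (partial_deriv i (w k)) x - partial_deriv l (partial_deriv i (w m)) x\<bar> \<le> e"
        using 1 unfolding partial_deriv_lin2[OF wh wh x3] by simp
    qed
  qed
  have B3: "x \<in> ball x0 (3 * r)" "x \<in> ball x0 (5 * r)" if "x \<in> B" for x using that r by (auto simp: B_def)
  define G where "G i = partial_deriv j (partial_deriv i v)" for i
  have Glim: "(\<lambda>k. partial_deriv i (w k) x) \<longlonglongrightarrow> G i x" if "x \<in> B" for i x
    unfolding wp[OF B3(1)[OF that]] G_def by (rule diffq_tendsto[OF vdiff(2)[OF B3(2)[OF that]] h0 h(1)])
  have "uniformly_convergent_on B (\<lambda>k. partial_deriv i (w k))" for i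
  proof (rule Cauchy_uniformly_convergent, unfold uniformly_Cauchy_on_def, intro allI impI)
    fix e :: real assume "e > 0"
    then have e2: "e / 2 > 0" "e / 2 < e" by auto
    obtain K where K: "\<And>m n x. m \<ge> K \<Longrightarrow> n \<ge> K \<Longrightarrow> x \<in> B \<Longrightarrow> \<bar>partial_deriv i (w m) x - partial_deriv i (w n) x\<bar> \<le> e / 2"
      using cau[OF e2(1)] by metis
    show "\<exists>M. \<forall>x\<in>B. \<forall>m\<ge>M. \<forall>n\<ge>M. dist (partial_deriv i (w m) x) (partial_deriv i (w n) x) < e"
      unfolding dist_real_def by (intro exI[of _ K] ballI allI impI order_le_less_trans[OF K e2(2)])
  qed
  then have Gu: "uniform_limit B (\<lambda>k. partial_deriv i (w k)) (G i) sequentially" for i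
  proof -
    obtain L where L: "uniform_limit B (\<lambda>k. partial_deriv i (w k)) L sequentially"
      using \<open>\<And>i. uniformly_convergent_on B (\<lambda>k. partial_deriv i (w k))\<close> unfolding uniformly_convergent_on_def by blast
    have "L x = G i x" if "x \<in> B" for x
      using LIMSEQ_unique[OF tendsto_uniform_limitI[OF L that] Glim[OF that]] .
    then show ?thesis using L by (subst (asm) uniform_limit_cong'[of B _ _ L "G i"]) auto
  qed
  have "uniformly_convergent_on B (\<lambda>k. partial_deriv l (partial_deriv i (w k)))" for i l
  proof (rule Cauchy_uniformly_convergent, unfold uniformly_Cauchy_on_def, intro allI impI)
    fix e :: real assume "e > 0"
    then have e2: "e / 2 > 0" "e / 2 < e" by auto
    obtain K where K: "\<And>m n x. m \<ge> K \<Longrightarrow> n \<ge> K \<Longrightarrow> x \<in> B \<Longrightarrow> \<bar>partial_deriv l (partial_deriv i (w m)) x - partial_deriv l (partial_deriv i (w n)) x\<bar> \<le> e / 2"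
      using cau[OF e2(1)] by metis
    show "\<exists>M. \<forall>x\<in>B. \<forall>m\<ge>M. \<forall>n\<ge>M. dist (partial_deriv l (partial_deriv i (w m)) x) (partial_deriv l (partial_deriv i (w n)) x) < e"
      unfolding dist_real_def by (intro exI[of _ K] ballI allI impI order_le_less_trans[OF K e2(2)])
  qed
  then have ex: "\<forall>i l. \<exists>Z. uniform_limit B (\<lambda>k. partial_deriv l (partial_deriv i (w k))) Z sequentially"
    unfolding uniformly_convergent_on_def by auto
  define Z where "Z i l = (SOME Z. uniform_limit B (\<lambda>k. partial_deriv l (partial_deriv i (w k))) Z sequentially)" for i l
  have Z: "uniform_limit B (\<lambda>k. partial_deriv l (partial_deriv i (w k))) (Z i l) sequentially" for i l
    unfolding Z_def by (rule someI_ex[OF ex[rule_format, of l i]])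
  have op: "open B" "convex B" by (auto simp: B_def)
  have wB: "harmonic_on B (w k)" for k by (rule harmonic_subset[OF wh op(1)]) (use B3 in blast)
  have jet: "jet2 B (partial_deriv j v) G Z"
    unfolding jet2_def
  proof (intro conjI ballI allI)
    show "open B" by fact
    fix x assume x: "x \<in> B"
    show "(partial_deriv j v has_derivative (\<lambda>w. \<Sum>i\<in>UNIV. w $ i * G i x)) (at x)"
    proof (rule sum_partial_limit[OF op _ Gu _ x])
      show "(w k has_derivative (\<lambda>wa. \<Sum>i\<in>UNIV. wa $ i * partial_deriv i (w k) x)) (at x)" if "x \<in> B" for k x
        by (rule harmonic_has_derivative[OF wB that])
      show "(\<lambda>k. w k x) \<longlonglongrightarrow> partial_deriv j v x" if "x \<in> B" for x
        unfolding w_def by (rule diffq_tendsto[OF vdiff(1)[OF B3(2)[OF that]] h0 h(1)])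
    qed
    fix i
    show "(G i has_derivative (\<lambda>w. \<Sum>l\<in>UNIV. w $ l * Z i l x)) (at x)"
    proof (rule sum_partial_limit[OF op _ Z _ x])
      show "((partial_deriv i (w k)) has_derivative (\<lambda>wa. \<Sum>l\<in>UNIV. wa $ l * partial_deriv l (partial_deriv i (w k)) x)) (at x)" if "x \<in> B" for k x
        by (rule jet2_first(2)[OF harmonic_jet2[OF wB] that])
    qed (rule Glim)
  next
    fix i l
    show "continuous_on B (Z i l)"
    proof (rule uniform_limit_theorem[OF _ Z])
      have "continuous_on B (partial_deriv l (partial_deriv i (w k)))" for k
        using harmonic_jet2[OF wB, of k] by (simp add: jet2_def)
      then show "\<forall>\<^sub>F k in sequentially. continuous_on B (partial_deriv l (partial_deriv i (w k)))" by simp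
    qed simp
  qed
  have "harmonic_on B (partial_deriv j v)"
  proof (rule jet2_harmonic[OF jet])
    fix x assume x: "x \<in> B"
    have "(\<lambda>k. \<Sum>i\<in>UNIV. partial_deriv i (partial_deriv i (w k)) x) \<longlonglongrightarrow> (\<Sum>i\<in>UNIV. Z i i x)"
      by (intro tendsto_sum tendsto_uniform_limitI[OF Z x])
    then show "(\<Sum>i\<in>UNIV. Z i i x) = 0"
      unfolding harmonic_trace[OF wB x] by (simp add: LIMSEQ_const_iff)
  qed
  moreover have "partial_deriv i (partial_deriv j v) x = partial_deriv j (partial_deriv i v) x" if "x \<in> B" for x i
    using jet2_partial(1)[OF jet that] by (simp add: G_def)
  ultimately show ?thesis by (simp add: B_def)
qed

lemma harmonic_partial:
  assumes v: "harmonic_on S v"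
  shows "harmonic_on S (partial_deriv j v)"
    and "x \<in> S \<Longrightarrow> partial_deriv i (partial_deriv j v) x = partial_deriv j (partial_deriv i v) x"
proof -
  have *: "\<exists>r>0. ball x (5 * r) \<subseteq> S" if xS: "x \<in> S" for x
  proof -
    obtain e where "e > 0" "ball x e \<subseteq> S" using harmonic_open[OF v] xS by (meson open_contains_ball)
    then show ?thesis by (intro exI[of _ "e / 5"]) auto
  qed
  show "harmonic_on S (partial_deriv j v)"
  proof (rule harmonic_local[OF harmonic_open[OF v]])
    fix x assume "x \<in> S"
    then obtain r where "r > 0" "ball x (5 * r) \<subseteq> S" using * by blast
    then show "\<exists>T. x \<in> T \<and> harmonic_on T (partial_deriv j v)"
      using harmonic_partial_local[OF v] by (intro exI[of _ "ball x r"]) auto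
  qed
  show "partial_deriv i (partial_deriv j v) x = partial_deriv j (partial_deriv i v) x" if xS: "x \<in> S"
  proof -
    obtain r where "r > 0" "ball x (5 * r) \<subseteq> S" using * xS by blast
    then show ?thesis using harmonic_partial_local[OF v, of r x j] by auto
  qed
qed

subsection \<open>Directional derivatives and Taylor expansion along lines\<close>

text \<open>Cutting off outside \<open>S\<close> makes identities between derivatives, such as commutation,
  equalities of functions.\<close>

definition dder :: "(real^'n::finite) set \<Rightarrow> real^'n \<Rightarrow> (real^'n \<Rightarrow> real) \<Rightarrow> real^'n \<Rightarrow> real" where
  "dder S w v = (\<lambda>x. if x \<in> S then \<Sum>i\<in>UNIV. w $ i * partial_deriv i v x else 0)"

lemma harmonic_dder:
  assumes "harmonic_on S v" shows "harmonic_on S (dder S w v)"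
  by (rule harmonic_cong[OF harmonic_sum[OF finite harmonic_open[OF assms] harmonic_partial(1)[OF assms], where I=UNIV and c="\<lambda>i. w $ i"]])
     (simp add: dder_def)

lemma harmonic_dder_pow:
  assumes "harmonic_on S v" shows "harmonic_on S ((dder S w ^^ k) v)"
  using assms by (induction k) (auto intro: harmonic_dder)

lemma partial_dder:
  assumes v: "harmonic_on S v" and x: "x \<in> S"
  shows "partial_deriv i (dder S w v) x = (\<Sum>j\<in>UNIV. w $ j * partial_deriv i (partial_deriv j v) x)"
proof -
  have op: "open S" by (rule harmonic_open[OF v])
  have "((\<lambda>x. \<Sum>j\<in>UNIV. w $ j * partial_deriv j v x) has_derivative
      (\<lambda>a. \<Sum>j\<in>UNIV. w $ j * (\<Sum>i\<in>UNIV. a $ i * partial_deriv i (partial_deriv j v) x))) (at x)"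
    by (intro has_derivative_sum has_derivative_mult_right harmonic_has_derivative[OF harmonic_partial(1)[OF v] x])
  moreover have "(\<Sum>j\<in>UNIV. w $ j * (\<Sum>i\<in>UNIV. a $ i * partial_deriv i (partial_deriv j v) x)) =
     (\<Sum>i\<in>UNIV. a $ i * (\<Sum>j\<in>UNIV. w $ j * partial_deriv i (partial_deriv j v) x))" for a :: "real^'a"
    unfolding sum_distrib_left by (subst sum.swap) (simp add: ac_simps)
  ultimately have "((\<lambda>x. \<Sum>j\<in>UNIV. w $ j * partial_deriv j v x) has_derivative
      (\<lambda>a. \<Sum>i\<in>UNIV. a $ i * (\<Sum>j\<in>UNIV. w $ j * partial_deriv i (partial_deriv j v) x))) (at x)" by simp
  from has_derivative_cong_open[OF op x _ this, of "dder S w v"]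
  have "(dder S w v has_derivative
      (\<lambda>a. \<Sum>i\<in>UNIV. a $ i * (\<Sum>j\<in>UNIV. w $ j * partial_deriv i (partial_deriv j v) x))) (at x)"
    by (simp add: dder_def)
  then show ?thesis by (rule partial_deriv_eqI)
qed

lemma dder_commute:
  assumes v: "harmonic_on S v"
  shows "dder S a (dder S b v) = dder S b (dder S a v)"
proof
  fix x
  show "dder S a (dder S b v) x = dder S b (dder S a v) x"
  proof (cases "x \<in> S")
    case True
    have "(\<Sum>i\<in>UNIV. a $ i * (\<Sum>j\<in>UNIV. b $ j * partial_deriv i (partial_deriv j v) x)) =
      (\<Sum>j\<in>UNIV. b $ j * (\<Sum>i\<in>UNIV. a $ i * partial_deriv j (partial_deriv i v) x))"
      unfolding sum_distrib_left
      by (subst sum.swap) (simp add: harmonic_partial(2)[OF v True] ac_simps)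
    then show ?thesis using True by (simp add: dder_def[of S _ "dder S _ v"] partial_dder[OF v True])
  qed (simp add: dder_def)
qed

lemma dder_line:
  assumes "harmonic_on S v" "p + t *\<^sub>R w \<in> S"
  shows "((\<lambda>t. v (p + t *\<^sub>R w)) has_real_derivative dder S w v (p + t *\<^sub>R w)) (at t)"
  using line_deriv[OF harmonic_has_derivative[OF assms]] assms(2) by (simp add: dder_def)

text \<open>A derivative along a vector with entries of modulus at most one costs 2 n^3 / r, that is
  n partial derivatives at 2 n^2 / r each; the remaining factor 3 comes from
  \<open>power_self_le\<close>.\<close>

definition taylor_const :: "'n::finite itself \<Rightarrow> real" where
  "taylor_const _ = 6 * real CARD('n) ^ 3"

lemma card_ge_1: "real CARD('n::finite) \<ge> 1"
  by (simp add: Suc_leI)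

lemma taylor_const_ge: "taylor_const TYPE('n::finite) \<ge> 6 * real CARD('n)" "taylor_const TYPE('n) \<ge> 6"
proof -
  have "real CARD('n) \<le> real CARD('n) ^ 3" by (rule self_le_power[OF card_ge_1]) simp
  then show "taylor_const TYPE('n::finite) \<ge> 6 * real CARD('n)" by (simp add: taylor_const_def)
  then show "taylor_const TYPE('n) \<ge> 6" using card_ge_1[where 'n='n] by linarith
qed

lemma norm_le_card:
  fixes w :: "real^'n::finite"
  assumes "\<And>i. \<bar>w $ i\<bar> \<le> a" shows "norm w \<le> real CARD('n) * a"
proof -
  have "norm w \<le> (\<Sum>i\<in>UNIV. \<bar>w $ i\<bar>)" by (rule norm_le_l1_cart)
  also have "\<dots> \<le> (\<Sum>i\<in>(UNIV::'n set). a)" by (intro sum_mono assms)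
  finally show ?thesis by simp
qed

lemma dder_bound:
  fixes v :: "real^'n::finite \<Rightarrow> real" and w :: "real^'n"
  assumes v: "harmonic_on S v" and r: "r > 0" "ball c r \<subseteq> S" and M: "\<And>y. y \<in> ball c r \<Longrightarrow> \<bar>v y\<bar> \<le> M"
    and w: "\<And>i. \<bar>w $ i\<bar> \<le> 1"
  shows "\<bar>dder S w v c\<bar> \<le> taylor_const TYPE('n) / 3 / r * M"
proof -
  have c: "c \<in> S" using r by auto
  have "\<bar>dder S w v c\<bar> \<le> (\<Sum>i\<in>UNIV. \<bar>w $ i * partial_deriv i v c\<bar>)"
    using c by (simp add: dder_def)
  also have "\<dots> \<le> (\<Sum>i\<in>(UNIV::'n set). 1 * (2 * (real CARD('n))\<^sup>2 / r * M))"
    unfolding abs_mult by (intro sum_mono mult_mono w partial_deriv_ball[OF v r M]) auto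
  also have "\<dots> = taylor_const TYPE('n) / 3 / r * M" by (simp add: taylor_const_def power2_eq_square power3_eq_cube)
  finally show ?thesis .
qed

text \<open>Each derivative spends radius \<open>d\<close>. Sharing a radius \<open>r\<close>
  equally among \<open>k\<close> derivatives leads to \<open>k ^ k\<close> in place of
  \<open>fact k\<close>, a geometric loss only.\<close>

lemma dder_pow_bound_step:
  fixes v :: "real^'n::finite \<Rightarrow> real" and w :: "real^'n"
  assumes v: "harmonic_on S v" and T: "T \<subseteq> S" and d: "d > 0" and M: "\<And>y. y \<in> T \<Longrightarrow> \<bar>v y\<bar> \<le> M"
    and w: "\<And>i. \<bar>w $ i\<bar> \<le> 1"
  shows "x \<in> T \<Longrightarrow> ball x (real j * d) \<subseteq> T \<Longrightarrow> \<bar>(dder S w ^^ j) v x\<bar> \<le> (taylor_const TYPE('n) / 3 / d) ^ j * M"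
proof (induction j arbitrary: x)
  case 0
  then show ?case using M by simp
next
  case (Suc j)
  have sub: "ball x d \<subseteq> ball x (real (Suc j) * d)" using d by (intro subset_ball) (simp add: algebra_simps)
  have "\<bar>dder S w ((dder S w ^^ j) v) x\<bar> \<le> taylor_const TYPE('n) / 3 / d * ((taylor_const TYPE('n) / 3 / d) ^ j * M)"
  proof (rule dder_bound[OF harmonic_dder_pow[OF v] d _ _ w])
    show "ball x d \<subseteq> S" using sub Suc.prems T by blast
    fix y assume y: "y \<in> ball x d"
    show "\<bar>(dder S w ^^ j) v y\<bar> \<le> (taylor_const TYPE('n) / 3 / d) ^ j * M"
    proof (rule Suc.IH)
      show "y \<in> T" using y sub Suc.prems by blast
      have "ball y (real j * d) \<subseteq> ball x (real (Suc j) * d)"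
      proof
        fix z assume "z \<in> ball y (real j * d)"
        then have "dist x z < d + real j * d" using y dist_triangle[of x z y] by simp
        then show "z \<in> ball x (real (Suc j) * d)" by (simp add: algebra_simps)
      qed
      then show "ball y (real j * d) \<subseteq> T" using Suc.prems by blast
    qed
  qed
  then show ?case by (simp add: mult.assoc)
qed

text \<open>The left side divided by \<open>fact k\<close> is a single term of the exponential
  series at \<open>k\<close>.\<close>

lemma power_self_le_exp: "real k ^ k \<le> exp (real k) * fact k"
proof -
  have s: "(\<lambda>m. real k ^ m /\<^sub>R fact m) sums exp (real k)" by (rule exp_converges)
  have "(\<Sum>m\<in>{k}. real k ^ m /\<^sub>R fact m) \<le> exp (real k)"
    using s by (intro sum_le_suminf[of "\<lambda>m. real k ^ m /\<^sub>R fact m", THEN order_trans]) (auto simp: sums_iff)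
  then show ?thesis by (simp add: field_simps)
qed

lemma power_self_le: "real k ^ k \<le> 3 ^ k * fact k"
proof -
  have "real k ^ k \<le> exp (real k) * fact k" by (rule power_self_le_exp)
  also have "exp (real k) = exp 1 ^ k" by (metis exp_of_nat_mult mult.right_neutral)
  also have "exp 1 ^ k * fact k \<le> (3::real) ^ k * fact k"
    using exp_le by (intro mult_right_mono power_mono) auto
  finally show ?thesis .
qed

text \<open>Quantitative analyticity: with \<open>d = r / k\<close> in
  \<open>dder_pow_bound_step\<close> the coefficients along a line grow at most geometrically, so
  the Taylor series has radius of convergence at least \<open>r / taylor_const\<close>, uniformly in
  the direction.\<close>

lemma taylor_coeff_bound:
  fixes v :: "real^'n::finite \<Rightarrow> real" and w :: "real^'n"
  assumes v: "harmonic_on S v" and r: "r > 0" "ball c r \<subseteq> S" and M: "\<And>y. y \<in> ball c r \<Longrightarrow> \<bar>v y\<bar> \<le> M"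
    and w: "\<And>i. \<bar>w $ i\<bar> \<le> 1"
  shows "\<bar>(dder S w ^^ k) v c / fact k\<bar> \<le> (taylor_const TYPE('n) / r) ^ k * M"
proof (cases "k = 0")
  case True then show ?thesis using M[of c] r by simp
next
  case False
  have c: "c \<in> ball c r" using r by simp
  have M0: "M \<ge> 0" using M[OF c] by linarith
  have "\<bar>(dder S w ^^ k) v c\<bar> \<le> (taylor_const TYPE('n) / 3 / (r / real k)) ^ k * M"
    by (rule dder_pow_bound_step[OF v r(2) _ M w c]) (use False r in auto)
  also have "\<dots> = (taylor_const TYPE('n) / 3 / r) ^ k * M * real k ^ k" by (simp add: power_divide power_mult_distrib)
  also have "\<dots> \<le> (taylor_const TYPE('n) / 3 / r) ^ k * M * (3 ^ k * fact k)"
    using M0 r taylor_const_ge(2)[where 'n='n] by (intro mult_left_mono power_self_le) auto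
  also have "\<dots> = (taylor_const TYPE('n) / r) ^ k * M * fact k" by (simp add: power_divide)
  finally show ?thesis by (simp add: abs_divide divide_le_eq)
qed

lemma taylor_sums:
  fixes v :: "real^'n::finite \<Rightarrow> real" and w :: "real^'n"
  assumes v: "harmonic_on S v" and r: "r > 0" "ball p r \<subseteq> S" and M: "\<And>y. y \<in> ball p r \<Longrightarrow> \<bar>v y\<bar> \<le> M"
    and w: "\<And>i. \<bar>w $ i\<bar> \<le> 1" and t: "\<bar>t\<bar> < r / (2 * taylor_const TYPE('n))"
  shows "(\<lambda>k. (dder S w ^^ k) v p / fact k * t ^ k) sums v (p + t *\<^sub>R w)"
proof -
  let ?K = "taylor_const TYPE('n)"
  have K: "?K \<ge> 6" "?K \<ge> 6 * real CARD('n)" by (rule taylor_const_ge)+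
  have nw: "norm w \<le> real CARD('n)" using norm_le_card[of w 1] w by simp
  \<comment> \<open>Every intermediate point of the Lagrange remainder keeps radius
    \<open>r / 2\<close>, whence the ratio \<open>2 * ?K * \<bar>t\<bar> / r\<close> in the
    remainder, which is below one by the restriction on \<open>t\<close>.\<close>
  have near: "ball (p + s *\<^sub>R w) (r / 2) \<subseteq> ball p r" if "\<bar>s\<bar> \<le> \<bar>t\<bar>" for s
  proof -
    have "norm (s *\<^sub>R w) \<le> \<bar>t\<bar> * ?K" using that nw K by (auto intro!: mult_mono)
    also have "\<dots> \<le> r / 2" using t K by (simp add: field_simps)
    finally have "norm (s *\<^sub>R w) \<le> r / 2" .
    then show ?thesis by (intro ball_subset_ball_iff[THEN iffD2]) (simp add: dist_norm)
  qed
  have inS: "p + s *\<^sub>R w \<in> S" if "\<bar>s\<bar> \<le> \<bar>t\<bar>" for s using near[OF that] r by (auto simp: subset_iff)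
  have rem: "\<bar>v (p + t *\<^sub>R w) - (\<Sum>m<n. (dder S w ^^ m) v p / fact m * t ^ m)\<bar> \<le> (2 * ?K * \<bar>t\<bar> / r) ^ n * M" for n
  proof -
    have "\<exists>s. \<bar>s\<bar> \<le> \<bar>t\<bar> \<and> v (p + t *\<^sub>R w) = (\<Sum>m<n. (dder S w ^^ m) v (p + 0 *\<^sub>R w) / fact m * t ^ m)
        + (dder S w ^^ n) v (p + s *\<^sub>R w) / fact n * t ^ n"
      by (rule Maclaurin_bi_le) (auto intro!: dder_line[OF harmonic_dder_pow[OF v]] inS)
    then obtain s where s: "\<bar>s\<bar> \<le> \<bar>t\<bar>" "v (p + t *\<^sub>R w) - (\<Sum>m<n. (dder S w ^^ m) v p / fact m * t ^ m)
        = (dder S w ^^ n) v (p + s *\<^sub>R w) / fact n * t ^ n" by auto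
    have "\<bar>(dder S w ^^ n) v (p + s *\<^sub>R w) / fact n\<bar> \<le> (?K / (r / 2)) ^ n * M"
      by (rule taylor_coeff_bound[OF v _ _ M w]) (use near[OF s(1)] r in auto)
    then have "\<bar>(dder S w ^^ n) v (p + s *\<^sub>R w) / fact n * t ^ n\<bar> \<le> (?K / (r / 2)) ^ n * M * \<bar>t\<bar> ^ n"
      unfolding abs_mult[of _ "t ^ n"] power_abs by (intro mult_right_mono) auto
    then show ?thesis unfolding s by (simp add: power_divide power_mult_distrib ac_simps)
  qed
  have "2 * ?K * \<bar>t\<bar> / r < 1" using t K r by (simp add: field_simps)
  then have "(\<lambda>n. (2 * ?K * \<bar>t\<bar> / r) ^ n * M) \<longlonglongrightarrow> 0 * M"
    using K r by (intro tendsto_mult LIMSEQ_realpow_zero tendsto_const) auto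
  then have lim0: "(\<lambda>n. (2 * ?K * \<bar>t\<bar> / r) ^ n * M) \<longlonglongrightarrow> 0" by (simp only: mult_zero_left)
  have "(\<lambda>n. v (p + t *\<^sub>R w) - (\<Sum>m<n. (dder S w ^^ m) v p / fact m * t ^ m)) \<longlonglongrightarrow> 0"
    by (rule Lim_null_comparison[OF _ lim0], unfold real_norm_def, rule always_eventually, rule allI, rule rem)
  from tendsto_diff[OF tendsto_const[of "v (p + t *\<^sub>R w)"] this]
  have "(\<lambda>n. \<Sum>m<n. (dder S w ^^ m) v p / fact m * t ^ m) \<longlonglongrightarrow> v (p + t *\<^sub>R w)"
    by (simp only: diff_diff_eq2 add_diff_cancel_left' diff_zero)
  then show ?thesis unfolding sums_def .
qed

lemma complex_extension:
  fixes v :: "real^'n::finite \<Rightarrow> real" and w :: "real^'n"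
  assumes v: "harmonic_on S v" and r: "r > 0" "ball p r \<subseteq> S" and M: "\<And>y. y \<in> ball p r \<Longrightarrow> \<bar>v y\<bar> \<le> M"
    and w: "\<And>i. \<bar>w $ i\<bar> \<le> 1"
  obtains G where "G holomorphic_on ball 0 (r / taylor_const TYPE('n))"
    "\<And>z. cmod z \<le> r / (2 * taylor_const TYPE('n)) \<Longrightarrow> cmod (G z) \<le> 2 * M"
    "\<And>t k. \<bar>t\<bar> < r / (2 * taylor_const TYPE('n)) \<Longrightarrow> (deriv ^^ k) G (of_real t) = of_real ((dder S w ^^ k) v (p + t *\<^sub>R w))"
proof -
  let ?K = "taylor_const TYPE('n)"
  have K: "?K \<ge> 6" by (rule taylor_const_ge)
  have M0: "M \<ge> 0" using M[of p] r by force
  define a where "a k = (dder S w ^^ k) v p / fact k" for k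
  have a: "\<bar>a k\<bar> \<le> (?K / r) ^ k * M" for k
    unfolding a_def by (rule taylor_coeff_bound[OF v r M w])
  have trm: "cmod (of_real (a k) * z ^ k) \<le> M * (?K * cmod z / r) ^ k" for k z
  proof -
    have "cmod (of_real (a k) * z ^ k) = \<bar>a k\<bar> * cmod z ^ k" by (simp add: norm_mult norm_power)
    also have "\<dots> \<le> (?K / r) ^ k * M * cmod z ^ k" by (intro mult_right_mono a) auto
    finally show ?thesis by (simp add: power_mult_distrib power_divide ac_simps)
  qed
  have small: "?K * cmod z / r < 1" "0 \<le> ?K * cmod z / r" if "cmod z < r / ?K" for z
    using that K r by (auto simp: field_simps)
  have summ: "summable (\<lambda>k. cmod (of_real (a k) * z ^ k))" if "cmod z < r / ?K" for z
    by (rule summable_comparison_test'[where N=0 and g="\<lambda>k. M * (?K * cmod z / r) ^ k"])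
       (use trm small[OF that] in \<open>auto intro!: summable_mult summable_geometric\<close>)
  define G where "G z = (\<Sum>k. of_real (a k) * z ^ k)" for z :: complex
  have sG: "(\<lambda>k. of_real (a k) * z ^ k) sums G z" if "cmod z < r / ?K" for z
    unfolding G_def by (rule summable_sums[OF summable_norm_cancel[OF summ[OF that]]])
  have hol: "G holomorphic_on ball 0 (r / ?K)"
    by (rule power_series_holomorphic[of 0 _ "\<lambda>k. of_real (a k)"]) (use sG in auto)
  \<comment> \<open>At half the radius of convergence the majorant is geometric with ratio
    1/2.\<close>
  have bd: "cmod (G z) \<le> 2 * M" if z: "cmod z \<le> r / (2 * ?K)" for z
  proof -
    have "r / (2 * ?K) < r / ?K" using r K by (simp add: field_simps)
    then have z': "cmod z < r / ?K" using z by linarith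
    have half: "?K * cmod z / r \<le> 1/2" using z r K by (simp add: field_simps)
    have "cmod (G z) \<le> (\<Sum>k. cmod (of_real (a k) * z ^ k))"
      unfolding G_def by (rule summable_norm[OF summ[OF z']])
    also have "\<dots> \<le> (\<Sum>k. M * (1/2) ^ k)"
    proof (rule suminf_le[OF _ summ[OF z']])
      show "cmod (of_real (a k) * z ^ k) \<le> M * (1/2) ^ k" for k
        using trm[of k z] M0 half small[OF z'] by (meson mult_left_mono order_trans power_mono)
      show "summable (\<lambda>k. M * (1/2::real) ^ k)" by (intro summable_mult summable_geometric) auto
    qed
    also have "\<dots> = 2 * M" by (subst suminf_mult) (auto intro: summable_geometric simp: suminf_geometric)
    finally show ?thesis .
  qed
  \<comment> \<open>By induction on \<open>k\<close>: the complex derivative at a real point equals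
    the derivative along the real axis, and there the function is already identified with an
    iterated directional derivative.\<close>
  have der: "\<forall>t. \<bar>t\<bar> < r / (2 * ?K) \<longrightarrow> (deriv ^^ k) G (of_real t) = of_real ((dder S w ^^ k) v (p + t *\<^sub>R w))" for k
  proof (induction k)
    case 0
    show ?case
    proof (intro allI impI)
      fix t assume t: "\<bar>t\<bar> < r / (2 * ?K)"
      have "r / (2 * ?K) < r / ?K" using r K by (simp add: field_simps)
      then have t': "cmod (of_real t) < r / ?K" using t by simp
      have "(\<lambda>k. of_real (a k * t ^ k) :: complex) sums of_real (v (p + t *\<^sub>R w))"
        unfolding a_def by (rule sums_of_real[OF taylor_sums[OF v r M w t]])
      then show "(deriv ^^ 0) G (of_real t) = of_real ((dder S w ^^ 0) v (p + t *\<^sub>R w))"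
        using sG[OF t'] sums_unique2 by fastforce
    qed
  next
    case (Suc k)
    show ?case
    proof (intro allI impI)
      fix t assume t: "\<bar>t\<bar> < r / (2 * ?K)"
      have lt: "r / (2 * ?K) < r / ?K" using r K by (simp add: field_simps)
      define F where "F = (deriv ^^ k) G"
      have holF: "F holomorphic_on ball 0 (r / ?K)" unfolding F_def by (rule holomorphic_higher_deriv[OF hol]) simp
      have "(F has_field_derivative deriv F (of_real t)) (at (of_real t))"
        by (rule holomorphic_derivI[OF holF]) (use t lt in auto)
      then have 1: "((\<lambda>s. F (of_real s)) has_vector_derivative deriv F (of_real t)) (at t)"
        by (rule has_vector_derivative_real_field)
      have inS: "p + t *\<^sub>R w \<in> S"
      proof -
        have "norm w \<le> ?K" using norm_le_card[of w 1] w taylor_const_ge(1)[where 'n='n] card_ge_1[where 'n='n] by simp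
        then have "norm (t *\<^sub>R w) \<le> \<bar>t\<bar> * ?K" by (simp add: mult_left_mono)
        also have "\<dots> < r" using t K r by (simp add: field_simps)
        finally show ?thesis using r by (auto simp: subset_iff dist_norm)
      qed
      have "((\<lambda>s. (dder S w ^^ k) v (p + s *\<^sub>R w)) has_real_derivative (dder S w ^^ Suc k) v (p + t *\<^sub>R w)) (at t)"
        using dder_line[OF harmonic_dder_pow[OF v] inS] by simp
      then have 2: "((\<lambda>s. complex_of_real ((dder S w ^^ k) v (p + s *\<^sub>R w))) has_vector_derivative
          of_real ((dder S w ^^ Suc k) v (p + t *\<^sub>R w))) (at t)"
        by (rule has_vector_derivative_of_real)
      have "((\<lambda>s. F (of_real s)) has_vector_derivative of_real ((dder S w ^^ Suc k) v (p + t *\<^sub>R w))) (at t)"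
      proof (rule has_vector_derivative_transform_within_open[OF 2, of "{s. \<bar>s\<bar> < r / (2 * ?K)}"])
        show "open {s. \<bar>s\<bar> < r / (2 * ?K)}" by (intro open_Collect_less continuous_intros)
      qed (use t Suc.IH in \<open>auto simp: F_def\<close>)
      then have "deriv F (of_real t) = of_real ((dder S w ^^ Suc k) v (p + t *\<^sub>R w))"
        using 1 vector_derivative_unique_at by blast
      then show "(deriv ^^ Suc k) G (of_real t) = of_real ((dder S w ^^ Suc k) v (p + t *\<^sub>R w))"
        by (simp add: F_def)
    qed
  qed
  show ?thesis using that[OF hol bd] der by blast
qed

subsection \<open>Propagation of smallness along a line\<close>

text \<open>For a monic polynomial of degree d with zeros in [-2, 2], 6^d bounds the modulus below
  on the circle of radius 8 and 5^d bounds it above on the disc of radius 3; this gives 6/5. The 12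
  is 2 times 6, with the 2 from the estimate near the zeros, and the factor 2 in front pays for
  rounding a real exponent to an integer one.\<close>

definition line_expo :: "real \<Rightarrow> real" where
  "line_expo C = ln (6/5) / (2 * (C + ln 12))"

lemma line_expo_pos: "C \<ge> 0 \<Longrightarrow> line_expo C > 0"
  unfolding line_expo_def by (intro divide_pos_pos mult_pos_pos add_nonneg_pos) auto

lemma line_expo_le_1: assumes "C \<ge> 0" shows "line_expo C \<le> 1"
proof -
  have "ln (6/5) \<le> ln (12::real)" by simp
  moreover have "0 < ln (12::real)" by simp
  ultimately have "ln (6/5) \<le> 2 * (C + ln 12)" using assms by (simp only: distrib_left)
  moreover have "0 < 2 * (C + ln 12)" using assms \<open>0 < ln (12::real)\<close> by (intro mult_pos_pos add_nonneg_pos) auto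
  ultimately show ?thesis by (simp add: line_expo_def)
qed

text \<open>The maximum principle is applied to \<open>G\<^sup>a / P\<^sup>b\<close>, where \<open>P\<close> is the monic polynomial with
  zero set \<open>T\<close>; taking powers avoids branches of \<open>P\<close> raised to a real exponent.\<close>

lemma two_constants:
  fixes G :: "complex \<Rightarrow> complex" and T :: "real set"
  assumes hol: "G holomorphic_on ball 0 10" and B: "\<And>z. cmod z \<le> 8 \<Longrightarrow> cmod (G z) \<le> B"
    and T: "finite T" "T \<noteq> {}" "\<And>t. t \<in> T \<Longrightarrow> \<bar>t\<bar> \<le> 2" and h: "0 < h"
    and small: "\<And>t z. t \<in> T \<Longrightarrow> cmod (z - of_real t) \<le> h \<Longrightarrow> cmod (G z) \<le> B * exp (- W)"
    and W: "W \<ge> 0" and C: "C \<ge> 0"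
    and pot: "\<And>t. t \<in> T \<Longrightarrow> (\<Sum>s\<in>T. ln (1 / max \<bar>s - t\<bar> h)) \<le> C * real (card T)"
    and z: "cmod z \<le> 3"
  shows "cmod (G z) \<le> B * exp (- line_expo C * W)"
proof -
  define N where "N = real (card T)"
  have N: "N > 0" using T by (simp add: N_def card_gt_0_iff)
  have B0: "B \<ge> 0" using order_trans[OF norm_ge_zero B[of 0]] by simp
  have C12: "C + ln 12 > 0" using C by (intro add_nonneg_pos) auto
  consider "W = 0" | "W > 0" "\<exists>t\<in>T. cmod (z - of_real t) \<le> h" | "W > 0" "\<forall>t\<in>T. cmod (z - of_real t) > h"
    using W by force
  then show ?thesis
  proof cases
    case 1 then show ?thesis using B[of z] z by simp
  next
    case 2
    then have "cmod (G z) \<le> B * exp (- W)" using small by blast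
    also have "\<dots> \<le> B * exp (- line_expo C * W)"
      using mult_right_mono[OF line_expo_le_1[OF C] W] B0 by (intro mult_left_mono) auto
    finally show ?thesis .
  next
    case 3
    \<comment> \<open>Ideal ratio \<open>b / a\<close>. From \<open>b \<le> a * l\<close> follows
      \<open>b * N * (C + ln 12) \<le> a * W\<close>, which makes the small circles around
      \<open>T\<close> no worse than the outer circle.\<close>
    define l where "l = W / (N * (C + ln 12))"
    have l: "l > 0" using 3 N C12 by (simp add: l_def)
    \<comment> \<open>Once \<open>a * l\<close> is at least one, its floor loses at most half of
      it.\<close>
    obtain a :: nat where a: "1 \<le> real a * l"
      using reals_Archimedean3[OF l] by (metis less_imp_le)
    have a0: "a > 0" using a by (cases a) auto
    define b where "b = nat \<lfloor>real a * l\<rfloor>"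
    have b1: "real b \<le> real a * l" using a by (simp add: b_def)
    have b2: "real b \<ge> real a * l / 2"
    proof -
      have 1: "1 \<le> real_of_int \<lfloor>real a * l\<rfloor>" using a by (simp only: of_int_1_le_iff le_floor_iff of_int_1)
      have 2: "real a * l < real_of_int \<lfloor>real a * l\<rfloor> + 1" by linarith
      have "real b = real_of_int \<lfloor>real a * l\<rfloor>" using a by (simp add: b_def)
      then show ?thesis using 1 2 by linarith
    qed
    define P where "P x = (\<Prod>t\<in>T. x - complex_of_real t)" for x
    define U where "U = ball 0 8 - (\<Union>t\<in>T. cball (complex_of_real t) h)"
    have opU: "open U" unfolding U_def using T by (intro open_Diff closed_UN) auto
    have clU: "cmod x \<le> 8 \<and> (\<forall>t\<in>T. cmod (x - of_real t) \<ge> h)" if "x \<in> closure U" for x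
    proof -
      have "closed (cball 0 8 \<inter> (\<Inter>t\<in>T. {x. h \<le> cmod (x - of_real t)}))"
        by (intro closed_Int closed_INT ballI closed_Collect_le continuous_intros closed_cball)
      moreover have "U \<subseteq> cball 0 8 \<inter> (\<Inter>t\<in>T. {x. h \<le> cmod (x - of_real t)})"
        unfolding U_def by (auto simp: dist_norm norm_minus_commute)
      ultimately have "closure U \<subseteq> cball 0 8 \<inter> (\<Inter>t\<in>T. {x. h \<le> cmod (x - of_real t)})" by (rule closure_minimal[rotated])
      then show ?thesis using that by auto
    qed
    have Pne: "P x \<noteq> 0" if "x \<in> closure U" for x
      using clU[OF that] h T by (force simp: P_def)
    have P_hol: "P holomorphic_on A" for A unfolding P_def by (intro holomorphic_intros)
    define f where "f x = G x ^ a / P x ^ b" for x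
    have clsub: "closure U \<subseteq> ball 0 10" using clU by force
    have hf: "f holomorphic_on ball 0 10 \<inter> {x. P x \<noteq> 0}"
      unfolding f_def by (intro holomorphic_intros holomorphic_on_subset[OF hol] P_hol) auto
    \<comment> \<open>One bound for both parts of the frontier: the circle of radius 8, at distance
      at least 6 from all zeros, and the circles of radius \<open>h\<close>.\<close>
    define Q where "Q = (1/6) ^ (card T * b) * B ^ a"
    have hcl: "f holomorphic_on closure U"
      by (rule holomorphic_on_subset[OF hf]) (use clsub Pne in blast)
    have "norm (f z) \<le> Q"
    proof (rule maximum_modulus_frontier[where S=U and f=f and \<xi>=z and B=Q])
      show "f holomorphic_on interior U"
        by (rule holomorphic_on_subset[OF hcl order_trans[OF interior_subset closure_subset]])
      show "continuous_on (closure U) f"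
        by (rule holomorphic_on_imp_continuous_on[OF hcl])
      show "bounded U" by (rule bounded_subset[of "ball 0 8"]) (auto simp: U_def)
      show "z \<in> U" using 3 z by (auto simp: U_def dist_norm norm_minus_commute)
      fix x assume "x \<in> frontier U"
      then have x: "x \<in> closure U" "x \<notin> U" using opU by (auto simp: frontier_def interior_open)
      have nf: "norm (f x) = cmod (G x) ^ a / cmod (P x) ^ b" by (simp add: f_def norm_divide norm_power)
      have Pn: "cmod (P x) = (\<Prod>t\<in>T. cmod (x - of_real t))" by (simp add: P_def prod_norm)
      show "norm (f x) \<le> Q"
      proof (cases "cmod x = 8")
        case True
        have "6 ^ card T \<le> (\<Prod>t\<in>T. cmod (x - of_real t))"
        proof (rule prod_constant[symmetric, THEN ord_eq_le_trans], rule prod_mono)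
          fix t assume "t \<in> T"
          then have "cmod (complex_of_real t) \<le> 2" using T(3) by simp
          then show "0 \<le> (6::real) \<and> 6 \<le> cmod (x - of_real t)"
            using True norm_triangle_ineq2[of x "of_real t"] by simp
        qed
        then have "6 ^ (card T * b) \<le> cmod (P x) ^ b" unfolding Pn power_mult by (intro power_mono) auto
        then have "cmod (G x) ^ a / cmod (P x) ^ b \<le> B ^ a / 6 ^ (card T * b)"
          using B[of x] True B0 by (intro frac_le power_mono) auto
        then show ?thesis unfolding nf Q_def by (simp add: power_divide)
      next
        case False
        then have x8: "cmod x < 8" using clU[OF x(1)] by auto
        then obtain t where t: "t \<in> T" "cmod (x - of_real t) = h"
          using x clU[OF x(1)] unfolding U_def by (force simp: dist_norm norm_minus_commute)
        \<comment> \<open>With \<open>cmod (x - t) = h\<close> and every zero at distance at least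
          \<open>h\<close> from \<open>x\<close>, the triangle inequality gives distance at least
          half of \<open>max \<bar>s - t\<bar> h\<close> to each zero \<open>s\<close>. The
          potential bound at \<open>t\<close> then controls the product.\<close>
        have e: "exp (- (C + ln 2) * N) \<le> cmod (P x)"
        proof -
          have "exp (- (C + ln 2) * N) \<le> exp (\<Sum>s\<in>T. ln (max \<bar>s - t\<bar> h / 2))"
          proof -
            have "(\<Sum>s\<in>T. ln (max \<bar>s - t\<bar> h / 2)) = - (\<Sum>s\<in>T. ln (1 / max \<bar>s - t\<bar> h)) - N * ln 2"
            proof -
              have "ln (max \<bar>s - t\<bar> h / 2) = - ln (1 / max \<bar>s - t\<bar> h) - ln 2" for s
              proof -
                have "max \<bar>s - t\<bar> h > 0" using h by (simp add: less_max_iff_disj)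
                then show ?thesis by (simp add: ln_div)
              qed
              then show ?thesis by (simp add: sum_subtractf sum_negf N_def)
            qed
            then show ?thesis using pot[OF t(1)] unfolding N_def[symmetric] by (simp add: algebra_simps)
          qed
          also have "\<dots> = (\<Prod>s\<in>T. max \<bar>s - t\<bar> h / 2)"
            using h by (simp add: exp_sum[OF T(1)] less_max_iff_disj)
          also have "\<dots> \<le> cmod (P x)" unfolding Pn
          proof (rule prod_mono)
            fix s assume s: "s \<in> T"
            have "h \<le> cmod (x - of_real s)" using clU[OF x(1)] s by auto
            moreover have "\<bar>s - t\<bar> \<le> cmod (x - of_real s) + cmod (x - of_real t)"
            proof -
              have "\<bar>s - t\<bar> = cmod ((x - of_real t) - (x - of_real s))"
                by (simp flip: of_real_diff)
              then show ?thesis using norm_triangle_ineq4[of "x - of_real t" "x - of_real s"] by simp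
            qed
            ultimately show "0 \<le> max \<bar>s - t\<bar> h / 2 \<and> max \<bar>s - t\<bar> h / 2 \<le> cmod (x - of_real s)"
              using t h by auto
          qed
          finally show ?thesis .
        qed
        have "cmod (G x) ^ a / cmod (P x) ^ b \<le> (B * exp (- W)) ^ a / (exp (- (C + ln 2) * N)) ^ b"
          using small[OF t(1), of x] t e B0 by (intro frac_le power_mono zero_le_power) auto
        also have "\<dots> = B ^ a * exp (real b * (C + ln 2) * N - real a * W)"
        proof -
          have "exp (real a * - W) / exp (real b * (- (C + ln 2) * N)) = exp (real b * (C + ln 2) * N - real a * W)"
            unfolding exp_diff[symmetric] by (rule arg_cong[where f=exp]) (simp add: algebra_simps)
          then show ?thesis unfolding power_mult_distrib exp_of_nat_mult[symmetric] times_divide_eq_right[symmetric] by simp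
        qed
        also have "\<dots> \<le> B ^ a * exp (- (N * real b) * ln 6)"
        proof (intro mult_left_mono)
          have "real b * (N * (C + ln 12)) \<le> real a * l * (N * (C + ln 12))"
            using b1 N C12 by (intro mult_right_mono) auto
          also have "\<dots> = real a * W" using N C12 by (simp add: l_def)
          finally have "real b * N * (C + ln 12) \<le> real a * W" by simp
          moreover have "ln (12::real) = ln 2 + ln 6" using ln_mult[of "2::real" 6] by simp
          ultimately show "exp (real b * (C + ln 2) * N - real a * W) \<le> exp (- (N * real b) * ln 6)"
            by (simp add: algebra_simps)
        qed (use B0 in auto)
        also have "exp (- (N * real b) * ln (6::real)) = (1/6) ^ (card T * b)"
        proof -
          have "(1/6::real) ^ (card T * b) = exp (ln (1/6)) ^ (card T * b)" by simp
          also have "\<dots> = exp (real (card T * b) * ln (1/6))" by (rule exp_of_nat_mult[symmetric])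
          finally show ?thesis by (simp add: N_def ln_div)
        qed
        finally show ?thesis unfolding nf Q_def by (simp add: mult.commute)
      qed
    qed
    moreover have zU: "z \<in> closure U" using 3 z closure_subset[of U] by (force simp: U_def dist_norm norm_minus_commute)
    ultimately have "cmod (G z) ^ a \<le> Q * cmod (P z) ^ b"
      using Pne[OF zU] by (simp add: f_def norm_divide norm_power divide_le_eq)
    also have "\<dots> \<le> Q * 5 ^ (card T * b)"
    proof (intro mult_left_mono)
      have "(\<Prod>t\<in>T. cmod (z - complex_of_real t)) \<le> (\<Prod>t\<in>T. 5)"
      proof (rule prod_mono)
        fix t assume "t \<in> T"
        then have "cmod (complex_of_real t) \<le> 2" using T(3) by simp
        then show "0 \<le> cmod (z - of_real t) \<and> cmod (z - of_real t) \<le> 5"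
          using z norm_triangle_ineq4[of z "of_real t"] by simp
      qed
      then have "cmod (P z) \<le> 5 ^ card T" by (simp add: P_def prod_norm)
      then have "cmod (P z) ^ b \<le> (5 ^ card T) ^ b" by (intro power_mono) auto
      then show "cmod (P z) ^ b \<le> 5 ^ (card T * b)" by (simp add: power_mult)
    qed (use B0 in \<open>simp add: Q_def\<close>)
    also have "\<dots> = B ^ a * (5/6) ^ (card T * b)" by (simp add: Q_def power_divide)
    also have "\<dots> \<le> B ^ a * exp (- (line_expo C * W)) ^ a"
    proof (intro mult_left_mono)
      have "(5/6::real) ^ (card T * b) = exp (ln (5/6)) ^ (card T * b)" by simp
      also have "\<dots> = exp (real (card T * b) * ln (5/6))" by (rule exp_of_nat_mult[symmetric])
      also have "\<dots> \<le> exp (real a * - (line_expo C * W))"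
      proof -
        have "ln (5/6::real) = - ln (6/5)" by (simp add: ln_div)
        moreover have "line_expo C * W * real a \<le> N * real b * ln (6/5)"
        proof -
          have "line_expo C * W * real a = (real a * l / 2) * (N * ln (6/5))"
          proof -
            have "l * N = W / (C + ln 12)" using N by (simp add: l_def)
            moreover have "(real a * l / 2) * (N * ln (6/5)) = real a / 2 * ln (6/5) * (l * N)"
              by (simp only: divide_inverse ac_simps)
            ultimately have 1: "(real a * l / 2) * (N * ln (6/5)) = real a / 2 * ln (6/5) * (W / (C + ln 12))" by (simp only:)
            show ?thesis unfolding 1 line_expo_def by (simp only: divide_inverse inverse_mult_distrib ac_simps)
          qed
          also have "\<dots> \<le> real b * (N * ln (6/5))" using b2 N by (intro mult_right_mono) auto
          finally show ?thesis by (simp add: ac_simps)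
        qed
        ultimately show ?thesis by (simp add: N_def algebra_simps)
      qed
      also have "\<dots> = exp (- (line_expo C * W)) ^ a" by (rule exp_of_nat_mult)
      finally show "(5/6::real) ^ (card T * b) \<le> exp (- (line_expo C * W)) ^ a" .
    qed (use B0 in simp)
    finally have "cmod (G z) ^ a \<le> (B * exp (- (line_expo C * W))) ^ a" by (simp add: power_mult_distrib)
    then have "cmod (G z) \<le> B * exp (- (line_expo C * W))"
      using a0 B0 by (metis power_mono_iff norm_ge_zero mult_nonneg_nonneg exp_ge_zero)
    then show ?thesis by simp
  qed
qed

text \<open>The radius \<open>20 * taylor_const\<close> makes the complex extension holomorphic in
  radius 20 and bounded by \<open>2 * B\<close> in radius 10. Likewise balls of radius
  \<open>2 * taylor_const * h\<close> around the points of \<open>T\<close> give smallness on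
  complex discs of radius \<open>h\<close>. Unit circles around real points of modulus at most 2
  stay in the disc of radius 3 of \<open>two_constants\<close>, so Cauchy's inequality delivers all
  derivatives along the line with the same bound.\<close>

lemma line_smallness:
  fixes v :: "real^'n::finite \<Rightarrow> real" and w :: "real^'n" and T :: "real set"
  assumes v: "harmonic_on S v" and S: "ball p (20 * taylor_const TYPE('n)) \<subseteq> S"
    and B: "\<And>y. y \<in> ball p (20 * taylor_const TYPE('n)) \<Longrightarrow> \<bar>v y\<bar> \<le> B"
    and w: "\<And>i. \<bar>w $ i\<bar> \<le> 1"
    and T: "finite T" "T \<noteq> {}" "\<And>t. t \<in> T \<Longrightarrow> \<bar>t\<bar> \<le> 2" and h: "0 < h" "h \<le> 1"
    and small: "\<And>t y. t \<in> T \<Longrightarrow> y \<in> ball (p + t *\<^sub>R w) (2 * taylor_const TYPE('n) * h) \<Longrightarrow> \<bar>v y\<bar> \<le> B * exp (- W)"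
    and W: "W \<ge> 0" and C: "C \<ge> 0"
    and pot: "\<And>t. t \<in> T \<Longrightarrow> (\<Sum>s\<in>T. ln (1 / max \<bar>s - t\<bar> h)) \<le> C * real (card T)"
    and t: "\<bar>t\<bar> \<le> 2"
  shows "\<bar>(dder S w ^^ k) v (p + t *\<^sub>R w) / fact k\<bar> \<le> 2 * B * exp (- line_expo C * W)"
proof -
  let ?K = "taylor_const TYPE('n)"
  have K: "?K \<ge> 6" "?K \<ge> 6 * real CARD('n)" by (rule taylor_const_ge)+
  have B0: "B \<ge> 0" using B[of p] K by force
  have r: "20 * ?K > 0" using K by simp
  have sub: "ball (p + s *\<^sub>R w) (2 * ?K * h) \<subseteq> ball p (20 * ?K)" if "\<bar>s\<bar> \<le> 2" for s
  proof -
    have "norm w \<le> ?K" using norm_le_card[of w 1] w K card_ge_1[where 'n='n] by simp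
    then have "norm (s *\<^sub>R w) \<le> 2 * ?K" using that by (auto intro!: mult_mono)
    moreover have "2 * ?K * h \<le> 2 * ?K" using h K by simp
    ultimately have "norm (s *\<^sub>R w) + 2 * ?K * h \<le> 20 * ?K" using K by linarith
    then show ?thesis by (intro ball_subset_ball_iff[THEN iffD2]) (simp add: dist_norm)
  qed
  obtain G where hol0: "G holomorphic_on ball 0 (20 * ?K / ?K)"
    and bd0: "\<And>z. cmod z \<le> 20 * ?K / (2 * ?K) \<Longrightarrow> cmod (G z) \<le> 2 * B"
    and der0: "\<And>t k. \<bar>t\<bar> < 20 * ?K / (2 * ?K) \<Longrightarrow> (deriv ^^ k) G (of_real t) = of_real ((dder S w ^^ k) v (p + t *\<^sub>R w))"
    using complex_extension[OF v r S B w] by metis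
  have e: "20 * ?K / ?K = 20" "20 * ?K / (2 * ?K) = 10" using K by simp_all
  note hol = hol0[unfolded e] and bd = bd0[unfolded e] and der = der0[unfolded e]
  have hol10: "G holomorphic_on ball 0 10" by (rule holomorphic_on_subset[OF hol]) auto
  have sm: "cmod (G z) \<le> (2 * B) * exp (- W)" if s: "s \<in> T" and z: "cmod (z - of_real s) \<le> h" for s z
  proof -
    have hol2: "G holomorphic_on ball (of_real s) 2"
    proof (rule holomorphic_on_subset[OF hol10], rule subsetI)
      fix x assume "x \<in> ball (complex_of_real s) 2"
      then have "cmod (x - of_real s) < 2" by (simp add: dist_norm norm_minus_commute)
      then show "x \<in> ball 0 10" using norm_triangle_sub[of x "of_real s"] T(3)[OF s] by simp
    qed
    have zb: "z \<in> ball (of_real s) 2" using z h by (simp add: dist_norm norm_minus_commute)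
    have sums: "(\<lambda>k. (deriv ^^ k) G (of_real s) / fact k * (z - of_real s) ^ k) sums G z"
      by (rule holomorphic_power_series[OF hol2 zb])
    have s10: "\<bar>s\<bar> < 10" using T(3)[OF s] by simp
    have bnd: "norm ((deriv ^^ k) G (of_real s) / fact k * (z - of_real s) ^ k) \<le> B * exp (- W) * (1/2) ^ k" for k
    proof -
      have "\<bar>(dder S w ^^ k) v (p + s *\<^sub>R w) / fact k\<bar> \<le> (?K / (2 * ?K * h)) ^ k * (B * exp (- W))"
        by (rule taylor_coeff_bound[OF v _ _ small[OF s] w]) (use K h S sub[OF T(3)[OF s]] in auto)
      moreover have "?K / (2 * ?K * h) = 1 / (2 * h)" using K by simp
      ultimately have 1: "\<bar>(dder S w ^^ k) v (p + s *\<^sub>R w)\<bar> / fact k \<le> (1 / (2 * h)) ^ k * (B * exp (- W))"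
        by (simp add: abs_divide)
      have "norm ((deriv ^^ k) G (of_real s) / fact k * (z - of_real s) ^ k)
         = \<bar>(dder S w ^^ k) v (p + s *\<^sub>R w)\<bar> / fact k * cmod (z - of_real s) ^ k"
        unfolding der[OF s10] by (simp add: norm_mult norm_divide norm_power)
      also have "\<dots> \<le> (1 / (2 * h)) ^ k * (B * exp (- W)) * h ^ k"
        using B0 h z by (intro mult_mono 1 power_mono) auto
      also have "\<dots> = B * exp (- W) * (1/2) ^ k" using h by (simp add: power_divide power_mult_distrib)
      finally show ?thesis .
    qed
    have g: "(\<lambda>k. B * exp (- W) * (1/2) ^ k) sums (B * exp (- W) * (1 / (1 - 1/2)))"
      by (intro sums_mult geometric_sums) simp
    have "norm (G z) \<le> B * exp (- W) * (1 / (1 - 1/2))"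
      unfolding sums_unique[OF sums] sums_unique[OF g] by (rule norm_suminf_le[OF bnd sums_summable[OF g]])
    then show ?thesis by simp
  qed
  have main: "cmod (G z) \<le> 2 * B * exp (- line_expo C * W)" if "cmod z \<le> 3" for z
    by (rule two_constants[OF hol10 _ T h(1) sm W C pot that]) (use bd in auto)
  have t10: "\<bar>t\<bar> < 10" using t by simp
  have sub3: "cmod z \<le> 3" if "z \<in> cball (of_real t) 1" for z
  proof -
    have "cmod z \<le> cmod (of_real t) + cmod (z - of_real t)" by (rule norm_triangle_sub)
    then show ?thesis using that t by (simp add: dist_norm norm_minus_commute)
  qed
  have "norm ((deriv ^^ k) G (of_real t)) \<le> fact k * (2 * B * exp (- line_expo C * W)) / 1 ^ k"
  proof (rule Cauchy_inequality)
    have "cball (complex_of_real t) 1 \<subseteq> ball 0 10" using sub3 by force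
    then show "G holomorphic_on ball (of_real t) 1" "continuous_on (cball (of_real t) 1) G"
      using hol10 ball_subset_cball by (blast intro: holomorphic_on_subset holomorphic_on_imp_continuous_on)+
    show "norm (G z) \<le> 2 * B * exp (- line_expo C * W)" if "norm (of_real t - z) = 1" for z
      by (rule main[OF sub3]) (simp add: dist_norm that)
  qed simp
  then show ?thesis unfolding der[OF t10] by (simp add: abs_divide divide_le_eq mult.commute)
qed

subsection \<open>Growth at one scale forces smallness at all larger scales\<close>

lemma partial_le_gradient: "\<bar>partial_deriv i f x\<bar> \<le> norm (gradient f x)"
  using component_le_norm_cart[of "gradient f x" i] by (simp add: gradient_def)

lemma gradient_le_sum_partial: "norm (gradient f x) \<le> (\<Sum>i\<in>UNIV. \<bar>partial_deriv i f x\<bar>)"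
  using norm_le_l1_cart[of "gradient f x"] by (simp add: gradient_def)

lemma half_power_sum_bound:
  assumes s: "a sums (x::real)" and a: "\<And>k. \<bar>a k\<bar> \<le> (1/2) ^ k * Z"
  shows "\<bar>x\<bar> \<le> 2 * Z"
proof -
  have g: "(\<lambda>k. (1/2) ^ k * Z) sums (1 / (1 - 1/2) * Z)" by (intro sums_mult2 geometric_sums) simp
  have "norm (suminf a) \<le> (\<Sum>k. (1/2) ^ k * Z)"
    by (rule norm_suminf_le[OF _ sums_summable[OF g]]) (use a in simp)
  then show ?thesis unfolding sums_unique[OF s, symmetric] sums_unique[OF g, symmetric] by simp
qed

text \<open>Chosen so that (40 n \<open>taylor_const\<close>)^(\<open>rate\<close> N) = exp(N / 2).
  Half of the growth exp(N) pays for the Taylor coefficients of order up to \<open>rate\<close> N,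
  the other half for the factor 4 n.\<close>

definition rate :: "'n::finite itself \<Rightarrow> real" where
  "rate T = 1 / (2 * ln (40 * real CARD('n) * taylor_const T))"

lemma ln_pos_aux: "ln (40 * real CARD('n::finite) * taylor_const TYPE('n)) > 0"
proof -
  have "40 * real CARD('n) * taylor_const TYPE('n) \<ge> 40 * 1 * 6"
    using card_ge_1[where 'n='n] taylor_const_ge(2)[where 'n='n] by (intro mult_mono) auto
  then show ?thesis by (intro ln_gt_zero) linarith
qed

lemma rate_pos: "rate TYPE('n::finite) > 0"
  using ln_pos_aux[where 'n='n] by (simp add: rate_def)

text \<open>The Taylor coefficients of \<open>\<nabla>U\<close> at \<open>x\<close> of order at most \<open>K\<close> are controlled by the small
  ball, and one coefficient of larger order is responsible for the growth. It dominates the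
  low orders at every larger scale.\<close>

lemma growth_smallness:
  fixes U :: "real^'n::finite \<Rightarrow> real"
  assumes U: "harmonic_on S U" and R: "ball x R \<subseteq> S"
    and B: "\<And>y. y \<in> ball x R \<Longrightarrow> norm (gradient U y) \<le> B"
    and r: "r > 0" and y: "y \<in> ball x (10 * real CARD('n) * r)"
    and bad: "\<And>z. z \<in> ball x r \<Longrightarrow> exp N * norm (gradient U z) < norm (gradient U y)"
    and N: "N \<ge> 2 * ln (4 * real CARD('n))"
    and rho: "20 * real CARD('n) * r \<le> \<rho>" "2 * taylor_const TYPE('n) * \<rho> < R"
    and q: "q \<in> ball x \<rho>"
  shows "norm (gradient U q) \<le> 2 * real CARD('n) * B * (2 * taylor_const TYPE('n) * \<rho> / R) powr (rate TYPE('n) * N)"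
proof -
  let ?n = "real CARD('n)" and ?K = "taylor_const TYPE('n)"
  have n: "?n \<ge> 1" by (rule card_ge_1)
  have K6: "?K \<ge> 6" by (rule taylor_const_ge)
  have nr: "?n * r \<ge> r" using n r by simp
  have rho0: "\<rho> > 0" using rho(1) nr r by linarith
  have Krho: "?K * \<rho> \<ge> 6 * \<rho>" using K6 rho0 by simp
  have R0: "R > 0" "R > \<rho>" using Krho rho(2) rho0 by linarith+
  have rR: "r \<le> R" using R0 rho(1) nr r by linarith
  have B0: "B \<ge> 0" using order_trans[OF norm_ge_zero B[of x]] R0 by simp
  define t where "t = 10 * ?n * r"
  have t: "t > 0" "2 * t \<le> \<rho>" using r n rho(1) by (auto simp: t_def)
  define g where "g = norm (gradient U y)"
  have g: "g > 0"
  proof -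
    have "0 \<le> exp N * norm (gradient U x)" by simp
    also have "\<dots> < g" unfolding g_def by (rule bad) (use r in simp)
    finally show ?thesis .
  qed
  define L where "L = 40 * ?n * ?K"
  have L: "L \<ge> 1" "ln L > 0"
  proof -
    show "ln L > 0" unfolding L_def by (rule ln_pos_aux)
    have "40 * ?n * ?K \<ge> 40 * 1 * 6" using n K6 by (intro mult_mono) auto
    then show "L \<ge> 1" unfolding L_def by linarith
  qed
  have N0: "N \<ge> 0" using order_trans[OF _ N, of 0] n by simp
  define K where "K = nat \<lfloor>rate TYPE('n) * N\<rfloor>"
  have rN: "rate TYPE('n) * N \<ge> 0" using rate_pos[where 'n='n] N0 by simp
  have Kle: "real K \<le> rate TYPE('n) * N" unfolding K_def using rN by simp
  have Kge: "rate TYPE('n) * N \<le> real (Suc K)" unfolding K_def using rN by linarith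
  have LK: "4 * ?n * L ^ K \<le> exp N"
  proof -
    have "L ^ K = exp (real K * ln L)" using L by (simp add: exp_of_nat_mult)
    also have "\<dots> \<le> exp (N / 2)"
    proof -
      have "real K * ln L \<le> (rate TYPE('n) * N) * ln L" using Kle L by (intro mult_right_mono) auto
      also have "\<dots> = N / 2" using L by (simp add: rate_def L_def[symmetric])
      finally show ?thesis by simp
    qed
    finally have 1: "L ^ K \<le> exp (N / 2)" .
    have "4 * ?n = exp (ln (4 * ?n))" using n by simp
    also have "\<dots> \<le> exp (N / 2)" unfolding exp_le_cancel_iff using N by simp
    finally have "4 * ?n * L ^ K \<le> exp (N / 2) * exp (N / 2)" using 1 n L by (intro mult_mono) auto
    then show ?thesis by (simp add: exp_add[symmetric])
  qed
  have LK': "4 * ?n * exp (- N) * L ^ K \<le> 1"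
    using mult_right_mono[OF LK, of "exp (- N)"] by (simp add: exp_minus_inverse ac_simps)
  define a where "a j w k = (dder S w ^^ k) (partial_deriv j U) x / fact k" for j w k
  have vh: "harmonic_on S (partial_deriv j U)" for j by (rule harmonic_partial(1)[OF U])
  have low: "\<bar>a j w k\<bar> \<le> (?K / r) ^ k * (exp (- N) * g)" if "\<And>i. \<bar>w $ i\<bar> \<le> 1" for j k and w :: "real^'n"
    unfolding a_def
  proof (rule taylor_coeff_bound[OF vh r _ _ that])
    show "ball x r \<subseteq> S" using R subset_ball[OF rR] by blast
    fix z assume z: "z \<in> ball x r"
    have "norm (gradient U z) = exp (- N) * (exp N * norm (gradient U z))"
      by (simp add: mult.assoc[symmetric] exp_add[symmetric])
    also have "\<dots> \<le> exp (- N) * g" using bad[OF z] by (intro mult_left_mono) (auto simp: g_def)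
    finally show "\<bar>partial_deriv j U z\<bar> \<le> exp (- N) * g" using partial_le_gradient order_trans by blast
  qed
  have high: "\<bar>a j w k\<bar> \<le> (?K / R) ^ k * B" if "\<And>i. \<bar>w $ i\<bar> \<le> 1" for j k and w :: "real^'n"
    unfolding a_def
    by (rule taylor_coeff_bound[OF vh R0(1) R _ that]) (use B partial_le_gradient order_trans in blast)
  have sums: "(\<lambda>k. a j w k * s ^ k) sums partial_deriv j U (x + s *\<^sub>R w)"
    if w: "\<And>i. \<bar>w $ i\<bar> \<le> 1" and s: "0 \<le> s" "s \<le> \<rho>" for j s and w :: "real^'n"
    unfolding a_def
  proof (rule taylor_sums[OF vh R0(1) R _ w])
    show "\<bar>partial_deriv j U z\<bar> \<le> B" if "z \<in> ball x R" for z using B[OF that] partial_le_gradient order_trans by blast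
    have "?K * s \<le> ?K * \<rho>" using s K6 by simp
    then have "2 * ?K * s < R" using rho(2) by linarith
    then show "\<bar>s\<bar> < R / (2 * ?K)" using s K6 by (simp add: field_simps)
  qed
  obtain i where i: "\<bar>partial_deriv i U y\<bar> \<ge> g / ?n"
  proof (rule ccontr)
    assume "\<not> thesis"
    then have "\<bar>partial_deriv i U y\<bar> < g / ?n" for i using that by (meson not_le)
    then have "(\<Sum>i\<in>UNIV. \<bar>partial_deriv i U y\<bar>) < (\<Sum>i\<in>(UNIV::'n set). g / ?n)"
      by (intro sum_strict_mono) auto
    then show False using gradient_le_sum_partial[of U y] n by (simp add: g_def)
  qed
  define w where "w = (1 / t) *\<^sub>R (y - x)"
  have yw: "y = x + t *\<^sub>R w" using t by (simp add: w_def)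
  have w: "\<bar>w $ i\<bar> \<le> 1" for i
  proof -
    have "norm w \<le> 1" using y t by (simp add: w_def t_def[symmetric] dist_norm norm_minus_commute)
    then show ?thesis using component_le_norm_cart order_trans by blast
  qed
  \<comment> \<open>Otherwise every Taylor term at \<open>y\<close> is at most 2^-k
    \<open>g / (4 * ?n)\<close>: the low orders because exp(-N) beats \<open>L ^ K\<close>, the high
    ones by assumption. The sum would be at most \<open>g / (2 * ?n)\<close>, too small for the
    component selected by \<open>i\<close>.\<close>
  have "\<exists>k>K. \<bar>a i w k\<bar> * (2 * t) ^ k \<ge> g / (4 * ?n)"
  proof (rule ccontr)
    assume "\<not> (\<exists>k>K. \<bar>a i w k\<bar> * (2 * t) ^ k \<ge> g / (4 * ?n))"
    then have hk: "\<bar>a i w k\<bar> * (2 * t) ^ k < g / (4 * ?n)" if "k > K" for k using that by (meson not_le)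
    have "\<bar>a i w k * t ^ k\<bar> \<le> (1/2) ^ k * (g / (4 * ?n))" for k
    proof (cases "k > K")
      case True
      then show ?thesis using hk[OF True] t by (simp add: abs_mult power_mult_distrib field_simps)
    next
      case False
      have "\<bar>a i w k * t ^ k\<bar> \<le> (?K / r) ^ k * (exp (- N) * g) * t ^ k"
        unfolding abs_mult using t by (simp add: low[OF w] mult_right_mono)
      also have "\<dots> = (10 * ?n * ?K) ^ k * exp (- N) * g"
        using r by (simp add: t_def power_mult_distrib power_divide)
      also have "\<dots> = (1/2) ^ k * ((20 * ?n * ?K) ^ k * exp (- N) * g)"
        by (simp add: power_mult_distrib[symmetric] mult.assoc[symmetric])
      also have "\<dots> \<le> (1/2) ^ k * (L ^ K * exp (- N) * g)"
      proof (intro mult_left_mono mult_right_mono)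
        have "(20 * ?n * ?K) ^ k \<le> L ^ k" using n K6 by (intro power_mono) (auto simp: L_def)
        also have "\<dots> \<le> L ^ K" using L False by (intro power_increasing) auto
        finally show "(20 * ?n * ?K) ^ k \<le> L ^ K" .
      qed (use g in auto)
      also have "\<dots> \<le> (1/2) ^ k * (g / (4 * ?n))"
        using mult_right_mono[OF LK', of "g / (4 * ?n)"] g n by (intro mult_left_mono) (auto simp: field_simps)
      finally show ?thesis .
    qed
    from half_power_sum_bound[OF sums[OF w, of t] this] t
    have "\<bar>partial_deriv i U y\<bar> \<le> 2 * (g / (4 * ?n))" unfolding yw by simp
    also have "\<dots> < g / ?n" using g n by (simp add: field_simps)
    finally show False using i by simp
  qed
  then obtain k1 where k1: "k1 > K" "\<bar>a i w k1\<bar> * (2 * t) ^ k1 \<ge> g / (4 * ?n)" by blast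
  define X where "X = ?K * \<rho> / R"
  have X: "0 < X" "2 * X < 1" using rho0 R0 K6 rho(2) by (auto simp: X_def field_simps)
  \<comment> \<open>The responsible coefficient also obeys the Cauchy bound at the large radius
    \<open>R\<close>, which bounds the growth \<open>g\<close> itself and, through
    \<open>low\<close>, all low-order coefficients.\<close>
  have gB: "g \<le> 4 * ?n * ((2 * t / \<rho>) ^ k1 * X ^ k1 * B)"
  proof -
    have "g / (4 * ?n) \<le> (?K / R) ^ k1 * B * (2 * t) ^ k1"
      by (rule order_trans[OF k1(2) mult_right_mono[OF high[OF w]]]) (use t in simp)
    also have "\<dots> = (2 * t / \<rho>) ^ k1 * X ^ k1 * B"
      using rho0 by (simp add: X_def power_mult_distrib power_divide)
    finally show ?thesis using n by (simp add: field_simps)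
  qed
  define w' where "w' = (1 / \<rho>) *\<^sub>R (q - x)"
  have qw: "q = x + \<rho> *\<^sub>R w'" using rho0 by (simp add: w'_def)
  have w': "\<bar>w' $ i\<bar> \<le> 1" for i
  proof -
    have "norm w' \<le> 1" using q rho0 by (simp add: w'_def dist_norm norm_minus_commute)
    then show ?thesis using component_le_norm_cart order_trans by blast
  qed
  define Z where "Z = (2 * X) ^ Suc K * B"
  have trm: "\<bar>a j w' k * \<rho> ^ k\<bar> \<le> (1/2) ^ k * Z" for j k
  proof (cases "k > K")
    case True
    have "\<bar>a j w' k * \<rho> ^ k\<bar> \<le> (?K / R) ^ k * B * \<rho> ^ k"
      unfolding abs_mult using rho0 by (simp add: high[OF w'] mult_right_mono)
    also have "\<dots> = (1/2) ^ k * ((2 * X) ^ k * B)"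
      by (simp add: X_def power_mult_distrib power_divide)
    also have "\<dots> \<le> (1/2) ^ k * Z" unfolding Z_def
      using X True B0 by (intro mult_left_mono mult_right_mono power_decreasing) auto
    finally show ?thesis .
  next
    case False
    have "\<bar>a j w' k * \<rho> ^ k\<bar> \<le> (?K / r) ^ k * (exp (- N) * g) * \<rho> ^ k"
      unfolding abs_mult using rho0 by (simp add: low[OF w'] mult_right_mono)
    also have "\<dots> \<le> (?K / r) ^ k * (exp (- N) * (4 * ?n * ((2 * t / \<rho>) ^ k1 * X ^ k1 * B))) * \<rho> ^ k"
      using K6 r rho0 by (intro mult_right_mono mult_left_mono gB) auto
    \<comment> \<open>The identity behind the 40 in \<open>L\<close>: \<open>?K * \<rho> / r\<close>
      is 1/2 times \<open>40 * ?n * ?K\<close> times \<open>\<rho> / (2 * t)\<close>. One factor 2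
      supplies the geometric series, the other the passage from \<open>t\<close> to
      \<open>2 * t\<close>. As \<open>k < k1\<close> and \<open>2 * t \<le> \<rho>\<close>, the
      powers of \<open>\<rho> / (2 * t)\<close> then cancel favourably.\<close>
    also have "\<dots> = (1/2) ^ k * ((2 * (20 * ?n * ?K)) ^ k * (4 * ?n * exp (- N)) * ((\<rho> / (2 * t)) ^ k * (2 * t / \<rho>) ^ k1) * X ^ k1 * B)"
    proof -
      have "1/2 * (2 * (20 * ?n * ?K)) * (\<rho> / (2 * t)) = ?K / r * \<rho>" using r n by (simp add: t_def)
      then have "(1/2) ^ k * (2 * (20 * ?n * ?K)) ^ k * (\<rho> / (2 * t)) ^ k = (?K / r) ^ k * \<rho> ^ k"
        unfolding power_mult_distrib[symmetric] by (rule arg_cong)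
      then show ?thesis by (simp only: ac_simps) (simp add: ac_simps)
    qed
    also have "\<dots> \<le> (1/2) ^ k * (L ^ K * (4 * ?n * exp (- N)) * 1 * X ^ Suc K * B)"
    proof (intro mult_left_mono mult_right_mono mult_mono)
      have "2 * (20 * ?n * ?K) = L" by (simp add: L_def)
      then have "(2 * (20 * ?n * ?K)) ^ k = L ^ k" by (rule arg_cong)
      also have "\<dots> \<le> L ^ K" using L False by (intro power_increasing) auto
      finally show "(2 * (20 * ?n * ?K)) ^ k \<le> L ^ K" .
      have "(\<rho> / (2 * t)) ^ k * (2 * t / \<rho>) ^ k1 = (2 * t / \<rho>) ^ (k1 - k)"
        using t rho0 k1(1) False by (simp add: power_diff power_divide)
      also have "\<dots> \<le> 1" using t rho0 by (intro power_le_one) auto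
      finally show "(\<rho> / (2 * t)) ^ k * (2 * t / \<rho>) ^ k1 \<le> 1" .
      show "X ^ k1 \<le> X ^ Suc K" using X k1(1) by (intro power_decreasing) auto
    qed (use n K6 L B0 X t rho0 in auto)
    also have "\<dots> = (1/2) ^ k * ((4 * ?n * exp (- N) * L ^ K) * (X ^ Suc K * B))" by (simp add: ac_simps)
    also have "\<dots> \<le> (1/2) ^ k * (1 * ((2 * X) ^ Suc K * B))"
      using X B0 by (intro mult_left_mono mult_mono LK' power_mono) auto
    finally show ?thesis by (simp add: Z_def)
  qed
  have pb: "\<bar>partial_deriv j U q\<bar> \<le> 2 * Z" for j
    using half_power_sum_bound[OF sums[OF w', of \<rho> j] trm] rho0 unfolding qw by simp
  have "norm (gradient U q) \<le> (\<Sum>j\<in>(UNIV::'n set). 2 * Z)"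
    by (rule order_trans[OF gradient_le_sum_partial sum_mono[OF pb]])
  also have "\<dots> = 2 * ?n * B * (2 * X) ^ Suc K" by (simp add: Z_def)
  also have "(2 * X) ^ Suc K = (2 * X) powr real (Suc K)" using X by (subst powr_realpow) auto
  also have "2 * ?n * B * (2 * X) powr real (Suc K) \<le> 2 * ?n * B * (2 * X) powr (rate TYPE('n) * N)"
    using X Kge B0 n by (intro mult_left_mono powr_mono') auto
  finally show ?thesis by (simp add: X_def mult.assoc)
qed

subsection \<open>Cells and sweeping in a coordinate direction\<close>

definition cell_center :: "nat \<Rightarrow> ('n \<Rightarrow> int) \<Rightarrow> real^'n::finite" where
  "cell_center D f = (\<chi> i. (of_int (f i) + 1/2) / real D - 1/2)"

text \<open>Index 0 begins at coordinate -1/2, so the range from 0 to \<open>D - 1\<close> fills the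
  unit cube and the present range a cube of side 3. The margin is needed because tubes of slope
  below one leave the unit cube sideways. For odd \<open>D\<close> the fixed layer is centred on the
  hyperplane.\<close>

definition cells :: "'n::finite \<Rightarrow> nat \<Rightarrow> ('n \<Rightarrow> int) set" where
  "cells k D = {f. f k = (int D - 1) div 2 \<and> (\<forall>i. i \<noteq> k \<longrightarrow> f i \<in> {- int D..<2 * int D})}"

lemma finite_cells: "finite (cells k D)"
proof (rule finite_subset)
  show "cells k D \<subseteq> {f. \<forall>i. f i \<in> {- int D..<2 * int D} \<union> {(int D - 1) div 2}}"
    by (auto simp: cells_def)
  have "finite (Pi\<^sub>E (UNIV :: 'a set) (\<lambda>_. {- int D..<2 * int D} \<union> {(int D - 1) div 2}))"
    by (intro finite_PiE) auto
  moreover have "{f :: 'a \<Rightarrow> int. \<forall>i. f i \<in> {- int D..<2 * int D} \<union> {(int D - 1) div 2}} =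
     Pi\<^sub>E UNIV (\<lambda>_. {- int D..<2 * int D} \<union> {(int D - 1) div 2})"
    by (auto simp: PiE_def extensional_def Pi_def)
  ultimately show "finite {f :: 'a \<Rightarrow> int. \<forall>i. f i \<in> {- int D..<2 * int D} \<union> {(int D - 1) div 2}}" by simp
qed

lemma cells_upd: "f \<in> cells k D \<Longrightarrow> i \<noteq> k \<Longrightarrow> a \<in> {- int D..<2 * int D} \<Longrightarrow> f(i := a) \<in> cells k D"
  by (auto simp: cells_def)

lemma cells_range: "f \<in> cells k D \<Longrightarrow> i \<noteq> k \<Longrightarrow> f i \<in> {- int D..<2 * int D}"
  by (auto simp: cells_def)

lemma cell_center_bound:
  assumes f: "f \<in> cells k D" and D: "D > 0"
  shows "\<bar>cell_center D f $ i\<bar> \<le> 3/2"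
proof -
  have "- int D \<le> f i \<and> f i + 1 \<le> 2 * int D"
  proof (cases "i = k")
    case True
    then have "f i = (int D - 1) div 2" using f by (simp add: cells_def)
    moreover have "- d \<le> (d - 1) div 2 \<and> (d - 1) div 2 + 1 \<le> 2 * d" if "d > 0" for d :: int
      using that by presburger
    ultimately show ?thesis using D by simp
  next
    case False
    then show ?thesis using cells_range[OF f False] by auto
  qed
  then have "- real D \<le> of_int (f i)" "of_int (f i) + 1 \<le> 2 * real D"
    by (metis of_int_le_iff of_int_minus of_int_of_nat_eq) (use \<open>- int D \<le> f i \<and> f i + 1 \<le> 2 * int D\<close> in linarith)
  then have "- 1 \<le> (of_int (f i) + 1/2) / real D" "(of_int (f i) + 1/2) / real D \<le> 2"
    using D by (auto simp: field_simps)
  then show ?thesis unfolding cell_center_def vec_lambda_beta by linarith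
qed

definition sweep :: "'n::finite \<Rightarrow> nat \<Rightarrow> 'n \<Rightarrow> real \<Rightarrow> ('n \<Rightarrow> int) set \<Rightarrow> ('n \<Rightarrow> int) set" where
  "sweep k D i c F = {f \<in> cells k D. real (card {a \<in> {- int D..<2 * int D}. f(i := a) \<in> F}) \<ge> c * (3 * real D)}"

text \<open>Counting by rows in direction \<open>i\<close>: the mean row density is at least
  \<open>c\<close>, and rows of density below \<open>c / 2\<close> account for at most half of
  it.\<close>

lemma sweep_card:
  assumes F: "F \<subseteq> cells k D" and i: "i \<noteq> k" and D: "D > 0"
    and c: "real (card F) \<ge> c * real (card (cells k D))" "c > 0"
  shows "real (card (sweep k D i (c / 2) F)) \<ge> c / 2 * real (card (cells k D))"
proof -
  let ?R = "{- int D..<2 * int D}" and ?X = "cells k D"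
  have finF: "finite F" using F finite_cells finite_subset by blast
  define g where "g f = card {a \<in> ?R. f(i := a) \<in> F}" for f
  have cR: "card ?R = 3 * D" by simp
  have gle: "g f \<le> 3 * D" for f
    unfolding g_def cR[symmetric] by (rule card_mono) auto
  \<comment> \<open>Exchanging the \<open>i\<close>-th entry of the cell with the extra index is an
    involution.\<close>
  have "card {(f, a). f \<in> ?X \<and> a \<in> ?R \<and> f(i := a) \<in> F} = card (F \<times> ?R)"
  proof (rule bij_betw_same_card[of "\<lambda>(f, a). (f(i := a), f i)"])
    show "bij_betw (\<lambda>(f, a). (f(i := a), f i)) {(f, a). f \<in> ?X \<and> a \<in> ?R \<and> f(i := a) \<in> F} (F \<times> ?R)"
      by (rule bij_betw_byWitness[where f'="\<lambda>(f, a). (f(i := a), f i)"])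
         (use F i cells_range[of _ k D i] cells_upd[of _ k D i] in auto)
  qed
  moreover have "{(f, a). f \<in> ?X \<and> a \<in> ?R \<and> f(i := a) \<in> F} = (SIGMA f:?X. {a \<in> ?R. f(i := a) \<in> F})" by auto
  moreover have "finite {a \<in> ?R. f(i := a) \<in> F}" for f by (rule finite_subset[of _ ?R]) auto
  ultimately have "(\<Sum>f\<in>?X. g f) = card F * (3 * D)"
    using card_SigmaI[of ?X "\<lambda>f. {a \<in> ?R. f(i := a) \<in> F}"] finite_cells[of k D]
    unfolding g_def card_cartesian_product cR by metis
  then have tot: "real (card F) * (3 * real D) = (\<Sum>f\<in>?X. real (g f))"
    by (metis of_nat_sum of_nat_mult of_nat_numeral)
  define H where "H = sweep k D i (c / 2) F"
  have H: "H \<subseteq> ?X" by (auto simp: H_def sweep_def)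
  have "(\<Sum>f\<in>?X. real (g f)) = (\<Sum>f\<in>H. real (g f)) + (\<Sum>f\<in>?X - H. real (g f))"
    using sum.subset_diff[OF H finite_cells, of "\<lambda>f. real (g f)"] by simp
  also have "(\<Sum>f\<in>H. real (g f)) \<le> (\<Sum>f\<in>H. 3 * real D)"
    by (intro sum_mono) (metis gle of_nat_le_iff of_nat_mult of_nat_numeral)
  also have "(\<Sum>f\<in>?X - H. real (g f)) \<le> (\<Sum>f\<in>?X - H. c / 2 * (3 * real D))"
    by (intro sum_mono) (auto simp: H_def sweep_def g_def)
  also have "(\<Sum>f\<in>?X - H. c / 2 * (3 * real D)) \<le> real (card ?X) * (c / 2 * (3 * real D))"
    using c finite_cells D by (auto intro!: mult_right_mono card_mono)
  finally have "real (card F) * (3 * real D) \<le> real (card H) * (3 * real D) + real (card ?X) * (c / 2 * (3 * real D))"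
    by (simp add: tot)
  then have "3 * real D * real (card F) \<le> 3 * real D * (real (card H) + real (card ?X) * (c / 2))"
    by (simp add: algebra_simps)
  then have "real (card F) \<le> real (card H) + real (card ?X) * (c / 2)" using D by simp
  moreover have "c * real (card ?X) = c / 2 * real (card ?X) + c / 2 * real (card ?X)" by simp
  ultimately show ?thesis using c(1) unfolding H_def[symmetric] by (simp only: mult.commute)
qed

text \<open>Logarithm of \<open>D ^ D \<le> exp D * fact D\<close>; it says that a full row has
  bounded mean logarithmic potential.\<close>

lemma sum_ln_quotient_le: "(\<Sum>d\<in>{1..D}. ln (real D / real d)) \<le> real D"
proof (cases "D = 0")
  case False
  have "(\<Sum>d\<in>{1..D}. ln (real D / real d)) = real D * ln (real D) - ln (fact D)"
  proof -
    have "ln (fact D :: real) = (\<Sum>d\<in>{1..D}. ln (real d))"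
      unfolding fact_prod of_nat_prod by (subst ln_prod) auto
    moreover have "ln (real D / real d) = ln (real D) - ln (real d)" if "d \<in> {1..D}" for d
      using that False by (subst ln_div) auto
    ultimately show ?thesis by (simp add: sum_subtractf)
  qed
  moreover have "ln (real D ^ D) \<le> ln (exp (real D) * fact D)"
  proof -
    have "real D ^ D \<le> exp (real D) * fact D" by (rule power_self_le_exp)
    then show ?thesis using False by (subst ln_le_cancel_iff) auto
  qed
  ultimately show ?thesis using False by (simp add: ln_mult ln_realpow)
qed simp

text \<open>After discarding negative terms each index distance from 1 to \<open>D\<close> occurs at
  most twice, so the potential is at most \<open>ln D\<close> plus twice the sum in
  \<open>sum_ln_quotient_le\<close>, hence at most \<open>3 * D\<close> for any set of integers.
  Density converts this into a multiple of the cardinality.\<close>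

lemma potential_dense:
  fixes A :: "int set"
  assumes A: "finite A" "real (card A) \<ge> c * (3 * real D)" and c: "c > 0" and D: "D > 0"
  shows "(\<Sum>b\<in>A. ln (1 / max \<bar>(of_int b + 1/2) / real D - 1/2 - ((of_int a + 1/2) / real D - 1/2)\<bar> (1 / real D)))
     \<le> 1 / c * real (card A)"
proof -
  define \<phi> where "\<phi> b = ln (1 / max \<bar>(of_int b + 1/2) / real D - 1/2 - ((of_int a + 1/2) / real D - 1/2)\<bar> (1 / real D))" for b
  have lnD: "ln (real D) \<ge> 0" "ln (real D) \<le> real D"
    using D ln_le_minus_one[of "real D"] by (auto simp: Suc_leI)
  have phi: "\<phi> b = ln (real D / max (real_of_int \<bar>b - a\<bar>) 1)" for b
  proof -
    have "\<bar>(of_int b + 1/2) / real D - 1/2 - ((of_int a + 1/2) / real D - 1/2)\<bar> = real_of_int \<bar>b - a\<bar> / real D"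
      by (simp add: diff_divide_distrib[symmetric] abs_divide)
    moreover have "max (real_of_int \<bar>b - a\<bar> / real D) (1 / real D) = max (real_of_int \<bar>b - a\<bar>) 1 / real D"
      using D by (simp add: max_def divide_le_cancel)
    ultimately show ?thesis by (simp add: \<phi>_def)
  qed
  define I where "I = {a - int D..a + int D}"
  have "(\<Sum>b\<in>A. \<phi> b) \<le> (\<Sum>b\<in>A. max 0 (\<phi> b))" by (intro sum_mono) simp
  also have "\<dots> = (\<Sum>b\<in>A \<inter> I. max 0 (\<phi> b))"
  proof (rule sum.mono_neutral_right[OF A(1)])
    show "\<forall>b\<in>A - A \<inter> I. max 0 (\<phi> b) = 0"
    proof
      fix b assume "b \<in> A - A \<inter> I"
      then have "real_of_int \<bar>b - a\<bar> \<ge> real D" unfolding I_def by (simp add: abs_if) linarith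
      then have "real D / max (real_of_int \<bar>b - a\<bar>) 1 \<le> 1" using D by (simp add: divide_le_eq)
      moreover have "real D / max (real_of_int \<bar>b - a\<bar>) 1 > 0" using D by simp
      ultimately show "max 0 (\<phi> b) = 0" unfolding phi by simp
    qed
  qed auto
  also have "\<dots> \<le> (\<Sum>b\<in>I. max 0 (\<phi> b))" by (rule sum_mono2) (auto simp: I_def)
  also have "I = {a} \<union> (\<lambda>d. a + int d) ` {1..D} \<union> (\<lambda>d. a - int d) ` {1..D}"
  proof (intro equalityI subsetI)
    fix b assume b: "b \<in> I"
    show "b \<in> {a} \<union> (\<lambda>d. a + int d) ` {1..D} \<union> (\<lambda>d. a - int d) ` {1..D}"
    proof (cases b a rule: linorder_cases)
      case less then show ?thesis using b by (auto simp: I_def intro!: image_eqI[of _ _ "nat (a - b)"])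
    next
      case greater then show ?thesis using b by (auto simp: I_def intro!: image_eqI[of _ _ "nat (b - a)"])
    qed simp
  qed (auto simp: I_def)
  also have "(\<Sum>b\<in>\<dots>. max 0 (\<phi> b)) = max 0 (\<phi> a) + (\<Sum>d\<in>{1..D}. max 0 (\<phi> (a + int d))) + (\<Sum>d\<in>{1..D}. max 0 (\<phi> (a - int d)))"
    by (subst sum.union_disjoint; (subst sum.union_disjoint)?) (auto simp: sum.reindex inj_on_def)
  also have "max 0 (\<phi> a) = ln (real D)" using lnD by (simp add: phi)
  also have "(\<Sum>d\<in>{1..D}. max 0 (\<phi> (a + int d))) = (\<Sum>d\<in>{1..D}. ln (real D / real d))"
  proof (rule sum.cong[OF refl])
    fix d assume d: "d \<in> {1..D}"
    then have "real D / real d \<ge> 1" by simp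
    then have "ln (real D / real d) \<ge> 0" by simp
    moreover have "max (real d) 1 = real d" using d by (simp add: max_def)
    ultimately show "max 0 (\<phi> (a + int d)) = ln (real D / real d)" by (simp add: phi)
  qed
  also have "(\<Sum>d\<in>{1..D}. max 0 (\<phi> (a - int d))) = (\<Sum>d\<in>{1..D}. ln (real D / real d))"
  proof (rule sum.cong[OF refl])
    fix d assume d: "d \<in> {1..D}"
    then have "real D / real d \<ge> 1" by simp
    then have "ln (real D / real d) \<ge> 0" by simp
    moreover have "max (real d) 1 = real d" using d by (simp add: max_def)
    ultimately show "max 0 (\<phi> (a - int d)) = ln (real D / real d)" by (simp add: phi)
  qed
  finally have "(\<Sum>b\<in>A. \<phi> b) \<le> 3 * real D" using sum_ln_quotient_le[of D] lnD by linarith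
  also have "\<dots> = 1 / c * (c * (3 * real D))" using c by simp
  also have "\<dots> \<le> 1 / c * real (card A)" using A(2) c by (intro mult_left_mono) auto
  finally show ?thesis by (simp add: \<phi>_def)
qed

definition small_on :: "(real^'n::finite \<Rightarrow> real) \<Rightarrow> ('n \<Rightarrow> int) set \<Rightarrow> nat \<Rightarrow> real \<Rightarrow> real \<Rightarrow> bool" where
  "small_on v F D \<rho> E \<longleftrightarrow> (\<forall>f\<in>F. \<forall>q\<in>ball (cell_center D f) \<rho>. \<bar>v q\<bar> \<le> E)"

lemma cell_center_upd: "cell_center D (f(i := a)) = cell_center D f + (((of_int a + 1/2) / real D - 1/2) - cell_center D f $ i) *\<^sub>R axis i 1"
  by (auto simp: cell_center_def vec_eq_iff axis_def)

text \<open>The line through \<open>q\<close> in direction \<open>i\<close> passes the centres of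
  the cells of \<open>F\<close> in the same row with the same offset as \<open>q\<close> from its
  own centre. The extra radius \<open>2 * taylor_const / D\<close> is the room that
  \<open>line_smallness\<close> needs around each of these points when
  \<open>h = 1 / D\<close>.\<close>

lemma sweep_small:
  fixes v :: "real^'n::finite \<Rightarrow> real"
  assumes v: "harmonic_on S v" and S: "ball 0 \<rho> \<subseteq> S" and rho: "\<rho> \<ge> 21 * taylor_const TYPE('n)"
    and B: "\<And>y. y \<in> ball 0 \<rho> \<Longrightarrow> \<bar>v y\<bar> \<le> B"
    and F: "F \<subseteq> cells k D" and i: "i \<noteq> k" and D: "D > 0" and c: "c > 0" and W: "W \<ge> 0"
    and sm: "small_on v F D ((\<kappa> + 2 * taylor_const TYPE('n)) / real D) (B * exp (- W))"
    and kap: "0 \<le> \<kappa>" "\<kappa> / real D \<le> 1"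
  shows "small_on ((dder S (axis i 1) ^^ m) v) (sweep k D i c F) D (\<kappa> / real D)
     (2 * fact m * B * exp (- line_expo (1 / c) * W))"
  unfolding small_on_def
proof (intro ballI)
  let ?n = "real CARD('n)" and ?K = "taylor_const TYPE('n)"
  fix f q assume f: "f \<in> sweep k D i c F" and q: "q \<in> ball (cell_center D f) (\<kappa> / real D)"
  define A where "A = {a \<in> {- int D..<2 * int D}. f(i := a) \<in> F}"
  have fc: "f \<in> cells k D" and cA: "real (card A) \<ge> c * (3 * real D)" using f by (auto simp: sweep_def A_def)
  have finA: "finite A" by (rule finite_subset[of _ "{- int D..<2 * int D}"]) (auto simp: A_def)
  define \<tau> where "\<tau> a = (of_int a + 1/2) / real D - 1/2" for a :: int
  have inj: "inj_on \<tau> A" using D by (auto simp: inj_on_def \<tau>_def)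
  define T where "T = \<tau> ` A"
  define t where "t = cell_center D f $ i"
  \<comment> \<open>Normalizes the line so that its parameter is the \<open>i\<close>-th coordinate
    of cell centres, which puts \<open>q\<close> at parameter \<open>t\<close> and the cells of the
    row at the values of \<open>\<tau>\<close>.\<close>
  define p where "p = q - t *\<^sub>R axis i 1"
  have K: "?K \<ge> 6" "?K \<ge> 6 * ?n" by (rule taylor_const_ge)+
  have n: "?n \<ge> 1" by (rule card_ge_1)
  have ncc: "norm (cell_center D f) \<le> ?n * (3/2)" by (rule norm_le_card) (rule cell_center_bound[OF fc D])
  have t32: "\<bar>t\<bar> \<le> 3/2" unfolding t_def by (rule cell_center_bound[OF fc D])
  have "norm p \<le> ?K"
  proof -
    have "norm p \<le> norm q + \<bar>t\<bar>" unfolding p_def by (rule order_trans[OF norm_triangle_ineq4]) simp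
    moreover have "norm q \<le> norm (cell_center D f) + dist (cell_center D f) q"
      using norm_triangle_sub[of q "cell_center D f"] by (simp add: dist_norm norm_minus_commute)
    moreover have "dist (cell_center D f) q < 1" using q kap by simp
    ultimately show ?thesis using ncc t32 K n by linarith
  qed
  then have sub: "ball p (20 * ?K) \<subseteq> ball 0 \<rho>"
    using rho K by (intro ball_subset_ball_iff[THEN iffD2]) (simp add: dist_norm)
  have B0: "B \<ge> 0" using order_trans[OF abs_ge_zero B[of 0]] rho K by simp
  have fA: "f(i := a) \<in> F" if "a \<in> A" for a using that by (simp add: A_def)
  have "\<bar>(dder S (axis i 1) ^^ m) v (p + t *\<^sub>R axis i 1) / fact m\<bar> \<le> 2 * B * exp (- line_expo (1 / c) * W)"
  proof (rule line_smallness[OF v _ _ _ _ _ _ _ _ _ W])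
    show "ball p (20 * ?K) \<subseteq> S" using sub S by blast
    show "\<bar>v y\<bar> \<le> B" if "y \<in> ball p (20 * ?K)" for y using B sub that by blast
    show "\<bar>axis i (1::real) $ j\<bar> \<le> 1" for j by (simp add: axis_def)
    show "finite T" by (simp add: T_def finA)
    have "card A > 0" using cA c D by (metis mult_pos_pos of_nat_0_less_iff order_less_le_trans zero_less_numeral)
    then show "T \<noteq> {}" by (auto simp: T_def)
    show "\<bar>s\<bar> \<le> 2" if s: "s \<in> T" for s
    proof -
      obtain a where a: "a \<in> A" "s = \<tau> a" using s by (auto simp: T_def)
      have "\<bar>cell_center D (f(i := a)) $ i\<bar> \<le> 3/2" by (rule cell_center_bound) (use F fA[OF a(1)] D in auto)
      then show ?thesis by (simp add: a \<tau>_def cell_center_def)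
    qed
    show "0 < 1 / real D" "1 / real D \<le> 1" using D by auto
    show "\<bar>t\<bar> \<le> 2" using t32 by simp
    show "0 \<le> 1 / c" using c by simp
    show "\<bar>v y\<bar> \<le> B * exp (- W)" if s: "s \<in> T" and y: "y \<in> ball (p + s *\<^sub>R axis i 1) (2 * ?K * (1 / real D))" for s y
    proof -
      obtain a where a: "a \<in> A" "s = \<tau> a" using s by (auto simp: T_def)
      have "p + s *\<^sub>R axis i 1 - cell_center D (f(i := a)) = q - cell_center D f"
        unfolding cell_center_upd p_def a t_def \<tau>_def[symmetric] by (simp add: algebra_simps)
      moreover have "norm (q - cell_center D f) < \<kappa> / real D" using q by (simp add: dist_norm norm_minus_commute)
      ultimately have "dist (cell_center D (f(i := a))) (p + s *\<^sub>R axis i 1) < \<kappa> / real D"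
        by (metis dist_norm dist_commute)
      then have "dist (cell_center D (f(i := a))) y < \<kappa> / real D + 2 * ?K * (1 / real D)"
        using y dist_triangle[of "cell_center D (f(i := a))" y "p + s *\<^sub>R axis i 1"] by simp
      then have "y \<in> ball (cell_center D (f(i := a))) ((\<kappa> + 2 * ?K) / real D)" by (simp add: add_divide_distrib)
      then show ?thesis using sm fA[OF a(1)] by (auto simp: small_on_def)
    qed
    show "(\<Sum>s\<in>T. ln (1 / max \<bar>s - r\<bar> (1 / real D))) \<le> 1 / c * real (card T)" if r: "r \<in> T" for r
    proof -
      obtain a where a: "a \<in> A" "r = \<tau> a" using r by (auto simp: T_def)
      have "(\<Sum>s\<in>T. ln (1 / max \<bar>s - r\<bar> (1 / real D))) = (\<Sum>b\<in>A. ln (1 / max \<bar>\<tau> b - \<tau> a\<bar> (1 / real D)))"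
        unfolding T_def a by (simp add: sum.reindex[OF inj])
      also have "\<dots> \<le> 1 / c * real (card A)" unfolding \<tau>_def by (rule potential_dense[OF finA cA c D])
      also have "card A = card T" by (simp add: T_def card_image[OF inj])
      finally show ?thesis .
    qed
  qed
  then show "\<bar>(dder S (axis i 1) ^^ m) v q\<bar> \<le> 2 * fact m * B * exp (- line_expo (1 / c) * W)"
    by (simp add: p_def abs_divide divide_le_eq ac_simps)
qed

subsection \<open>From a positive proportion of the cells to a full neighbourhood\<close>

text \<open>The list fixes the order, head first, in which directions are swept and differentiated;
  the orders of differentiation are a separate function, so that they can vary while the list
  stays.\<close>

primrec mixed_dder :: "(real^'n::finite) set \<Rightarrow> 'n list \<Rightarrow> ('n \<Rightarrow> nat) \<Rightarrow> (real^'n \<Rightarrow> real) \<Rightarrow> real^'n \<Rightarrow> real" where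
  "mixed_dder S [] m v = v"
| "mixed_dder S (i # xs) m v = mixed_dder S xs m ((dder S (axis i 1) ^^ m i) v)"

text \<open>Each sweep keeps the rows of density \<open>c / 2\<close>, which explains the argument
  \<open>2 / c\<close>, and hands the density \<open>c / 2\<close> to the next one.\<close>

primrec sweep_expo :: "nat \<Rightarrow> real \<Rightarrow> real" where
  "sweep_expo 0 c = 1"
| "sweep_expo (Suc l) c = line_expo (2 / c) * sweep_expo l (c / 2)"

lemma sweep_expo_pos: "c > 0 \<Longrightarrow> sweep_expo l c > 0"
proof (induction l arbitrary: c)
  case (Suc l)
  have "line_expo (2 / c) > 0" using Suc.prems by (intro line_expo_pos) simp
  moreover have "sweep_expo l (c / 2) > 0" using Suc.prems by (intro Suc.IH) simp
  ultimately show ?case by simp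
qed simp

definition invariant_in :: "'n::finite set \<Rightarrow> nat \<Rightarrow> ('n \<Rightarrow> int) set \<Rightarrow> bool" where
  "invariant_in J D F \<longleftrightarrow> (\<forall>j\<in>J. \<forall>f\<in>F. \<forall>a\<in>{- int D..<2 * int D}. f(j := a) \<in> F)"

text \<open>Replacing coordinate \<open>j\<close> of a cell by any index leads to a row that meets
  \<open>F\<close> at least as often, by invariance of \<open>F\<close>; for \<open>j = i\<close> it
  is the same row. Full invariance and nonemptiness finally leave no cell out, see
  \<open>invariant_all\<close>.\<close>

lemma sweep_invariant:
  assumes J: "invariant_in J D F" and i: "i \<noteq> k" and k: "k \<notin> J"
  shows "invariant_in (insert i J) D (sweep k D i c F)"
  unfolding invariant_in_def
proof (intro ballI)
  fix j f b assume j: "j \<in> insert i J" and f: "f \<in> sweep k D i c F" and b: "b \<in> {- int D..<2 * int D}"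
  have jk: "j \<noteq> k" using j i k by auto
  have fc: "f(j := b) \<in> cells k D" using f b jk by (auto simp: sweep_def intro!: cells_upd)
  have le: "card {a \<in> {- int D..<2 * int D}. f(i := a) \<in> F} \<le> card {a \<in> {- int D..<2 * int D}. (f(j := b))(i := a) \<in> F}"
  proof (rule card_mono)
    show "finite {a \<in> {- int D..<2 * int D}. (f(j := b))(i := a) \<in> F}"
      by (rule finite_subset[of _ "{- int D..<2 * int D}"]) auto
    show "{a \<in> {- int D..<2 * int D}. f(i := a) \<in> F} \<subseteq> {a \<in> {- int D..<2 * int D}. (f(j := b))(i := a) \<in> F}"
    proof (cases "j = i")
      case True then show ?thesis by auto
    next
      case False
      then have "j \<in> J" using j by auto
      then show ?thesis using J b False by (auto simp: invariant_in_def fun_upd_twist[OF False])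
    qed
  qed
  have "c * (3 * real D) \<le> real (card {a \<in> {- int D..<2 * int D}. f(i := a) \<in> F})" using f by (auto simp: sweep_def)
  also have "\<dots> \<le> real (card {a \<in> {- int D..<2 * int D}. (f(j := b))(i := a) \<in> F})" using le by simp
  finally show "f(j := b) \<in> sweep k D i c F" using fc by (simp add: sweep_def)
qed

lemma invariant_all:
  assumes inv: "invariant_in (UNIV - {k}) D F" and F: "F \<subseteq> cells k D" "F \<noteq> {}"
  shows "F = cells k D"
proof
  show "cells k D \<subseteq> F"
  proof
    fix g assume g: "g \<in> cells k D"
    obtain f where f: "f \<in> F" using F by auto
    have "(\<lambda>i. if i \<in> A then g i else f i) \<in> F" if "A \<subseteq> UNIV - {k}" for A
      using finite[of A] that
    proof (induction A)
      case empty then show ?case using f by simp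
    next
      case (insert a A)
      have "((\<lambda>i. if i \<in> A then g i else f i)(a := g a)) \<in> F"
        using inv insert cells_range[OF g, of a] unfolding invariant_in_def by auto
      moreover have "(\<lambda>i. if i \<in> A then g i else f i)(a := g a) = (\<lambda>i. if i \<in> insert a A then g i else f i)"
        by auto
      ultimately show ?case by simp
    qed
    from this[of "UNIV - {k}"] have "(\<lambda>i. if i \<in> UNIV - {k} then g i else f i) \<in> F" by simp
    moreover have "(\<lambda>i. if i \<in> UNIV - {k} then g i else f i) = g"
      using f g F by (auto simp: cells_def fun_eq_iff)
    ultimately show "g \<in> F" by simp
  qed
qed (rule F)

text \<open>A single sweep keeps only a proportion of the cells. The final set is full because the
  invariances accumulate, one direction per sweep, while the density bound merely keeps the set
  nonempty. Per sweep the small balls lose \<open>2 * taylor_const / D\<close> and the big ball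
  loses \<open>taylor_const\<close>, the latter to bound the derivative just taken.\<close>

lemma sweeps_small:
  fixes v :: "real^'n::finite \<Rightarrow> real"
  assumes "harmonic_on S v" and "ball 0 \<rho> \<subseteq> S" and "\<rho> \<ge> (21 + real (length xs)) * taylor_const TYPE('n)"
    and "\<And>y. y \<in> ball 0 \<rho> \<Longrightarrow> \<bar>v y\<bar> \<le> B"
    and "F \<subseteq> cells k D" and "k \<notin> set xs" and D: "D > 0" and "c > 0" and "W \<ge> 0"
    and "real (card F) \<ge> c * real (card (cells k D))"
    and "small_on v F D ((\<kappa> + 2 * taylor_const TYPE('n) * real (length xs)) / real D) (B * exp (- W))"
    and kap: "0 \<le> \<kappa>" and "(\<kappa> + 2 * taylor_const TYPE('n) * real (length xs)) / real D \<le> 1"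
    and "invariant_in J D F" and "k \<notin> J" and "J \<union> set xs = UNIV - {k}"
  shows "small_on (mixed_dder S xs m v) (cells k D) D (\<kappa> / real D)
     (2 ^ length xs * prod_list (map (\<lambda>i. fact (m i)) xs) * B * exp (- sweep_expo (length xs) c * W))"
  using assms(1-6,8-11,13-16)
proof (induction xs arbitrary: v F B W c \<rho> J)
  case Nil
  have "\<exists>f. f \<in> cells k D" by (rule exI[of _ "\<lambda>i. if i = k then (int D - 1) div 2 else 0"]) (auto simp: cells_def D)
  then have "card (cells k D) > 0" using finite_cells[of k D] card_gt_0_iff by blast
  then have "real (card F) > 0" using Nil.prems(7,9) by (metis mult_pos_pos of_nat_0_less_iff order_less_le_trans)
  then have "F \<noteq> {}" by auto
  then have "F = cells k D" using invariant_all[of k D F] Nil.prems by auto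
  then show ?case using Nil.prems by simp
next
  case (Cons i js)
  let ?K = "taylor_const TYPE('n)"
  have K: "?K \<ge> 6" by (rule taylor_const_ge)
  define w :: "real^'n" where "w = axis i 1"
  define v1 where "v1 = (dder S w ^^ m i) v"
  define F1 where "F1 = sweep k D i (c / 2) F"
  define B1 where "B1 = 2 * fact (m i) * B"
  define W1 where "W1 = line_expo (2 / c) * W"
  have ik: "i \<noteq> k" using Cons.prems(6) by auto
  have rho: "\<rho> \<ge> 21 * ?K + real (length js) * ?K + ?K" using Cons.prems(3) by (simp add: algebra_simps)
  have lK: "real (length js) * ?K \<ge> 0" using K by simp
  have B0: "B \<ge> 0" using order_trans[OF abs_ge_zero Cons.prems(4)[of 0]] rho lK K by simp
  have wb: "\<bar>w $ j\<bar> \<le> 1" for j by (simp add: w_def axis_def)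
  have "small_on (mixed_dder S js m v1) (cells k D) D (\<kappa> / real D)
     (2 ^ length js * prod_list (map (\<lambda>i. fact (m i)) js) * B1 * exp (- sweep_expo (length js) (c / 2) * W1))"
  proof (rule Cons.IH[where F=F1 and \<rho>="\<rho> - ?K" and J="insert i J"])
    show "harmonic_on S v1" unfolding v1_def by (rule harmonic_dder_pow[OF Cons.prems(1)])
    have sub: "ball (0::real^'n) (\<rho> - ?K) \<subseteq> ball 0 \<rho>" using K by (intro subset_ball) simp
    then show "ball 0 (\<rho> - ?K) \<subseteq> S" using Cons.prems(2) by blast
    show "(21 + real (length js)) * ?K \<le> \<rho> - ?K" using rho by (simp add: algebra_simps)
    \<comment> \<open>Radius exactly \<open>?K\<close> makes the geometric factor of
      \<open>taylor_coeff_bound\<close> equal to one.\<close>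
    show "\<bar>v1 y\<bar> \<le> B1" if y: "y \<in> ball 0 (\<rho> - ?K)" for y
    proof -
      have "ball y ?K \<subseteq> ball 0 \<rho>" using y by (intro ball_subset_ball_iff[THEN iffD2]) (simp add: dist_norm)
      then have "\<bar>v1 y / fact (m i)\<bar> \<le> (?K / ?K) ^ m i * B"
        unfolding v1_def using Cons.prems(2,4) K by (intro taylor_coeff_bound[OF Cons.prems(1) _ _ _ wb]) auto
      then have "\<bar>v1 y\<bar> \<le> fact (m i) * B" using K by (simp add: abs_divide divide_le_eq mult.commute)
      also have "\<dots> \<le> B1" using B0 by (simp add: B1_def)
      finally show ?thesis .
    qed
    show "F1 \<subseteq> cells k D" by (auto simp: F1_def sweep_def)
    show "k \<notin> set js" using Cons.prems(6) by simp
    show "c / 2 > 0" using Cons.prems(7) by simp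
    show "0 \<le> W1" unfolding W1_def using Cons.prems(7,8) line_expo_pos[of "2 / c"] by simp
    show "c / 2 * real (card (cells k D)) \<le> real (card F1)"
      unfolding F1_def by (rule sweep_card[OF Cons.prems(5) ik D Cons.prems(9,7)])
    have e: "\<kappa> + 2 * ?K * real (length js) + 2 * ?K = \<kappa> + 2 * ?K * real (length (i # js))" by (simp add: algebra_simps)
    have k1: "(\<kappa> + 2 * ?K * real (length js)) / real D \<le> (\<kappa> + 2 * ?K * real (length (i # js))) / real D"
      using K by (intro divide_right_mono) auto
    show k2: "(\<kappa> + 2 * ?K * real (length js)) / real D \<le> 1" using order_trans[OF k1 Cons.prems(11)] .
    have "small_on ((dder S (axis i 1) ^^ m i) v) (sweep k D i (c / 2) F) D ((\<kappa> + 2 * ?K * real (length js)) / real D)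
        (2 * fact (m i) * B * exp (- line_expo (1 / (c / 2)) * W))"
    proof (rule sweep_small[OF Cons.prems(1,2) _ Cons.prems(4,5) ik D _ Cons.prems(8)])
      show "21 * ?K \<le> \<rho>" using rho lK K by linarith
      show "0 < c / 2" using Cons.prems(7) by simp
      show "small_on v F D ((\<kappa> + 2 * ?K * real (length js) + 2 * ?K) / real D) (B * exp (- W))"
        unfolding e by (rule Cons.prems(10))
      show "0 \<le> \<kappa> + 2 * ?K * real (length js)" using kap lK by (simp add: mult.assoc mult.commute)
    qed (use k2 in auto)
    then show "small_on v1 F1 D ((\<kappa> + 2 * ?K * real (length js)) / real D) (B1 * exp (- W1))"
      by (simp add: v1_def w_def F1_def B1_def W1_def)
    show "invariant_in (insert i J) D F1" unfolding F1_def by (rule sweep_invariant[OF Cons.prems(12) ik Cons.prems(13)])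
    show "k \<notin> insert i J" "insert i J \<union> set js = UNIV - {k}" using Cons.prems ik by auto
  qed
  moreover have e: "2 ^ length js * prod_list (map (\<lambda>i. fact (m i)) js) * B1 * exp (- sweep_expo (length js) (c / 2) * W1)
    = 2 ^ length (i # js) * prod_list (map (\<lambda>i. fact (m i)) (i # js)) * B * exp (- sweep_expo (length (i # js)) c * W)"
  proof -
    have "sweep_expo (length js) (c / 2) * W1 = sweep_expo (length (i # js)) c * W" by (simp add: W1_def ac_simps)
    then show ?thesis by (simp only: minus_mult_left[symmetric] B1_def) simp
  qed
  ultimately show ?case unfolding e v1_def w_def mixed_dder.simps by (simp only:)
qed

section \<open>Tangential and normal derivatives at points of the hyperplane\<close>

lemma dder_linear:
  assumes I: "finite I" and f: "\<And>i. i \<in> I \<Longrightarrow> harmonic_on S (f i)"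
  shows "dder S w (\<lambda>x. \<Sum>i\<in>I. c i * f i x) = (\<lambda>x. \<Sum>i\<in>I. c i * dder S w (f i) x)"
proof
  fix x
  show "dder S w (\<lambda>x. \<Sum>i\<in>I. c i * f i x) x = (\<Sum>i\<in>I. c i * dder S w (f i) x)"
  proof (cases "x \<in> S")
    case True
    have "((\<lambda>x. \<Sum>i\<in>I. c i * f i x) has_derivative (\<lambda>a. \<Sum>i\<in>I. c i * (\<Sum>j\<in>UNIV. a $ j * partial_deriv j (f i) x))) (at x)"
      by (intro has_derivative_sum has_derivative_mult_right harmonic_has_derivative[OF f True])
    moreover have "(\<Sum>i\<in>I. c i * (\<Sum>j\<in>UNIV. a $ j * partial_deriv j (f i) x)) =
        (\<Sum>j\<in>UNIV. a $ j * (\<Sum>i\<in>I. c i * partial_deriv j (f i) x))" for a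
      unfolding sum_distrib_left by (subst sum.swap) (simp add: ac_simps)
    ultimately have "partial_deriv j (\<lambda>x. \<Sum>i\<in>I. c i * f i x) x = (\<Sum>i\<in>I. c i * partial_deriv j (f i) x)" for j
      by (intro partial_deriv_eqI) simp
    then show ?thesis using True unfolding dder_def sum_distrib_left by (simp add: sum_distrib_left) (subst sum.swap, simp add: ac_simps)
  qed (simp add: dder_def)
qed

lemma dder_pow_linear:
  assumes I: "finite I" and f: "\<And>i. i \<in> I \<Longrightarrow> harmonic_on S (f i)"
  shows "(dder S w ^^ l) (\<lambda>x. \<Sum>i\<in>I. c i * f i x) = (\<lambda>x. \<Sum>i\<in>I. c i * (dder S w ^^ l) (f i) x)"
proof (induction l)
  case (Suc l)
  then show ?case using dder_linear[OF I harmonic_dder_pow[OF f], where w=w] by simp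
qed simp

lemma mixed_dder_linear:
  assumes I: "finite I" and f: "\<And>i. i \<in> I \<Longrightarrow> harmonic_on S (f i)"
  shows "mixed_dder S xs m (\<lambda>x. \<Sum>i\<in>I. c i * f i x) = (\<lambda>x. \<Sum>i\<in>I. c i * mixed_dder S xs m (f i) x)"
  using f
proof (induction xs arbitrary: f)
  case (Cons j js)
  have "(dder S (axis j 1) ^^ m j) (\<lambda>x. \<Sum>i\<in>I. c i * f i x) = (\<lambda>x. \<Sum>i\<in>I. c i * (dder S (axis j 1) ^^ m j) (f i) x)"
    by (rule dder_pow_linear[OF I Cons.prems])
  then show ?case
    using Cons.IH[of "\<lambda>i. (dder S (axis j 1) ^^ m j) (f i)", OF harmonic_dder_pow[OF Cons.prems]] by (simp only: mixed_dder.simps)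
qed simp

lemma dder_pow_commute:
  assumes v: "harmonic_on S v"
  shows "(dder S a ^^ l) (dder S b v) = dder S b ((dder S a ^^ l) v)"
proof (induction l)
  case (Suc l)
  then show ?case using dder_commute[OF harmonic_dder_pow[OF v]] by simp
qed simp

lemma mixed_dder_cong: "(\<And>i. i \<in> set xs \<Longrightarrow> m i = m' i) \<Longrightarrow> mixed_dder S xs m v = mixed_dder S xs m' v"
  by (induction xs arbitrary: v) auto

lemma mixed_dder_step:
  assumes "harmonic_on S v" "distinct xs" "i \<in> set xs"
  shows "mixed_dder S xs m (dder S (axis i 1) v) = mixed_dder S xs (m(i := Suc (m i))) v"
  using assms
proof (induction xs arbitrary: v)
  case (Cons j js)
  show ?case
  proof (cases "j = i")
    case True
    have "mixed_dder S (j # js) m (dder S (axis i 1) v) = mixed_dder S js m ((dder S (axis i 1) ^^ Suc (m i)) v)"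
      using True by (simp add: funpow_swap1)
    also have "\<dots> = mixed_dder S js (m(i := Suc (m i))) ((dder S (axis i 1) ^^ Suc (m i)) v)"
      using Cons.prems True by (intro mixed_dder_cong) auto
    also have "\<dots> = mixed_dder S (j # js) (m(i := Suc (m i))) v" by (simp only: mixed_dder.simps True fun_upd_same)
    finally show ?thesis .
  next
    case False
    then have "i \<in> set js" using Cons.prems by auto
    then show ?thesis using False Cons.prems
      by (simp add: dder_pow_commute[OF Cons.prems(1)] Cons.IH[OF harmonic_dder_pow[OF Cons.prems(1)]])
  qed
qed simp

lemma mixed_dder_zero: "mixed_dder S xs (\<lambda>_. 0) v = v"
  by (induction xs) auto

lemma dder_axis: "x \<in> S \<Longrightarrow> dder S (axis i 1) v x = partial_deriv i v x"
  by (simp add: dder_def sum_axis)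

lemma dder_axis2:
  assumes "harmonic_on S v" "x \<in> S"
  shows "dder S (axis i 1) (dder S (axis j 1) v) x = partial_deriv i (partial_deriv j v) x"
  unfolding dder_axis[OF assms(2)] partial_dder[OF assms] by (rule sum_axis)

lemma normal_second:
  fixes v :: "real^'n::finite \<Rightarrow> real"
  assumes "harmonic_on S v"
  shows "dder S (axis k 1) (dder S (axis k 1) v) =
    (\<lambda>x. \<Sum>i\<in>UNIV - {k}. (- 1) * dder S (axis i 1) (dder S (axis i 1) v) x)"
proof
  fix x
  show "dder S (axis k 1) (dder S (axis k 1) v) x = (\<Sum>i\<in>UNIV - {k}. (- 1) * dder S (axis i 1) (dder S (axis i 1) v) x)"
  proof (cases "x \<in> S")
    case True
    have "(\<Sum>i\<in>UNIV. partial_deriv i (partial_deriv i v) x) = partial_deriv k (partial_deriv k v) x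
       + (\<Sum>i\<in>UNIV - {k}. partial_deriv i (partial_deriv i v) x)" by (rule sum.remove) auto
    then show ?thesis using harmonic_trace[OF assms True]
      by (simp add: dder_axis2[OF assms True] sum_negf)
  qed (simp add: dder_def)
qed

text \<open>Two normal derivatives are traded for at most n pure second tangential derivatives. Each
  trade multiplies the bound by n and raises the total order by two, which the factorial
  records.\<close>

lemma normal_even_bound:
  fixes v :: "real^'n::finite \<Rightarrow> real"
  assumes v: "harmonic_on S v" and xs: "distinct xs" "set xs = UNIV - {k}"
    and b: "\<And>m. \<bar>mixed_dder S xs m v x\<bar> \<le> E * fact (sum_list (map m xs))" and E: "E \<ge> 0"
  shows "\<bar>mixed_dder S xs m ((dder S (axis k 1) ^^ (2 * j)) v) x\<bar> \<le> E * real CARD('n) ^ j * fact (sum_list (map m xs) + 2 * j)"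
proof (induction j arbitrary: m)
  case 0 then show ?case using b by simp
next
  case (Suc j)
  define g where "g = (dder S (axis k 1) ^^ (2 * j)) v"
  have g: "harmonic_on S g" unfolding g_def by (rule harmonic_dder_pow[OF v])
  have sl: "sum_list (map (m(i := Suc (Suc (m i)))) xs) = sum_list (map m xs) + 2" if "i \<in> UNIV - {k}" for i
  proof -
    have "(\<Sum>l\<in>UNIV - {k}. (m(i := Suc (Suc (m i)))) l) = (\<Sum>l\<in>UNIV - {k}. m l + (if l = i then 2 else 0))"
      by (intro sum.cong) auto
    also have "\<dots> = (\<Sum>l\<in>UNIV - {k}. m l) + 2" using that by (simp add: sum.distrib)
    finally show ?thesis using xs by (simp add: sum_list_distinct_conv_sum_set)
  qed
  have "mixed_dder S xs m ((dder S (axis k 1) ^^ (2 * Suc j)) v) x = mixed_dder S xs m (dder S (axis k 1) (dder S (axis k 1) g)) x"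
    by (simp add: g_def)
  also have "\<dots> = (\<Sum>i\<in>UNIV - {k}. (- 1) * mixed_dder S xs m (dder S (axis i 1) (dder S (axis i 1) g)) x)"
    by (subst normal_second[OF g, of k], subst mixed_dder_linear) (auto intro: harmonic_dder g)
  also have "\<dots> = (\<Sum>i\<in>UNIV - {k}. (- 1) * mixed_dder S xs (m(i := Suc (Suc (m i)))) g x)"
  proof (rule sum.cong[OF refl])
    fix i assume "i \<in> UNIV - {k}"
    then have i: "i \<in> set xs" using xs by simp
    show "(- 1) * mixed_dder S xs m (dder S (axis i 1) (dder S (axis i 1) g)) x = (- 1) * mixed_dder S xs (m(i := Suc (Suc (m i)))) g x"
      using mixed_dder_step[OF harmonic_dder[OF g] xs(1) i, of m] mixed_dder_step[OF g xs(1) i, of "m(i := Suc (m i))"] by simp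
  qed
  finally have "\<bar>mixed_dder S xs m ((dder S (axis k 1) ^^ (2 * Suc j)) v) x\<bar> \<le> (\<Sum>i\<in>UNIV - {k}. \<bar>mixed_dder S xs (m(i := Suc (Suc (m i)))) g x\<bar>)"
    using sum_abs[of "\<lambda>i. (- 1) * mixed_dder S xs (m(i := Suc (Suc (m i)))) g x" "UNIV - {k}"] by simp
  also have "\<dots> \<le> (\<Sum>i\<in>UNIV - {k}. E * real CARD('n) ^ j * fact (sum_list (map m xs) + 2 * Suc j))"
  proof (rule sum_mono)
    fix i assume i: "i \<in> UNIV - {k}"
    show "\<bar>mixed_dder S xs (m(i := Suc (Suc (m i)))) g x\<bar> \<le> E * real CARD('n) ^ j * fact (sum_list (map m xs) + 2 * Suc j)"
      using Suc.IH[of "m(i := Suc (Suc (m i)))"] unfolding g_def sl[OF i] by (simp only: mult_Suc_right add.assoc)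
  qed
  also have "\<dots> \<le> real CARD('n) * (E * real CARD('n) ^ j * fact (sum_list (map m xs) + 2 * Suc j))"
  proof -
    have "real (card (UNIV - {k} :: 'n set)) \<le> real CARD('n)" by (intro of_nat_mono card_mono) auto
    then show ?thesis using E unfolding sum_constant by (intro mult_right_mono) auto
  qed
  finally show ?case by (simp add: ac_simps)
qed

text \<open>Even orders reduce to tangential ones for every component. At odd orders one normal
  derivative is left over, and the structure of the gradient removes it: the normal derivative of
  component \<open>l\<close> is a tangential derivative of component \<open>k\<close> if
  \<open>l\<close> differs from \<open>k\<close>, and minus the tangential divergence if
  \<open>l = k\<close>.\<close>

lemma normal_bound:
  fixes U :: "real^'n::finite \<Rightarrow> real"
  assumes U: "harmonic_on S U" and xs: "distinct xs" "set xs = UNIV - {k}"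
    and b: "\<And>l m. \<bar>mixed_dder S xs m (partial_deriv l U) x\<bar> \<le> E * fact (sum_list (map m xs))" and E: "E \<ge> 0"
  shows "\<bar>(dder S (axis k 1) ^^ j) (partial_deriv l U) x\<bar> \<le> E * real CARD('n) ^ Suc j * fact j"
proof -
  let ?n = "real CARD('n)"
  let ?N = "dder S (axis k 1)"
  define V where "V l = partial_deriv l U" for l
  have V: "harmonic_on S (V l)" for l unfolding V_def by (rule harmonic_partial(1)[OF U])
  have n: "?n \<ge> 1" by (rule card_ge_1)
  note ev = normal_even_bound[OF V xs b[folded V_def] E]
  have z: "sum_list (map (\<lambda>_. 0) xs) = (0::nat)" by (induction xs) auto
  have tang: "\<bar>(?N ^^ (2 * i)) (dder S (axis a 1) (V e)) x\<bar> \<le> E * ?n ^ i * fact (Suc (2 * i))" if a: "a \<noteq> k" for a e i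
  proof -
    have ai: "a \<in> set xs" using a xs by simp
    have "(?N ^^ (2 * i)) (dder S (axis a 1) (V e)) = dder S (axis a 1) ((?N ^^ (2 * i)) (V e))"
      by (rule dder_pow_commute[OF V])
    also have "\<dots> = mixed_dder S xs (\<lambda>_. 0) (dder S (axis a 1) ((?N ^^ (2 * i)) (V e)))" by (simp add: mixed_dder_zero)
    also have "\<dots> = mixed_dder S xs ((\<lambda>_. 0)(a := Suc 0)) ((?N ^^ (2 * i)) (V e))"
      by (rule mixed_dder_step[OF harmonic_dder_pow[OF V] xs(1) ai])
    finally have e: "(?N ^^ (2 * i)) (dder S (axis a 1) (V e)) x = mixed_dder S xs ((\<lambda>_. 0)(a := Suc 0)) ((?N ^^ (2 * i)) (V e)) x" by simp
    have "sum_list (map ((\<lambda>_. 0)(a := Suc 0)) xs) = (\<Sum>l\<in>UNIV - {k}. if l = a then Suc 0 else 0)"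
      using xs by (simp add: sum_list_distinct_conv_sum_set fun_upd_def)
    also have "\<dots> = 1" using a by simp
    finally show ?thesis unfolding e using ev[of "(\<lambda>_. 0)(a := Suc 0)" i e] by simp
  qed
  have mono: "E * ?n ^ a * fact j \<le> E * ?n ^ Suc j * fact j" if "a \<le> Suc j" for a
    using that E n by (intro mult_right_mono mult_left_mono power_increasing) auto
  show ?thesis
  proof (cases "even j")
    case True
    then obtain i where i: "j = 2 * i" by (auto elim: evenE)
    have "\<bar>(?N ^^ j) (V l) x\<bar> \<le> E * ?n ^ i * fact j"
      using ev[of "\<lambda>_. 0" i l] by (simp add: mixed_dder_zero i z)
    also have "\<dots> \<le> E * ?n ^ Suc j * fact j" by (rule mono) (simp add: i)
    finally show ?thesis by (simp add: V_def)
  next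
    case False
    then obtain i where i: "j = Suc (2 * i)" by (metis oddE Suc_eq_plus1)
    have st: "(?N ^^ j) (V l) = (?N ^^ (2 * i)) (?N (V l))" by (simp add: i funpow_swap1)
    show ?thesis
    proof (cases "l = k")
      case False
      have "?N (V l) = dder S (axis l 1) (V k)"
        by (rule ext) (auto simp: dder_def sum_axis V_def harmonic_partial(2)[OF U])
      then have "\<bar>(?N ^^ j) (V l) x\<bar> \<le> E * ?n ^ i * fact (Suc (2 * i))" using tang[OF False, of i k] unfolding st by (simp only:)
      then have "\<bar>(?N ^^ j) (V l) x\<bar> \<le> E * ?n ^ i * fact j" by (simp only: i)
      also have "\<dots> \<le> E * ?n ^ Suc j * fact j" by (rule mono) (simp add: i)
      finally show ?thesis by (simp add: V_def)
    next
      case True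
      have "?N (V k) = (\<lambda>x. \<Sum>a\<in>UNIV - {k}. (- 1) * dder S (axis a 1) (V a) x)"
      proof
        fix x
        show "?N (V k) x = (\<Sum>a\<in>UNIV - {k}. (- 1) * dder S (axis a 1) (V a) x)"
        proof (cases "x \<in> S")
          case True
          have "(\<Sum>i\<in>UNIV. partial_deriv i (V i) x) = partial_deriv k (V k) x + (\<Sum>i\<in>UNIV - {k}. partial_deriv i (V i) x)"
            by (rule sum.remove) auto
          then show ?thesis using harmonic_trace[OF U True] by (simp add: dder_axis[OF True] sum_negf V_def)
        qed (simp add: dder_def)
      qed
      then have "(?N ^^ (2 * i)) (?N (V k)) = (\<lambda>x. \<Sum>a\<in>UNIV - {k}. (- 1) * (?N ^^ (2 * i)) (dder S (axis a 1) (V a)) x)"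
        by (simp only:) (subst dder_pow_linear, auto intro: harmonic_dder V)
      moreover have "(?N ^^ j) (V l) = (?N ^^ (2 * i)) (?N (V k))" using st unfolding True .
      ultimately have "(?N ^^ j) (V l) x = (\<Sum>a\<in>UNIV - {k}. (- 1) * (?N ^^ (2 * i)) (dder S (axis a 1) (V a)) x)"
        by (simp only:)
      then have "\<bar>(?N ^^ j) (V l) x\<bar> \<le> (\<Sum>a\<in>UNIV - {k}. \<bar>(?N ^^ (2 * i)) (dder S (axis a 1) (V a)) x\<bar>)"
        using sum_abs[of "\<lambda>a. (- 1) * (?N ^^ (2 * i)) (dder S (axis a 1) (V a)) x" "UNIV - {k}"] by simp
      also have "\<dots> \<le> (\<Sum>a\<in>UNIV - {k}. E * ?n ^ i * fact j)"
        by (intro sum_mono) (use tang in \<open>auto simp: i\<close>)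
      also have "\<dots> \<le> ?n * (E * ?n ^ i * fact j)"
      proof -
        have "real (card (UNIV - {k} :: 'n set)) \<le> real CARD('n)" by (intro of_nat_mono card_mono) auto
        then show ?thesis using E unfolding sum_constant by (intro mult_right_mono) auto
      qed
      also have "\<dots> = E * ?n ^ Suc i * fact j" by simp
      also have "\<dots> \<le> E * ?n ^ Suc j * fact j" by (rule mono) (simp add: i)
      finally show ?thesis by (simp add: V_def)
    qed
  qed
qed

lemma prod_fact_le: "prod_list (map (\<lambda>i. fact (m i)) xs) \<le> (fact (sum_list (map m xs)) :: real)"
proof (induction xs)
  case (Cons i js)
  have "fact (m i) * prod_list (map (\<lambda>i. fact (m i)) js) \<le> (fact (m i) * fact (sum_list (map m js)) :: real)"
    using Cons by (intro mult_left_mono) auto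
  also have "\<dots> \<le> fact (m i + sum_list (map m js))"
    using fact_fact_dvd_fact[of "m i" "sum_list (map m js)"]
    by (metis dvd_imp_le fact_gt_zero of_nat_fact of_nat_le_iff of_nat_mult)
  finally show ?case by simp
qed simp

lemma cover_cells:
  fixes x :: "real^'n::finite"
  assumes x: "\<And>i. \<bar>x $ i\<bar> \<le> 1/2" "x $ k = 0" and D: "D > 0" "odd D"
  shows "\<exists>f\<in>cells k D. x \<in> ball (cell_center D f) ((real CARD('n) + 1) / real D)"
proof -
  define f where "f i = (if i = k then (int D - 1) div 2 else \<lfloor>(x $ i + 1/2) * real D\<rfloor>)" for i
  have close: "\<bar>(x - cell_center D f) $ i\<bar> \<le> 1 / real D" for i
  proof (cases "i = k")
    case True
    obtain e where e: "D = 2 * e + 1" using D by (auto elim: oddE)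
    have "f k = int e" by (simp add: f_def e)
    then have "cell_center D f $ k = (real e + 1/2) / (2 * real e + 1) - 1/2" by (simp add: cell_center_def e)
    also have "\<dots> = 0" by (simp add: field_simps)
    finally show ?thesis using True x(2) by simp
  next
    case False
    define y where "y = (x $ i + 1/2) * real D"
    have "x $ i = y / real D - 1/2" using D by (simp add: y_def)
    then have "(x - cell_center D f) $ i = (y - of_int \<lfloor>y\<rfloor> - 1/2) / real D"
      using False by (simp add: cell_center_def f_def y_def[symmetric] diff_divide_distrib add_divide_distrib)
    moreover have "\<bar>y - of_int \<lfloor>y\<rfloor> - 1/2\<bar> \<le> 1" by linarith
    ultimately show ?thesis using D by (simp add: abs_divide divide_right_mono)
  qed
  have "norm (x - cell_center D f) \<le> real CARD('n) * (1 / real D)" by (rule norm_le_card) (rule close)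
  also have "\<dots> < (real CARD('n) + 1) / real D" using D by (simp add: divide_strict_right_mono)
  finally have "x \<in> ball (cell_center D f) ((real CARD('n) + 1) / real D)" by (simp add: dist_norm norm_minus_commute)
  moreover have "f \<in> cells k D"
    unfolding cells_def
  proof (intro CollectI conjI allI impI)
    fix i assume "i \<noteq> k"
    have "0 \<le> x $ i + 1/2" "x $ i + 1/2 \<le> 1" using x(1)[of i] by (simp_all add: abs_le_iff)
    then have "0 \<le> (x $ i + 1/2) * real D" "(x $ i + 1/2) * real D \<le> 1 * real D"
      using D by (auto intro: mult_right_mono simp del: mult_1)
    \<comment> \<open>At the face \<open>x $ i = 1/2\<close> the floor equals \<open>D\<close>, one
      step beyond the unit cube but within the range of \<open>cells\<close>.\<close>
    then have "0 \<le> \<lfloor>(x $ i + 1/2) * real D\<rfloor>" "\<lfloor>(x $ i + 1/2) * real D\<rfloor> \<le> int D"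
      by (simp_all add: floor_le_iff)
    then have "- int D \<le> \<lfloor>(x $ i + 1/2) * real D\<rfloor>" "\<lfloor>(x $ i + 1/2) * real D\<rfloor> < 2 * int D" using D by linarith+
    then show "f i \<in> {- int D..<2 * int D}" using \<open>i \<noteq> k\<close> by (simp add: f_def)
  qed (simp add: f_def)
  ultimately show ?thesis by blast
qed

text \<open>A point \<open>y\<close> is reached from its foot on the hyperplane by a Taylor series
  in the normal direction. Its coefficients grow like n^j by \<open>normal_bound\<close>, so a
  height below 1 / (2 n) gives a geometric series of ratio 1/2.\<close>

lemma hyperplane_propagation:
  fixes U :: "real^'n::finite \<Rightarrow> real"
  assumes U: "harmonic_on S U" and S: "ball 0 \<rho> \<subseteq> S" and rho: "\<rho> \<ge> (21 + real CARD('n)) * taylor_const TYPE('n)"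
    and B: "\<And>y. y \<in> ball 0 \<rho> \<Longrightarrow> norm (gradient U y) \<le> B"
    and F: "F \<subseteq> cells k D" and c: "real (card F) \<ge> c * real (card (cells k D))" "c > 0"
    and D: "odd D" and W: "W \<ge> 0"
    and sm: "\<And>f q. f \<in> F \<Longrightarrow> q \<in> ball (cell_center D f) ((real CARD('n) + 1 + 2 * taylor_const TYPE('n) * real CARD('n)) / real D) \<Longrightarrow>
        norm (gradient U q) \<le> B * exp (- W)"
    and DK: "(real CARD('n) + 1 + 2 * taylor_const TYPE('n) * real CARD('n)) / real D \<le> 1"
    and y: "y \<in> ball 0 (1 / (2 * real CARD('n)))"
  shows "norm (gradient U y) \<le> 2 * real CARD('n) ^ 2 * 2 ^ CARD('n) * B * exp (- sweep_expo (CARD('n) - 1) c * W)"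
proof -
  let ?n = "real CARD('n)" and ?K = "taylor_const TYPE('n)"
  have K: "?K \<ge> 6" "?K \<ge> 6 * ?n" by (rule taylor_const_ge)+
  have n: "?n \<ge> 1" by (rule card_ge_1)
  have D0: "D > 0" using D by (cases D) auto
  obtain xs where xs: "distinct xs" "set xs = UNIV - {k}"
    using finite_distinct_list[of "UNIV - {k}"] by auto
  have len: "length xs = CARD('n) - 1" using xs distinct_card[of xs] by (simp add: card_Diff_singleton)
  have rhoK: "\<rho> \<ge> 21 * ?K + ?n * ?K" using rho by (simp add: algebra_simps)
  have nK: "?n * ?K \<ge> 0" using K n by simp
  have B0: "B \<ge> 0" using order_trans[OF norm_ge_zero B[of 0]] rhoK nK K by simp
  define V where "V l = partial_deriv l U" for l
  have V: "harmonic_on S (V l)" for l unfolding V_def by (rule harmonic_partial(1)[OF U])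
  have VB: "\<bar>V l z\<bar> \<le> B" if "z \<in> ball 0 \<rho>" for l z
    using order_trans[OF partial_le_gradient B[OF that]] by (simp add: V_def)
  define E where "E = 2 ^ CARD('n) * B * exp (- sweep_expo (CARD('n) - 1) c * W)"
  have E0: "E \<ge> 0" using B0 by (simp add: E_def)
  have lenle: "?n + 1 + 2 * ?K * real (length xs) \<le> ?n + 1 + 2 * ?K * ?n" using K by (simp add: len)
  have all: "small_on (mixed_dder S xs m (V l)) (cells k D) D ((?n + 1) / real D)
     (2 ^ length xs * prod_list (map (\<lambda>i. fact (m i)) xs) * B * exp (- sweep_expo (length xs) c * W))" for m l
  proof (rule sweeps_small[OF V S _ VB F _ D0 c(2) W c(1), where J="{}"])
    show "(21 + real (length xs)) * ?K \<le> \<rho>"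
    proof -
      have "(21 + real (length xs)) * ?K \<le> (21 + ?n) * ?K" using K by (intro mult_right_mono) (auto simp: len)
      then show ?thesis using rho by simp
    qed
    show "k \<notin> set xs" "{} \<union> set xs = UNIV - {k}" using xs by auto
    show "small_on (V l) F D ((?n + 1 + 2 * ?K * real (length xs)) / real D) (B * exp (- W))"
      unfolding small_on_def
    proof (intro ballI)
      fix f q assume f: "f \<in> F" and q: "q \<in> ball (cell_center D f) ((?n + 1 + 2 * ?K * real (length xs)) / real D)"
      have "(?n + 1 + 2 * ?K * real (length xs)) / real D \<le> (?n + 1 + 2 * ?K * ?n) / real D"
        using lenle by (intro divide_right_mono) auto
      then have "q \<in> ball (cell_center D f) ((?n + 1 + 2 * ?K * ?n) / real D)" using q by auto
      then show "\<bar>V l q\<bar> \<le> B * exp (- W)" using order_trans[OF partial_le_gradient sm[OF f]] by (simp add: V_def)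
    qed
    show "(?n + 1 + 2 * ?K * real (length xs)) / real D \<le> 1"
      using DK divide_right_mono[OF lenle, of "real D"] by linarith
  qed (auto simp: invariant_in_def)
  define x where "x = y - (y $ k) *\<^sub>R axis k 1"
  have yn: "norm y < 1 / (2 * ?n)" using y by simp
  have yi: "\<bar>y $ i\<bar> < 1 / (2 * ?n)" for i using component_le_norm_cart[of y i] yn by linarith
  have n2: "1 / (2 * ?n) \<le> 1/2" using n by (simp add: field_simps)
  have xk: "x $ k = 0" by (simp add: x_def)
  have xi: "\<bar>x $ i\<bar> \<le> 1/2" for i
  proof -
    have "\<bar>y $ i\<bar> \<le> 1/2" using yi[of i] n2 by linarith
    then show ?thesis by (cases "i = k") (auto simp: x_def axis_def)
  qed
  obtain f where f: "f \<in> cells k D" "x \<in> ball (cell_center D f) ((?n + 1) / real D)"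
    using cover_cells[OF xi xk D0 D] by blast
  have b: "\<bar>mixed_dder S xs m (partial_deriv l U) x\<bar> \<le> E * fact (sum_list (map m xs))" for l m
  proof -
    have "\<bar>mixed_dder S xs m (V l) x\<bar> \<le> 2 ^ length xs * prod_list (map (\<lambda>i. fact (m i)) xs) * B * exp (- sweep_expo (length xs) c * W)"
      using all[of m l] f by (auto simp: small_on_def)
    also have "\<dots> \<le> 2 ^ CARD('n) * fact (sum_list (map m xs)) * B * exp (- sweep_expo (length xs) c * W)"
      using B0 by (intro mult_right_mono mult_mono prod_fact_le power_increasing) (auto simp: len intro!: prod_list_nonneg)
    finally show ?thesis by (simp add: E_def len V_def ac_simps)
  qed
  have Vy: "\<bar>V l y\<bar> \<le> 2 * (?n * E)" for l
  proof -
    have xn: "norm x \<le> ?n * (1/2)" by (rule norm_le_card) (rule xi)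
    have sub: "ball x (3 * ?K) \<subseteq> ball 0 \<rho>"
    proof -
      have "norm x \<le> ?K" using xn K n by linarith
      then have "norm x + 3 * ?K \<le> \<rho>" using rhoK nK K by linarith
      then show ?thesis by (intro ball_subset_ball_iff[THEN iffD2]) (simp add: dist_norm)
    qed
    have "(\<lambda>j. (dder S (axis k 1) ^^ j) (V l) x / fact j * (y $ k) ^ j) sums V l (x + (y $ k) *\<^sub>R axis k 1)"
    proof (rule taylor_sums[OF V, where r="3 * ?K" and M=B])
      have "\<bar>y $ k\<bar> \<le> 1/2" using yi[of k] n2 by linarith
      then show "\<bar>y $ k\<bar> < 3 * ?K / (2 * ?K)" using K by simp
    qed (use sub S VB K in \<open>auto simp: axis_def\<close>)
    then have s: "(\<lambda>j. (dder S (axis k 1) ^^ j) (V l) x / fact j * (y $ k) ^ j) sums V l y" by (simp add: x_def)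
    show ?thesis
    proof (rule half_power_sum_bound[OF s])
      fix j
      have "\<bar>(dder S (axis k 1) ^^ j) (V l) x\<bar> / fact j \<le> E * ?n ^ Suc j"
        using normal_bound[OF U xs b E0, of j l] by (simp add: V_def divide_le_eq)
      then have "\<bar>(dder S (axis k 1) ^^ j) (V l) x / fact j * (y $ k) ^ j\<bar> \<le> E * ?n ^ Suc j * (1 / (2 * ?n)) ^ j"
        unfolding abs_mult power_abs using yi[of k] E0 n by (intro mult_mono power_mono) (auto simp: abs_divide)
      also have "\<dots> = (1/2) ^ j * (?n * E)" using n by (simp add: power_divide power_mult_distrib)
      finally show "\<bar>(dder S (axis k 1) ^^ j) (V l) x / fact j * (y $ k) ^ j\<bar> \<le> (1/2) ^ j * (?n * E)" .
    qed
  qed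
  have "norm (gradient U y) \<le> (\<Sum>l\<in>(UNIV::'n set). 2 * (?n * E))"
    by (rule order_trans[OF gradient_le_sum_partial sum_mono]) (use Vy in \<open>simp add: V_def\<close>)
  also have "\<dots> = 2 * ?n ^ 2 * 2 ^ CARD('n) * B * exp (- sweep_expo (CARD('n) - 1) c * W)"
    by (simp add: E_def power2_eq_square ac_simps)
  finally show ?thesis .
qed

subsection \<open>Selecting tubes on which the bad cells are spread out\<close>

text \<open>As \<open>P\<close> is at least one, a class of size m has energy at least m^2; a
  bounded mean energy therefore forces \<open>E\<close> to spread over many classes. Shrinking a
  class then turns its energy bound into a bound at every point, the form in which
  \<open>two_constants\<close> uses it.\<close>

lemma class_selection:
  fixes key :: "'a \<Rightarrow> 'b" and P :: "'a \<Rightarrow> 'a \<Rightarrow> real"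
  assumes E: "finite E" "E \<noteq> {}" and P: "\<And>e e'. e \<in> E \<Longrightarrow> e' \<in> E \<Longrightarrow> P e e' \<ge> 1"
    and M: "real (card (key ` E)) \<le> M" and C: "C > 0"
    and tot: "(\<Sum>e\<in>E. \<Sum>e'\<in>{e'\<in>E. key e' = key e}. P e e') \<le> C * real (card E) ^ 2 / M"
  shows "\<exists>Y \<subseteq> key ` E. real (card Y) \<ge> M / (16 * C) \<and>
     (\<forall>y\<in>Y. \<exists>E'. E' \<subseteq> {e\<in>E. key e = y} \<and> E' \<noteq> {} \<and> (\<forall>e\<in>E'. (\<Sum>e'\<in>E'. P e e') \<le> 32 * C * real (card E')))"
proof -
  define cl where "cl y = {e\<in>E. key e = y}" for y
  define n where "n y = real (card (cl y))" for y
  define pot where "pot e = (\<Sum>e'\<in>cl (key e). P e e')" for e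
  define en where "en y = (\<Sum>e\<in>cl y. pot e)" for y
  have fcl: "finite (cl y)" for y using E by (simp add: cl_def)
  have clE: "cl y \<subseteq> E" for y by (auto simp: cl_def)
  define K where "K = key ` E"
  have K: "finite K" "K \<noteq> {}" using E by (auto simp: K_def)
  have M0: "M > 0"
  proof -
    have "card K > 0" using K by (simp add: card_gt_0_iff)
    then show ?thesis using M unfolding K_def by linarith
  qed
  define cE where "cE = real (card E)"
  have cE: "cE > 0" using E by (simp add: cE_def card_gt_0_iff)
  define a where "a = cE / M"
  have a: "a > 0" using cE M0 by (simp add: a_def)
  have pot1: "pot e \<ge> n (key e)" if "e \<in> E" for e
  proof -
    have "(\<Sum>e'\<in>cl (key e). 1) \<le> pot e" unfolding pot_def using P[OF that] clE by (intro sum_mono) blast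
    then show ?thesis by (simp add: n_def)
  qed
  have pot0: "pot e \<ge> 0" if "e \<in> E" for e using order_trans[OF _ pot1[OF that], of 0] by (simp add: n_def)
  have sumn: "(\<Sum>y\<in>K. n y) = cE"
  proof -
    have "(\<Sum>y\<in>K. \<Sum>e\<in>cl y. (1::real)) = (\<Sum>e\<in>E. 1)"
      unfolding cl_def by (rule sum.group) (use E K in \<open>auto simp: K_def\<close>)
    then show ?thesis by (simp add: n_def cE_def)
  qed
  have sume: "(\<Sum>y\<in>K. en y) \<le> C * cE * a"
  proof -
    have "(\<Sum>y\<in>K. en y) = (\<Sum>e\<in>E. pot e)"
      unfolding en_def cl_def by (rule sum.group) (use E K in \<open>auto simp: K_def\<close>)
    also have "\<dots> \<le> C * cE ^ 2 / M" using tot by (simp add: pot_def cl_def cE_def)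
    finally show ?thesis by (simp add: a_def power2_eq_square)
  qed
  have en0: "en y \<ge> 0" for y unfolding en_def using clE pot0 by (intro sum_nonneg) blast
  have en2: "en y \<ge> n y * n y" for y
  proof -
    have "(\<Sum>e\<in>cl y. n y) \<le> en y" unfolding en_def
    proof (rule sum_mono)
      fix e assume "e \<in> cl y"
      then show "n y \<le> pot e" using pot1[of e] by (auto simp: cl_def)
    qed
    then show ?thesis by (simp add: n_def)
  qed
  \<comment> \<open>Classes smaller than half the reference size \<open>a\<close> hold at most half
    of \<open>E\<close>, those with energy above \<open>4 * C * a\<close> per element at most a
    quarter. A quarter of \<open>E\<close> remains, in classes of size at most
    \<open>4 * C * a\<close>.\<close>
  define Y where "Y = {y\<in>K. n y \<ge> a / 2 \<and> en y \<le> 4 * C * a * n y}"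
  have YK: "Y \<subseteq> K" and finY: "finite Y" using K by (auto simp: Y_def)
  have "cE \<le> (\<Sum>y\<in>K. (if y \<in> Y then n y else 0) + (a / 2 + en y / (4 * C * a)))"
    unfolding sumn[symmetric]
  proof (rule sum_mono)
    fix y assume y: "y \<in> K"
    have nn: "n y \<ge> 0" by (simp add: n_def)
    have q: "en y / (4 * C * a) \<ge> 0" using en0 C a by simp
    show "n y \<le> (if y \<in> Y then n y else 0) + (a / 2 + en y / (4 * C * a))"
    proof (cases "y \<in> Y")
      case True then show ?thesis using q a by simp
    next
      case False
      then consider "n y < a / 2" | "en y > 4 * C * a * n y" using y by (force simp: Y_def)
      then show ?thesis
      proof cases
        case 1 then show ?thesis using q False by simp
      next
        case 2
        then have "n y \<le> en y / (4 * C * a)" using C a by (simp add: pos_le_divide_eq mult.commute)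
        then show ?thesis using a False by simp
      qed
    qed
  qed
  also have "\<dots> = (\<Sum>y\<in>K. if y \<in> Y then n y else 0) + (real (card K) * (a / 2) + (\<Sum>y\<in>K. en y) / (4 * C * a))"
    by (simp add: sum.distrib sum_divide_distrib)
  also have "(\<Sum>y\<in>K. if y \<in> Y then n y else 0) = (\<Sum>y\<in>Y. n y)"
    using sum.inter_restrict[OF K(1), of n Y] YK by (simp add: Int_absorb1)
  also have "real (card K) * (a / 2) \<le> M * (a / 2)" using M a by (intro mult_right_mono) (auto simp: K_def)
  also have "M * (a / 2) = cE / 2" using M0 by (simp add: a_def)
  also have "(\<Sum>y\<in>K. en y) / (4 * C * a) \<le> C * cE * a / (4 * C * a)" using sume C a by (intro divide_right_mono) auto
  also have "C * cE * a / (4 * C * a) = cE / 4" using C a by simp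
  finally have Yn: "cE / 4 \<le> (\<Sum>y\<in>Y. n y)" by simp
  have nY: "n y \<le> 4 * C * a" "n y > 0" if "y \<in> Y" for y
  proof -
    show "n y > 0" using that a by (auto simp: Y_def)
    have "n y * n y \<le> 4 * C * a * n y" using en2[of y] that by (auto simp: Y_def)
    then show "n y \<le> 4 * C * a" using \<open>n y > 0\<close> by simp
  qed
  have "(\<Sum>y\<in>Y. n y) \<le> (\<Sum>y\<in>Y. 4 * C * a)" by (intro sum_mono nY)
  then have "cE / 4 \<le> real (card Y) * (4 * C * a)" using Yn by simp
  then have "cE \<le> real (card Y) * (16 * C) * a" by (simp add: ac_simps)
  then have cY: "M / (16 * C) \<le> real (card Y)"
    using M0 C cE by (simp add: a_def pos_divide_le_eq pos_le_divide_eq mult.commute)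
  have "\<exists>E'. E' \<subseteq> {e\<in>E. key e = y} \<and> E' \<noteq> {} \<and> (\<forall>e\<in>E'. (\<Sum>e'\<in>E'. P e e') \<le> 32 * C * real (card E'))" if y: "y \<in> Y" for y
  proof -
    \<comment> \<open>Chebyshev: the energy of the class is at most
      \<open>8 * C * n y * n y\<close>, so at most half of its elements are removed. Removal only
      lowers the potentials of the others.\<close>
    define E' where "E' = {e\<in>cl y. pot e \<le> 16 * C * n y}"
    have sub: "E' \<subseteq> cl y" by (auto simp: E'_def)
    have fE': "finite E'" using sub fcl finite_subset by blast
    have "real (card (cl y - E')) * (16 * C * n y) \<le> (\<Sum>e\<in>cl y - E'. pot e)"
      by (rule order_trans[OF _ sum_mono[of _ "\<lambda>_. 16 * C * n y"]]) (auto simp: E'_def)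
    also have "\<dots> \<le> en y" unfolding en_def using fcl clE pot0 by (intro sum_mono2) auto
    also have "\<dots> \<le> 4 * C * a * n y" using y by (simp add: Y_def)
    also have "\<dots> \<le> 4 * C * (2 * n y) * n y" using y C nY[OF y] by (intro mult_right_mono mult_left_mono) (auto simp: Y_def)
    finally have "real (card (cl y - E')) * (16 * C * n y) \<le> (n y / 2) * (16 * C * n y)" by simp
    then have "real (card (cl y - E')) \<le> n y / 2" using C nY[OF y] by simp
    moreover have "real (card (cl y - E')) = n y - real (card E')"
      using card_Diff_subset[OF fE' sub] card_mono[OF fcl sub] by (simp add: n_def)
    ultimately have half: "n y \<le> 2 * real (card E')" by simp
    then have "E' \<noteq> {}" using nY[OF y] by auto
    moreover have "(\<Sum>e'\<in>E'. P e e') \<le> 32 * C * real (card E')" if e: "e \<in> E'" for e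
    proof -
      have eE: "e \<in> E" "key e = y" using e by (auto simp: E'_def cl_def)
      have "(\<Sum>e'\<in>E'. P e e') \<le> pot e"
        unfolding pot_def eE(2) using P[OF eE(1)] clE by (intro sum_mono2 fcl sub) (meson DiffD1 order_trans subsetD zero_le_one)
      also have "\<dots> \<le> 16 * C * n y" using e by (simp add: E'_def)
      also have "\<dots> \<le> 16 * C * (2 * real (card E'))" using half C by (intro mult_left_mono) auto
      finally show ?thesis by simp
    qed
    ultimately show ?thesis using sub unfolding cl_def by blast
  qed
  then show ?thesis using YK cY unfolding K_def by blast
qed

text \<open>A tube is a discretized line with slope \<open>\<theta> i / D\<close> in coordinate
  \<open>i\<close> over coordinate \<open>l\<close>; the key is the place where it meets
  \<open>l\<close>-coordinate 0. Rounding by \<open>div\<close> makes the tubes of a fixed slope a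
  partition of the cells.\<close>

definition tubekey :: "'n \<Rightarrow> 'n \<Rightarrow> nat \<Rightarrow> ('n \<Rightarrow> int) \<Rightarrow> ('n \<Rightarrow> int) \<Rightarrow> 'n \<Rightarrow> int" where
  "tubekey k l D \<theta> e = (\<lambda>i. if i = l then 0 else if i = k then e k else e i - (\<theta> i * e l) div int D)"

definition slopes :: "'n::finite \<Rightarrow> 'n \<Rightarrow> nat \<Rightarrow> ('n \<Rightarrow> int) set" where
  "slopes k l D = Pi\<^sub>E (UNIV - {k, l}) (\<lambda>_. {0..<int D})"

definition grid :: "'n::finite \<Rightarrow> nat \<Rightarrow> ('n \<Rightarrow> int) set" where
  "grid k D = {e. e k = (int D - 1) div 2 \<and> (\<forall>i. i \<noteq> k \<longrightarrow> e i \<in> {0..<int D})}"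

lemma card_slopes: "k \<noteq> l \<Longrightarrow> card (slopes k l D) = D ^ (CARD('n) - 2)" for k :: "'n::finite"
  by (simp add: slopes_def card_PiE card_Diff_subset numeral_2_eq_2)

lemma finite_slopes: "finite (slopes k l D)"
  by (simp add: slopes_def finite_PiE)

section \<open>Counting the slopes that put two cells into one tube\<close>

lemma div_diff_bound:
  fixes x y D :: int
  assumes "D > 0" shows "\<bar>(x div D - y div D) * D - (x - y)\<bar> < D"
proof -
  have "x = x div D * D + x mod D" "y = y div D * D + y mod D" by simp_all
  then have "(x div D - y div D) * D - (x - y) = y mod D - x mod D" by (simp add: algebra_simps)
  moreover have "0 \<le> x mod D" "x mod D < D" "0 \<le> y mod D" "y mod D < D" using assms by auto
  ultimately show ?thesis by linarith
qed

lemma card_int_diameter: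
  fixes A :: "int set"
  assumes A: "finite A" and d: "\<And>t t'. t \<in> A \<Longrightarrow> t' \<in> A \<Longrightarrow> t - t' \<le> m" and m: "m \<ge> 0"
  shows "int (card A) \<le> m + 1"
proof (cases "A = {}")
  case False
  have "A \<subseteq> {Min A..Min A + m}" using d[OF _ Min_in[OF A False]] A by (force simp: algebra_simps)
  then have "card A \<le> card {Min A..Min A + m}" by (intro card_mono) auto
  then show ?thesis using m by simp
qed (use m in simp)

text \<open>Each admissible \<open>t\<close> fixes \<open>t * (x - x')\<close> up to an error below
  \<open>D\<close>, so two of them differ by less than 2 D / d with d the distance of
  \<open>x\<close> and \<open>x'\<close>. The count 2 D / d + 1 is at most 3 D / d because d is at
  most \<open>D\<close>.\<close>

lemma same_tube_coordinate:
  fixes D x x' y y' :: int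
  assumes D: "D > 0" and d: "x \<noteq> x'" "\<bar>x - x'\<bar> \<le> D"
  shows "real (card {t \<in> {0..<D}. y - (t * x) div D = y' - (t * x') div D}) \<le> 3 * real_of_int D / real_of_int \<bar>x - x'\<bar>"
proof -
  define A where "A = {t \<in> {0..<D}. y - (t * x) div D = y' - (t * x') div D}"
  define d where "d = \<bar>x - x'\<bar>"
  have d0: "d > 0" "d \<le> D" using d by (auto simp: d_def)
  have finA: "finite A" by (rule finite_subset[of _ "{0..<D}"]) (auto simp: A_def)
  have "int (card A) \<le> (2 * D) div d + 1"
  proof (rule card_int_diameter[OF finA])
    fix t t' assume t: "t \<in> A" "t' \<in> A"
    have 1: "\<bar>((t * x) div D - (t * x') div D) * D - (t * x - t * x')\<bar> < D"
      and 2: "\<bar>((t' * x) div D - (t' * x') div D) * D - (t' * x - t' * x')\<bar> < D"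
      by (rule div_diff_bound[OF D])+
    have eq: "(t * x) div D - (t * x') div D = y - y'" "(t' * x) div D - (t' * x') div D = y - y'"
      using t by (auto simp: A_def)
    have "\<bar>(t * x - t * x') - (t' * x - t' * x')\<bar> < 2 * D"
      using 1[unfolded eq] 2[unfolded eq] by linarith
    moreover have "(t * x - t * x') - (t' * x - t' * x') = (t - t') * (x - x')" by (simp add: algebra_simps)
    ultimately have "\<bar>t - t'\<bar> * d < 2 * D" by (simp add: abs_mult d_def)
    moreover have "(t - t') * d \<le> \<bar>t - t'\<bar> * d" using d0 by (intro mult_right_mono) auto
    ultimately have "(t - t') * d \<le> 2 * D" by linarith
    then show "t - t' \<le> (2 * D) div d" using d0 by (simp add: zdiv_mono1 order_trans[OF _ zdiv_mono1[of "(t - t') * d" "2 * D" d]])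
  qed (use D d0 in \<open>simp add: pos_imp_zdiv_nonneg_iff\<close>)
  then have "real (card A) \<le> real_of_int ((2 * D) div d) + 1" by linarith
  also have "real_of_int ((2 * D) div d) \<le> real_of_int (2 * D) / real_of_int d"
    using of_int_floor_le[of "real_of_int (2 * D) / real_of_int d"] unfolding floor_divide_of_int_eq by simp
  also have "1 \<le> real_of_int D / real_of_int d" using d0 by simp
  finally show ?thesis using d0 by (simp add: A_def d_def add_divide_distrib[symmetric])
qed

text \<open>Slopes below one force the largest index difference to occur in coordinate
  \<open>l\<close>, so one number measures the distance of the two cells. The slope entries are
  independent, and the bounds for single coordinates multiply.\<close>

lemma same_tube_card:
  fixes e e' :: "'n::finite \<Rightarrow> int"
  assumes kl: "k \<noteq> l" and D: "D > 0" and e: "e \<in> grid k D" "e' \<in> grid k D" and ne: "e \<noteq> e'"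
  defines "T \<equiv> {\<theta> \<in> slopes k l D. tubekey k l D \<theta> e' = tubekey k l D \<theta> e}"
  shows "T \<noteq> {} \<Longrightarrow> e l \<noteq> e' l \<and> (\<forall>i. \<bar>e i - e' i\<bar> \<le> \<bar>e l - e' l\<bar>)"
    and "T \<noteq> {} \<Longrightarrow> real (card T) \<le> (3 * real D / real_of_int \<bar>e l - e' l\<bar>) ^ (CARD('n) - 2)"
proof -
  have keq: "e' i - (\<theta> i * e' l) div int D = e i - (\<theta> i * e l) div int D" if "\<theta> \<in> T" "i \<noteq> k" "i \<noteq> l" for \<theta> i
  proof -
    have eq: "tubekey k l D \<theta> e' = tubekey k l D \<theta> e" using that(1) by (simp add: T_def)
    show ?thesis using fun_cong[OF eq, of i] that(2,3) by (simp add: tubekey_def)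
  qed
  have ek: "e k = e' k" using e by (simp add: grid_def)
  have lne: "e l \<noteq> e' l" if T: "T \<noteq> {}"
  proof
    assume l: "e l = e' l"
    obtain \<theta> where th: "\<theta> \<in> T" using T by auto
    have "e i = e' i" for i
    proof (cases "i = k \<or> i = l")
      case True then show ?thesis using ek l by auto
    next
      case False then show ?thesis using keq[OF th, of i] l by simp
    qed
    then show False using ne by auto
  qed
  show "e l \<noteq> e' l \<and> (\<forall>i. \<bar>e i - e' i\<bar> \<le> \<bar>e l - e' l\<bar>)" if T: "T \<noteq> {}"
  proof (intro conjI allI lne[OF T])
    fix i
    obtain \<theta> where th: "\<theta> \<in> T" using T by auto
    show "\<bar>e i - e' i\<bar> \<le> \<bar>e l - e' l\<bar>"
    proof (cases "i = k \<or> i = l")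
      case True then show ?thesis using ek by auto
    next
      case False
      then have t: "0 \<le> \<theta> i" "\<theta> i < int D" using th by (auto simp: T_def slopes_def PiE_def Pi_def)
      define u where "u = e i - e' i"
      have "\<bar>((\<theta> i * e l) div int D - (\<theta> i * e' l) div int D) * int D - (\<theta> i * e l - \<theta> i * e' l)\<bar> < int D"
        by (rule div_diff_bound) (use D in simp)
      moreover have "(\<theta> i * e l) div int D - (\<theta> i * e' l) div int D = u"
        using keq[OF th, of i] False by (simp add: u_def)
      ultimately have 1: "\<bar>u * int D - \<theta> i * (e l - e' l)\<bar> < int D" by (simp add: right_diff_distrib)
      have "\<bar>\<theta> i * (e l - e' l)\<bar> \<le> int D * \<bar>e l - e' l\<bar>" unfolding abs_mult using t by (intro mult_right_mono) auto
      then have "\<bar>u * int D\<bar> < int D * (\<bar>e l - e' l\<bar> + 1)" using 1 by (simp add: distrib_left)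
      then have "\<bar>u\<bar> * int D < (\<bar>e l - e' l\<bar> + 1) * int D" by (simp add: abs_mult mult.commute)
      then have "\<bar>u\<bar> < \<bar>e l - e' l\<bar> + 1" using D by (simp add: mult_less_cancel_right)
      then show ?thesis by (simp add: u_def)
    qed
  qed
  show "real (card T) \<le> (3 * real D / real_of_int \<bar>e l - e' l\<bar>) ^ (CARD('n) - 2)" if T: "T \<noteq> {}"
  proof -
    define A where "A i = {t \<in> {0..<int D}. e i - (t * e l) div int D = e' i - (t * e' l) div int D}" for i
    have finA: "finite (A i)" for i by (rule finite_subset[of _ "{0..<int D}"]) (auto simp: A_def)
    have "\<theta> \<in> Pi\<^sub>E (UNIV - {k, l}) A" if th: "\<theta> \<in> T" for \<theta>
    proof (rule PiE_I)
      fix i assume i: "i \<in> UNIV - {k, l}"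
      have "\<theta> i \<in> {0..<int D}" using th i by (auto simp: T_def slopes_def PiE_def Pi_def)
      then show "\<theta> i \<in> A i" using keq[OF th, of i] i by (simp add: A_def)
    next
      fix i assume "i \<notin> UNIV - {k, l}"
      then show "\<theta> i = undefined" using th by (auto simp: T_def slopes_def PiE_def extensional_def)
    qed
    then have "card T \<le> card (Pi\<^sub>E (UNIV - {k, l}) A)" using finA by (intro card_mono finite_PiE) auto
    also have "\<dots> = (\<Prod>i\<in>UNIV - {k, l}. card (A i))" by (simp add: card_PiE)
    finally have "real (card T) \<le> (\<Prod>i\<in>UNIV - {k, l}. real (card (A i)))" by (metis of_nat_le_iff of_nat_prod)
    also have "\<dots> \<le> (\<Prod>i\<in>UNIV - {k, l}. 3 * real D / real_of_int \<bar>e l - e' l\<bar>)"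
    proof (intro prod_mono conjI)
      fix i
      have "e l \<in> {0..<int D}" "e' l \<in> {0..<int D}" using e kl by (auto simp: grid_def)
      then have "\<bar>e l - e' l\<bar> \<le> int D" by auto
      then show "real (card (A i)) \<le> 3 * real D / real_of_int \<bar>e l - e' l\<bar>"
        unfolding A_def using same_tube_coordinate[of "int D" "e l" "e' l" "e i" "e' i"] D lne[OF T] by simp
    qed simp
    also have "\<dots> = (3 * real D / real_of_int \<bar>e l - e' l\<bar>) ^ (CARD('n) - 2)"
      using kl by (simp add: card_Diff_subset numeral_2_eq_2)
    finally show ?thesis .
  qed
qed

text \<open>For \<open>E\<close> inside a grid of \<open>3 ^ L\<close> cells per side: the
  normalized counting measure gives a triadic cube of relative side \<open>3 ^ a / 3 ^ L\<close>
  mass at most the \<open>s\<close>-th power of that side, with constant one.\<close>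

definition frostman :: "real \<Rightarrow> nat \<Rightarrow> ('n::finite \<Rightarrow> int) set \<Rightarrow> bool" where
  "frostman s L E \<longleftrightarrow> (\<forall>a\<le>L. \<forall>b. real (card {e\<in>E. \<forall>i. e i div 3 ^ a = b i}) \<le> real (card E) * 3 powr (- s * real (L - a)))"

lemma near_count:
  fixes E :: "('n::finite \<Rightarrow> int) set"
  assumes E: "finite E" and fr: "frostman s L E" and a: "a \<le> L"
  shows "real (card {e'\<in>E. \<forall>i. \<bar>e' i - e i\<bar> \<le> 3 ^ a}) \<le> 3 ^ CARD('n) * (real (card E) * 3 powr (- s * real (L - a)))"
proof -
  define BB where "BB = Pi\<^sub>E (UNIV :: 'n set) (\<lambda>i. {e i div 3 ^ a - 1..e i div 3 ^ a + 1})"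
  have cB: "card BB = 3 ^ CARD('n)" by (simp add: BB_def card_PiE)
  have finB: "finite BB" by (simp add: BB_def finite_PiE)
  have "{e'\<in>E. \<forall>i. \<bar>e' i - e i\<bar> \<le> 3 ^ a} \<subseteq> (\<Union>b\<in>BB. {e'\<in>E. \<forall>i. e' i div 3 ^ a = b i})"
  proof
    fix e' assume e': "e' \<in> {e'\<in>E. \<forall>i. \<bar>e' i - e i\<bar> \<le> 3 ^ a}"
    have "(\<lambda>i. e' i div 3 ^ a) \<in> BB"
      unfolding BB_def
    proof (rule PiE_I)
      fix i
      have d: "\<bar>e' i - e i\<bar> \<le> 3 ^ a" using e' by auto
      have "e' i div 3 ^ a \<le> (e i + 1 * 3 ^ a) div 3 ^ a" using d by (intro zdiv_mono1) auto
      moreover have "(e i + (- 1) * 3 ^ a) div 3 ^ a \<le> e' i div 3 ^ a" using d by (intro zdiv_mono1) auto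
      moreover have "(e i + c * 3 ^ a) div 3 ^ a = c + e i div 3 ^ a" for c by (rule div_mult_self1) simp
      ultimately have "e' i div 3 ^ a \<le> 1 + e i div 3 ^ a" "(- 1) + e i div 3 ^ a \<le> e' i div 3 ^ a" by (simp_all only:)
      then show "e' i div 3 ^ a \<in> {e i div 3 ^ a - 1..e i div 3 ^ a + 1}" by simp
    qed simp
    then show "e' \<in> (\<Union>b\<in>BB. {e'\<in>E. \<forall>i. e' i div 3 ^ a = b i})" using e' by auto
  qed
  then have "card {e'\<in>E. \<forall>i. \<bar>e' i - e i\<bar> \<le> 3 ^ a} \<le> card (\<Union>b\<in>BB. {e'\<in>E. \<forall>i. e' i div 3 ^ a = b i})"
    using E finB by (intro card_mono) auto
  also have "\<dots> \<le> (\<Sum>b\<in>BB. card {e'\<in>E. \<forall>i. e' i div 3 ^ a = b i})" by (rule card_UN_le[OF finB])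
  finally have "real (card {e'\<in>E. \<forall>i. \<bar>e' i - e i\<bar> \<le> 3 ^ a}) \<le> (\<Sum>b\<in>BB. real (card {e'\<in>E. \<forall>i. e' i div 3 ^ a = b i}))"
    by (simp only: of_nat_sum[symmetric] of_nat_le_iff)
  also have "\<dots> \<le> (\<Sum>b\<in>BB. real (card E) * 3 powr (- s * real (L - a)))"
    using fr a by (intro sum_mono) (auto simp: frostman_def)
  finally show ?thesis by (simp add: cB)
qed

text \<open>Share of the pairs at relative distance about 3^-b in the averaged energy: the first
  factor bounds the logarithmic kernel, as \<open>ln 3 \<le> 2\<close>, and the second is the
  surplus of the Frostman dimension over n - 2.\<close>

definition scale_weight :: "real \<Rightarrow> nat \<Rightarrow> real" where
  "scale_weight \<delta> b = (1 + 2 * real b) * (3 powr (- \<delta>)) ^ b"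

definition weight_series :: "real \<Rightarrow> real" where
  "weight_series \<delta> = (\<Sum>b. scale_weight \<delta> b)"

lemma scale_weight_pos: "scale_weight \<delta> b > 0"
  unfolding scale_weight_def by (intro mult_pos_pos) auto

lemma scale_weight_alt: "scale_weight \<delta> b = (1 + 2 * real b) * 3 powr (- \<delta> * real b)"
proof -
  have "(3 powr (- \<delta>)) ^ b = (3 powr (- \<delta>)) powr real b" by (rule powr_realpow[symmetric]) simp
  then show ?thesis by (simp add: scale_weight_def powr_powr)
qed

lemma scale_weight_summable: assumes "\<delta> > 0" shows "summable (scale_weight \<delta>)"
proof -
  define q where "q = 3 powr (- \<delta>)"
  have q: "0 < q" "q < 1" using assms by (auto simp: q_def powr_less_one)
  have "(\<lambda>n. of_nat (Suc n) * q ^ n) sums (1 / (1 - q)\<^sup>2)" by (rule geometric_deriv_sums) (use q in auto)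
  then have "summable (\<lambda>n. 2 * (real (Suc n) * q ^ n))" by (intro summable_mult sums_summable)
  then show ?thesis
  proof (rule summable_comparison_test'[where N=0])
    fix n
    have "(1 + 2 * real n) * q ^ n \<le> (2 * real (Suc n)) * q ^ n" using q by (intro mult_right_mono) auto
    then show "norm (scale_weight \<delta> n) \<le> 2 * (real (Suc n) * q ^ n)" using scale_weight_pos[of \<delta> n] q by (simp add: scale_weight_def q_def mult.assoc)
  qed
qed

lemma scale_weight_sum_le: "\<delta> > 0 \<Longrightarrow> finite A \<Longrightarrow> (\<Sum>b\<in>A. scale_weight \<delta> b) \<le> weight_series \<delta>"
  unfolding weight_series_def by (rule sum_le_suminf[OF scale_weight_summable]) (auto intro: less_imp_le[OF scale_weight_pos])

lemma weight_series_pos: "\<delta> > 0 \<Longrightarrow> weight_series \<delta> > 0"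
  using scale_weight_sum_le[of \<delta> "{0}"] scale_weight_pos[of \<delta> 0] by simp

definition log_kernel :: "'n \<Rightarrow> nat \<Rightarrow> ('n \<Rightarrow> int) \<Rightarrow> ('n \<Rightarrow> int) \<Rightarrow> real" where
  "log_kernel l D e e' = 1 + ln (real D / max (real_of_int \<bar>e l - e' l\<bar>) 1)"

lemma log_kernel_ge_1:
  assumes "e \<in> grid k D" "e' \<in> grid k D" "l \<noteq> k" shows "log_kernel l D e e' \<ge> 1"
proof -
  have "e l \<in> {0..<int D}" "e' l \<in> {0..<int D}" using assms by (auto simp: grid_def)
  then have "\<bar>e l - e' l\<bar> \<le> int D" "D \<ge> 1" by auto
  then have "max (real_of_int \<bar>e l - e' l\<bar>) 1 \<le> real D" by auto
  moreover have "0 < max (real_of_int \<bar>e l - e' l\<bar>) 1" by (simp add: less_max_iff_disj)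
  ultimately have "1 \<le> real D / max (real_of_int \<bar>e l - e' l\<bar>) 1" by (simp only: le_divide_eq_1_pos)
  then show ?thesis unfolding log_kernel_def by (metis ln_ge_zero add_increasing2 order_refl)
qed

text \<open>The summand 1 stands for the diagonal. In the other, 3^n counts neighbouring triadic
  cubes, and the exponent is (n - 2) + s with s = n - 2 + \<delta>: the factor 3 in the slope count
  gives n - 2, and rounding distances up to the next power of 3 gives s.\<close>

definition energy_const :: "'n::finite itself \<Rightarrow> real \<Rightarrow> real" where
  "energy_const T \<delta> = weight_series \<delta> * (1 + 3 ^ CARD('n) * 3 powr (2 * (real CARD('n) - 2) + \<delta>))"

text \<open>The cells \<open>e'\<close> are sorted by the power of 3 below their distance to
  \<open>e\<close>. At relative distance 3^-b the Frostman condition bounds their share of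
  \<open>E\<close> by a multiple of 3^(-s b), and each shares a tube with \<open>e\<close> for at
  most a multiple of 3^((n-2) b) slopes; the product decays like 3^(-\<delta> b), fast enough to sum
  the logarithm.\<close>

lemma energy_sum:
  fixes E :: "('n::finite \<Rightarrow> int) set"
  assumes n: "CARD('n) \<ge> 2" and kl: "k \<noteq> l" and D: "D = 3 ^ L" and L: "L \<ge> 1" and E: "finite E" "E \<subseteq> grid k D" "e \<in> E"
    and fr: "frostman (real CARD('n) - 2 + \<delta>) L E" and \<delta>: "\<delta> > 0"
  shows "(\<Sum>e'\<in>E. real (card {\<theta> \<in> slopes k l D. tubekey k l D \<theta> e' = tubekey k l D \<theta> e}) * log_kernel l D e e')
    \<le> energy_const TYPE('n) \<delta> * real (card E)"
proof -
  let ?n = "CARD('n)"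
  define T where "T e' = {\<theta> \<in> slopes k l D. tubekey k l D \<theta> e' = tubekey k l D \<theta> e}" for e'
  define m where "m = real ?n - 2"
  have m: "m = real (?n - 2)" "m \<ge> 0" using n by (auto simp: m_def of_nat_diff)
  define s where "s = m + \<delta>"
  have fr': "frostman s L E" using fr by (simp add: s_def m_def)
  have D0: "D > 0" by (simp add: D)
  define cE where "cE = real (card E)"
  define S where "S = {e'\<in>E. e' \<noteq> e \<and> T e' \<noteq> {}}"
  have finS: "finite S" using E by (simp add: S_def)
  define d where "d e' = \<bar>e l - e' l\<bar>" for e'
  define g where "g e' = (LEAST a. d e' < 3 ^ Suc a)" for e'
  have gr: "e' \<in> grid k D" if "e' \<in> E" for e' using E that by auto
  have tube: "e l \<noteq> e' l \<and> (\<forall>i. \<bar>e i - e' i\<bar> \<le> d e')"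
    "real (card (T e')) \<le> (3 * real D / real_of_int (d e')) ^ (?n - 2)" if "e' \<in> S" for e'
    using that same_tube_card[OF kl D0 gr[OF E(3)] gr[of e']] by (auto simp: S_def T_def d_def)
  have dD: "d e' < 3 ^ L" if "e' \<in> E" for e'
  proof -
    have "e l \<in> {0..<int D}" "e' l \<in> {0..<int D}" using gr[OF E(3)] gr[OF that] kl by (auto simp: grid_def)
    then have "d e' < int D" by (auto simp: d_def)
    then show ?thesis by (simp add: D)
  qed
  have gprop: "g e' < L" "d e' < 3 ^ Suc (g e')" "3 ^ g e' \<le> d e'" if e': "e' \<in> S" for e'
  proof -
    obtain L' where L': "L = Suc L'" using L by (cases L) auto
    have w: "d e' < 3 ^ Suc L'" using dD[of e'] e' L' by (simp add: S_def)
    show "g e' < L" unfolding g_def L' less_Suc_eq_le by (rule Least_le) (rule w)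
    show "d e' < 3 ^ Suc (g e')" unfolding g_def by (rule LeastI) (rule w)
    show "3 ^ g e' \<le> d e'"
    proof (cases "g e'")
      case 0 then show ?thesis using tube(1)[OF e'] by (auto simp: d_def)
    next
      case (Suc a)
      then have "\<not> d e' < 3 ^ Suc a" using not_less_Least[of a "\<lambda>a. d e' < 3 ^ Suc a"] by (simp add: g_def)
      then show ?thesis using Suc by simp
    qed
  qed
  have trm: "real (card (T e')) * log_kernel l D e e' \<le> 3 powr (m + real (L - g e') * m) * (1 + 2 * real (L - g e'))" if e': "e' \<in> S" for e'
  proof (rule mult_mono)
    let ?a = "g e'"
    have d3: "3 ^ ?a \<le> real_of_int (d e')" using gprop(3)[OF e'] by (metis of_int_le_iff of_int_numeral of_int_power)
    have d1: "real_of_int (d e') \<ge> 1" using order_trans[OF _ d3, of 1] by simp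
    have aL: "?a < L" by (rule gprop(1)[OF e'])
    have DL: "real D / 3 ^ ?a = 3 ^ (L - ?a)" using aL by (simp add: D power_diff)
    have q: "real D / real_of_int (d e') \<le> 3 ^ (L - ?a)"
      unfolding DL[symmetric] by (rule frac_le) (use d3 in auto)
    have q': "3 * real D / real_of_int (d e') \<le> 3 * 3 ^ (L - ?a)" using mult_left_mono[OF q, of 3] by simp
    have "real (card (T e')) \<le> (3 * real D / real_of_int (d e')) ^ (?n - 2)" by (rule tube(2)[OF e'])
    also have "\<dots> \<le> (3 * 3 ^ (L - ?a)) ^ (?n - 2)" using q' d1 by (intro power_mono) auto
    also have "\<dots> = (3 powr (1 + real (L - ?a))) powr m" by (simp add: m powr_realpow powr_add)
    also have "\<dots> = 3 powr (m + real (L - ?a) * m)" by (simp add: powr_powr algebra_simps)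
    finally show "real (card (T e')) \<le> 3 powr (m + real (L - ?a) * m)" .
    have mx: "max (real_of_int \<bar>e l - e' l\<bar>) 1 = real_of_int (d e')" using d1 by (simp add: d_def max_def)
    have "ln (real D / real_of_int (d e')) \<le> ln (3 ^ (L - ?a))"
      using q D0 d1 by (subst ln_le_cancel_iff) auto
    also have "\<dots> = real (L - ?a) * ln 3" by (simp add: ln_realpow)
    also have "\<dots> \<le> real (L - ?a) * 2" using ln_le_minus_one[of "3::real"] by (intro mult_left_mono) auto
    finally show "log_kernel l D e e' \<le> 1 + 2 * real (L - ?a)" unfolding log_kernel_def mx by simp
    show "0 \<le> log_kernel l D e e'" using log_kernel_ge_1[OF gr[OF E(3)] gr[of e']] e' kl by (force simp: S_def)
  qed auto
  have cnt: "real (card {e'\<in>S. g e' = a}) \<le> 3 ^ ?n * (cE * 3 powr (- s * real (L - Suc a)))" if a: "a < L" for a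
  proof -
    have "{e'\<in>S. g e' = a} \<subseteq> {e'\<in>E. \<forall>i. \<bar>e' i - e i\<bar> \<le> 3 ^ Suc a}"
    proof
      fix e' assume e': "e' \<in> {e'\<in>S. g e' = a}"
      then have S: "e' \<in> S" "g e' = a" by auto
      have "\<bar>e' i - e i\<bar> \<le> 3 ^ Suc a" for i
        using tube(1)[OF S(1)] gprop(2)[OF S(1)] S(2) by (smt (verit) abs_minus_commute)
      then show "e' \<in> {e'\<in>E. \<forall>i. \<bar>e' i - e i\<bar> \<le> 3 ^ Suc a}" using S by (auto simp: S_def)
    qed
    then have "card {e'\<in>S. g e' = a} \<le> card {e'\<in>E. \<forall>i. \<bar>e' i - e i\<bar> \<le> 3 ^ Suc a}" using E by (intro card_mono) auto
    then show ?thesis using near_count[OF E(1) fr', of "Suc a" e] a unfolding cE_def by (meson of_nat_mono order_trans Suc_leI)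
  qed
  have "(\<Sum>e'\<in>S. real (card (T e')) * log_kernel l D e e') \<le> (\<Sum>e'\<in>S. 3 powr (m + real (L - g e') * m) * (1 + 2 * real (L - g e')))"
    by (rule sum_mono) (rule trm)
  also have "\<dots> = (\<Sum>a<L. \<Sum>e'\<in>{e'\<in>S. g e' = a}. 3 powr (m + real (L - g e') * m) * (1 + 2 * real (L - g e')))"
    by (rule sum.group[symmetric]) (use finS gprop(1) in auto)
  also have "\<dots> = (\<Sum>a<L. real (card {e'\<in>S. g e' = a}) * (3 powr (m + real (L - a) * m) * (1 + 2 * real (L - a))))"
    by (intro sum.cong refl) simp
  also have "\<dots> \<le> (\<Sum>a<L. 3 ^ ?n * (cE * 3 powr (- s * real (L - Suc a))) * (3 powr (m + real (L - a) * m) * (1 + 2 * real (L - a))))"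
    by (intro sum_mono mult_right_mono cnt) auto
  also have "\<dots> = (\<Sum>a<L. cE * (3 ^ ?n * 3 powr (2 * m + \<delta>)) * scale_weight \<delta> (L - a))"
  proof (rule sum.cong[OF refl])
    fix a assume "a \<in> {..<L}"
    then have a: "real (L - Suc a) = real (L - a) - 1" by auto
    have "- s * real (L - Suc a) + (m + real (L - a) * m) = (2 * m + \<delta>) + - \<delta> * real (L - a)"
      unfolding a s_def by (simp add: algebra_simps)
    then have "3 powr (- s * real (L - Suc a)) * 3 powr (m + real (L - a) * m) = 3 powr (2 * m + \<delta>) * 3 powr (- \<delta> * real (L - a))"
      unfolding powr_add[symmetric] by (rule arg_cong)
    then show "3 ^ ?n * (cE * 3 powr (- s * real (L - Suc a))) * (3 powr (m + real (L - a) * m) * (1 + 2 * real (L - a))) =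
       cE * (3 ^ ?n * 3 powr (2 * m + \<delta>)) * scale_weight \<delta> (L - a)"
      unfolding scale_weight_alt by (metis (no_types, opaque_lifting) mult.assoc mult.left_commute mult.commute)
  qed
  also have "\<dots> = cE * (3 ^ ?n * 3 powr (2 * m + \<delta>)) * (\<Sum>b\<in>(\<lambda>a. L - a) ` {..<L}. scale_weight \<delta> b)"
    by (subst sum.reindex) (auto simp: inj_on_def sum_distrib_left)
  also have "\<dots> \<le> cE * (3 ^ ?n * 3 powr (2 * m + \<delta>)) * weight_series \<delta>"
    by (intro mult_left_mono scale_weight_sum_le \<delta>) (auto simp: cE_def)
  finally have off: "(\<Sum>e'\<in>S. real (card (T e')) * log_kernel l D e e') \<le> cE * (3 ^ ?n * 3 powr (2 * m + \<delta>)) * weight_series \<delta>" .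
  \<comment> \<open>On the diagonal all slopes count, with the largest value of the kernel. The
    condition at \<open>a = 0\<close>, applied to the single cell \<open>e\<close>, forces
    \<open>card E\<close> to be at least 3^(s L), which exceeds the number of slopes by 3^(\<delta>
    L).\<close>
  have diag: "real (card (T e)) * log_kernel l D e e \<le> cE * weight_series \<delta>"
  proof -
    have "T e = slopes k l D" by (simp add: T_def)
    then have cT: "real (card (T e)) = real D ^ (?n - 2)" using card_slopes[OF kl] by simp
    have "log_kernel l D e e = 1 + real L * ln 3" by (simp add: log_kernel_def D ln_realpow)
    also have "\<dots> \<le> 1 + 2 * real L" using ln_le_minus_one[of "3::real"] mult_left_mono[of "ln 3" 2 "real L"] by simp
    also have "\<dots> = scale_weight \<delta> L * 3 powr (\<delta> * real L)"
      unfolding scale_weight_alt mult.assoc powr_add[symmetric] by simp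
    also have "\<dots> \<le> weight_series \<delta> * 3 powr (\<delta> * real L)" using scale_weight_sum_le[OF \<delta>, of "{L}"] by (intro mult_right_mono) auto
    finally have p: "log_kernel l D e e \<le> weight_series \<delta> * 3 powr (\<delta> * real L)" .
    have "1 \<le> cE * 3 powr (- s * real L)"
    proof -
      have "card {e} \<le> card {e'\<in>E. \<forall>i. e' i div 3 ^ 0 = e i}" using E by (intro card_mono) auto
      then show ?thesis using fr'[unfolded frostman_def, rule_format, of 0 e] by (simp add: cE_def)
    qed
    then have "1 * 3 powr (s * real L) \<le> (cE * 3 powr (- s * real L)) * 3 powr (s * real L)" by (intro mult_right_mono) auto
    then have cEs: "3 powr (s * real L) \<le> cE" by (simp add: mult.assoc powr_add[symmetric])
    have "real D ^ (?n - 2) = 3 powr (m * real L)"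
      by (simp add: D m powr_realpow[symmetric] powr_powr mult.commute power_mult[symmetric])
    then have "real (card (T e)) * log_kernel l D e e \<le> 3 powr (m * real L) * (weight_series \<delta> * 3 powr (\<delta> * real L))"
      using p by (simp add: cT mult_left_mono)
    also have "\<dots> = weight_series \<delta> * 3 powr (s * real L)" by (simp add: s_def powr_add[symmetric] algebra_simps)
    also have "\<dots> \<le> weight_series \<delta> * cE" using cEs weight_series_pos[OF \<delta>] by (intro mult_left_mono) auto
    finally show ?thesis by (simp add: mult.commute)
  qed
  have "(\<Sum>e'\<in>E. real (card (T e')) * log_kernel l D e e') = real (card (T e)) * log_kernel l D e e + (\<Sum>e'\<in>E - {e}. real (card (T e')) * log_kernel l D e e')"
    by (rule sum.remove[OF E(1,3)])
  also have "(\<Sum>e'\<in>E - {e}. real (card (T e')) * log_kernel l D e e') = (\<Sum>e'\<in>S. real (card (T e')) * log_kernel l D e e')"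
    by (rule sum.mono_neutral_right) (use E in \<open>auto simp: S_def\<close>)
  finally have "(\<Sum>e'\<in>E. real (card (T e')) * log_kernel l D e e') \<le> cE * weight_series \<delta> + cE * (3 ^ ?n * 3 powr (2 * m + \<delta>)) * weight_series \<delta>"
    using diag off by simp
  also have "\<dots> = energy_const TYPE('n) \<delta> * cE" by (simp add: energy_const_def m_def algebra_simps)
  finally show ?thesis by (simp add: T_def cE_def)
qed

lemma slope_div_range:
  assumes D: "D > 0" and t: "0 \<le> t" "t < int D" and b: "0 \<le> b" "b < int D"
  shows "(t * b) div int D \<in> {0..<int D}"
proof -
  have "t * b \<le> (int D - 1) * (int D - 1)" using t b by (intro mult_mono) auto
  also have "\<dots> < int D * int D" using D by (simp add: algebra_simps)
  finally have "t * b < int D * int D" .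
  moreover have "t * b = (t * b) div int D * int D + (t * b) mod int D" by simp
  moreover have "0 \<le> (t * b) mod int D" using D by simp
  ultimately have "(t * b) div int D * int D < int D * int D" by linarith
  then have "(t * b) div int D < int D" using D by (simp add: mult_less_cancel_right)
  moreover have "0 \<le> (t * b) div int D" using t b D by (simp add: pos_imp_zdiv_nonneg_iff)
  ultimately show ?thesis by simp
qed

lemma tubekey_range:
  assumes kl: "k \<noteq> l" and D: "D > 0" and e: "e \<in> grid k D" and th: "\<theta> \<in> slopes k l D"
  shows "tubekey k l D \<theta> e l = 0" "tubekey k l D \<theta> e k = (int D - 1) div 2"
    "i \<noteq> k \<Longrightarrow> i \<noteq> l \<Longrightarrow> tubekey k l D \<theta> e i \<in> {- int D<..<int D}"
proof -
  show "tubekey k l D \<theta> e l = 0" "tubekey k l D \<theta> e k = (int D - 1) div 2"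
    using e kl by (auto simp: tubekey_def grid_def)
  assume i: "i \<noteq> k" "i \<noteq> l"
  have t: "0 \<le> \<theta> i" "\<theta> i < int D" using th i by (auto simp: slopes_def PiE_def Pi_def)
  have el: "0 \<le> e l" "e l < int D" "0 \<le> e i" "e i < int D" using e kl i by (auto simp: grid_def)
  have "(\<theta> i * e l) div int D \<in> {0..<int D}" by (rule slope_div_range[OF D t el(1,2)])
  then show "tubekey k l D \<theta> e i \<in> {- int D<..<int D}" using el i by (auto simp: tubekey_def)
qed

lemma card_tubekeys:
  fixes E :: "('n::finite \<Rightarrow> int) set"
  assumes kl: "k \<noteq> l" and D: "D > 0" and E: "E \<subseteq> grid k D" and th: "\<theta> \<in> slopes k l D"
  shows "real (card (tubekey k l D \<theta> ` E)) \<le> (2 * real D) ^ (CARD('n) - 2)"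
proof -
  define PP where "PP = Pi\<^sub>E (UNIV - {k, l}) (\<lambda>_. {- int D..<int D})"
  define ex where "ex p = (\<lambda>i. if i = l then 0 else if i = k then (int D - 1) div 2 else p i)" for p :: "'n \<Rightarrow> int"
  have "finite PP" by (simp add: PP_def finite_PiE)
  moreover have "tubekey k l D \<theta> ` E \<subseteq> ex ` PP"
  proof
    fix y assume "y \<in> tubekey k l D \<theta> ` E"
    then obtain e where e: "e \<in> E" "y = tubekey k l D \<theta> e" by auto
    note r = tubekey_range[OF kl D subsetD[OF E e(1)] th, folded e(2)]
    have "restrict y (UNIV - {k, l}) \<in> PP" unfolding PP_def using r(3) by (auto intro!: restrict_PiE_iff[THEN iffD2]) force+
    moreover have "y = ex (restrict y (UNIV - {k, l}))" using r(1,2) by (auto simp: ex_def fun_eq_iff)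
    ultimately show "y \<in> ex ` PP" by blast
  qed
  ultimately have "card (tubekey k l D \<theta> ` E) \<le> card PP" by (rule surj_card_le)
  also have "card PP = (2 * D) ^ (CARD('n) - 2)"
    using kl by (simp add: PP_def card_PiE card_Diff_subset numeral_2_eq_2 nat_mult_distrib)
  finally show ?thesis by (metis of_nat_le_iff of_nat_mult of_nat_numeral of_nat_power)
qed

text \<open>The energy is averaged over D^(n-2) slopes, whereas (2 D)^(n-2) is the bound used for
  the number of tubes; the power of 2 compensates.\<close>

definition tube_const :: "'n::finite itself \<Rightarrow> real \<Rightarrow> real" where
  "tube_const T \<delta> = energy_const T \<delta> * 2 ^ (CARD('n) - 2)"

lemma tube_const_pos: "\<delta> > 0 \<Longrightarrow> tube_const TYPE('n::finite) \<delta> > 0"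
  unfolding tube_const_def energy_const_def by (intro mult_pos_pos weight_series_pos add_pos_pos) auto

text \<open>Two cells at horizontal distance \<open>d / D\<close> lie in a common tube only for few of the
  \<open>D ^ (n - 2)\<close> slopes, so some slope has small total logarithmic energy.\<close>

lemma tube_selection:
  fixes E :: "('n::finite \<Rightarrow> int) set"
  assumes n: "CARD('n) \<ge> 2" and kl: "k \<noteq> l" and D: "D = 3 ^ L" and L: "L \<ge> 1" and E: "finite E" "E \<noteq> {}" "E \<subseteq> grid k D"
    and fr: "frostman (real CARD('n) - 2 + \<delta>) L E" and \<delta>: "\<delta> > 0"
  shows "\<exists>\<theta>\<in>slopes k l D. \<exists>Y \<subseteq> tubekey k l D \<theta> ` E.
     real (card Y) \<ge> (2 * real D) ^ (CARD('n) - 2) / (16 * tube_const TYPE('n) \<delta>) \<and>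
     (\<forall>y\<in>Y. \<exists>E'. E' \<subseteq> {e\<in>E. tubekey k l D \<theta> e = y} \<and> E' \<noteq> {} \<and>
        (\<forall>e\<in>E'. (\<Sum>e'\<in>E'. log_kernel l D e e') \<le> 32 * tube_const TYPE('n) \<delta> * real (card E')))"
proof -
  define \<Theta> where "\<Theta> = slopes k l D"
  have fin: "finite \<Theta>" by (simp add: \<Theta>_def finite_slopes)
  have D0: "D > 0" by (simp add: D)
  have c\<Theta>: "real (card \<Theta>) = real D ^ (CARD('n) - 2)" using card_slopes[OF kl] by (simp add: \<Theta>_def)
  have c\<Theta>0: "card \<Theta> > 0" using c\<Theta> D0 by (metis of_nat_0_less_iff zero_less_power)
  define en where "en \<theta> = (\<Sum>e\<in>E. \<Sum>e'\<in>{e'\<in>E. tubekey k l D \<theta> e' = tubekey k l D \<theta> e}. log_kernel l D e e')" for \<theta>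
  define cE where "cE = real (card E)"
  have "(\<Sum>\<theta>\<in>\<Theta>. en \<theta>) = (\<Sum>e\<in>E. \<Sum>e'\<in>E. real (card {\<theta>\<in>\<Theta>. tubekey k l D \<theta> e' = tubekey k l D \<theta> e}) * log_kernel l D e e')"
  proof -
    have "(\<Sum>\<theta>\<in>\<Theta>. en \<theta>) = (\<Sum>\<theta>\<in>\<Theta>. \<Sum>e\<in>E. \<Sum>e'\<in>E. if tubekey k l D \<theta> e' = tubekey k l D \<theta> e then log_kernel l D e e' else 0)"
      unfolding en_def using E(1) by (simp add: sum.inter_filter)
    also have "\<dots> = (\<Sum>e\<in>E. \<Sum>\<theta>\<in>\<Theta>. \<Sum>e'\<in>E. if tubekey k l D \<theta> e' = tubekey k l D \<theta> e then log_kernel l D e e' else 0)"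
      by (rule sum.swap)
    also have "\<dots> = (\<Sum>e\<in>E. \<Sum>e'\<in>E. \<Sum>\<theta>\<in>\<Theta>. if tubekey k l D \<theta> e' = tubekey k l D \<theta> e then log_kernel l D e e' else 0)"
      by (intro sum.cong refl sum.swap)
    also have "\<dots> = (\<Sum>e\<in>E. \<Sum>e'\<in>E. real (card {\<theta>\<in>\<Theta>. tubekey k l D \<theta> e' = tubekey k l D \<theta> e}) * log_kernel l D e e')"
      using fin by (intro sum.cong refl) (simp add: sum.inter_filter[symmetric])
    finally show ?thesis .
  qed
  also have "\<dots> \<le> (\<Sum>e\<in>E. energy_const TYPE('n) \<delta> * cE)"
    unfolding \<Theta>_def cE_def by (intro sum_mono energy_sum[OF n kl D L E(1,3) _ fr \<delta>])
  also have "\<dots> = energy_const TYPE('n) \<delta> * cE ^ 2" by (simp add: cE_def power2_eq_square)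
  finally have tot: "(\<Sum>\<theta>\<in>\<Theta>. en \<theta>) \<le> energy_const TYPE('n) \<delta> * cE ^ 2" .
  have "\<exists>\<theta>\<in>\<Theta>. en \<theta> \<le> energy_const TYPE('n) \<delta> * cE ^ 2 / real (card \<Theta>)"
  proof (rule ccontr)
    assume "\<not> ?thesis"
    then have "energy_const TYPE('n) \<delta> * cE ^ 2 / real (card \<Theta>) < en \<theta>" if "\<theta> \<in> \<Theta>" for \<theta> using that by force
    then have "(\<Sum>\<theta>\<in>\<Theta>. energy_const TYPE('n) \<delta> * cE ^ 2 / real (card \<Theta>)) < (\<Sum>\<theta>\<in>\<Theta>. en \<theta>)"
      using fin c\<Theta>0 by (intro sum_strict_mono) auto
    then show False using tot c\<Theta>0 by simp
  qed
  then obtain \<theta> where th: "\<theta> \<in> \<Theta>" "en \<theta> \<le> energy_const TYPE('n) \<delta> * cE ^ 2 / real D ^ (CARD('n) - 2)" by (auto simp: c\<Theta>)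
  have "\<exists>Y \<subseteq> tubekey k l D \<theta> ` E. real (card Y) \<ge> (2 * real D) ^ (CARD('n) - 2) / (16 * tube_const TYPE('n) \<delta>) \<and>
     (\<forall>y\<in>Y. \<exists>E'. E' \<subseteq> {e\<in>E. tubekey k l D \<theta> e = y} \<and> E' \<noteq> {} \<and>
        (\<forall>e\<in>E'. (\<Sum>e'\<in>E'. log_kernel l D e e') \<le> 32 * tube_const TYPE('n) \<delta> * real (card E')))"
  proof (rule class_selection[OF E(1,2) _ _ tube_const_pos[OF \<delta>]])
    show "1 \<le> log_kernel l D e e'" if "e \<in> E" "e' \<in> E" for e e' using log_kernel_ge_1[of e k D e' l] that E kl by auto
    show "real (card (tubekey k l D \<theta> ` E)) \<le> (2 * real D) ^ (CARD('n) - 2)"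
      by (rule card_tubekeys[OF kl D0 E(3)]) (use th in \<open>simp add: \<Theta>_def\<close>)
    have "energy_const TYPE('n) \<delta> * cE ^ 2 / real D ^ (CARD('n) - 2) = tube_const TYPE('n) \<delta> * cE ^ 2 / (2 * real D) ^ (CARD('n) - 2)"
      by (simp add: tube_const_def power_mult_distrib)
    then show "(\<Sum>e\<in>E. \<Sum>e'\<in>{e'\<in>E. tubekey k l D \<theta> e' = tubekey k l D \<theta> e}. log_kernel l D e e') \<le>
        tube_const TYPE('n) \<delta> * real (card E) ^ 2 / (2 * real D) ^ (CARD('n) - 2)"
      using th(2) by (simp add: en_def cE_def)
  qed
  then show ?thesis using th(1) unfolding \<Theta>_def by blast
qed

subsection \<open>The contradiction on a well-spread set of bad cells\<close>

text \<open>Inverse of \<open>tubekey\<close>: the cell of the tube \<open>y\<close> at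
  \<open>l\<close>-coordinate \<open>b\<close>. It also describes cells of the tube outside the unit
  cube.\<close>

definition tcell :: "'n \<Rightarrow> 'n \<Rightarrow> nat \<Rightarrow> ('n \<Rightarrow> int) \<Rightarrow> ('n \<Rightarrow> int) \<times> int \<Rightarrow> 'n \<Rightarrow> int" where
  "tcell k l D \<theta> = (\<lambda>(y, b) i. if i = l then b else if i = k then y k else y i + (\<theta> i * b) div int D)"

lemma tcell_cells:
  assumes kl: "k \<noteq> l" and D: "D > 0" and E: "E \<subseteq> grid k D" and th: "\<theta> \<in> slopes k l D"
    and y: "y \<in> tubekey k l D \<theta> ` E" and b: "b \<in> {0..<int D}"
  shows "tcell k l D \<theta> (y, b) \<in> cells k D"
proof -
  obtain e where e: "e \<in> E" "y = tubekey k l D \<theta> e" using y by auto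
  note r = tubekey_range[OF kl D subsetD[OF E e(1)] th, folded e(2)]
  have "y i + (\<theta> i * b) div int D \<in> {- int D..<2 * int D}" if i: "i \<noteq> k" "i \<noteq> l" for i
  proof -
    have t: "0 \<le> \<theta> i" "\<theta> i < int D" using th i by (auto simp: slopes_def PiE_def Pi_def)
    show ?thesis using slope_div_range[OF D t, of b] r(3)[OF i] b by auto
  qed
  then show ?thesis using r(2) b kl by (auto simp: cells_def tcell_def)
qed

lemma card_tcells:
  assumes kl: "k \<noteq> l" and D: "D > 0" and E: "E \<subseteq> grid k D" and th: "\<theta> \<in> slopes k l D"
    and Y: "Y \<subseteq> tubekey k l D \<theta> ` E"
  shows "card (tcell k l D \<theta> ` (Y \<times> {0..<int D})) = card Y * D"
proof -
  have "inj_on (tcell k l D \<theta>) (Y \<times> {0..<int D})"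
  proof (rule inj_onI, clarify)
    fix y b y' b' assume y: "y \<in> Y" "y' \<in> Y" and eq: "tcell k l D \<theta> (y, b) = tcell k l D \<theta> (y', b')"
    have b: "b = b'" using fun_cong[OF eq, of l] by (simp add: tcell_def)
    have "y i = y' i" for i
    proof (cases "i = l")
      case True
      have "y l = 0" "y' l = 0" using y Y tubekey_range(1)[OF kl D _ th] E by blast+
      then show ?thesis using True by simp
    next
      case False
      then show ?thesis using fun_cong[OF eq, of i] b by (cases "i = k") (auto simp: tcell_def)
    qed
    then show "y = y' \<and> b = b'" using b by auto
  qed
  then have "card (tcell k l D \<theta> ` (Y \<times> {0..<int D})) = card (Y \<times> {0..<int D})" by (rule card_image)
  then show ?thesis by (simp add: card_cartesian_product)
qed

lemma card_cells_le:
  fixes k :: "'n::finite"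
  shows "real (card (cells k D)) \<le> (3 * real D) ^ (CARD('n) - 1)"
proof -
  define PP where "PP = Pi\<^sub>E (UNIV - {k}) (\<lambda>_. {- int D..<2 * int D})"
  define ex where "ex p = (\<lambda>i. if i = k then (int D - 1) div 2 else p i)" for p :: "'n \<Rightarrow> int"
  have "finite PP" by (simp add: PP_def finite_PiE)
  moreover have "cells k D \<subseteq> ex ` PP"
  proof
    fix f assume f: "f \<in> cells k D"
    have "restrict f (UNIV - {k}) \<in> PP" unfolding PP_def using cells_range[OF f] by (auto intro!: restrict_PiE_iff[THEN iffD2])
    moreover have "f = ex (restrict f (UNIV - {k}))" using f by (auto simp: ex_def fun_eq_iff cells_def)
    ultimately show "f \<in> ex ` PP" by blast
  qed
  ultimately have "card (cells k D) \<le> card PP" by (rule surj_card_le)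
  also have "card PP = (3 * D) ^ (CARD('n) - 1)"
    by (simp add: PP_def card_PiE card_Diff_subset nat_mult_distrib)
  finally show ?thesis by (metis of_nat_le_iff of_nat_mult of_nat_numeral of_nat_power)
qed

lemma tube_small:
  fixes U :: "real^'n::finite \<Rightarrow> real"
  assumes U: "harmonic_on S U" and S: "ball 0 \<rho> \<subseteq> S" and rho: "\<rho> \<ge> 21 * taylor_const TYPE('n)"
    and B: "\<And>y. y \<in> ball 0 \<rho> \<Longrightarrow> norm (gradient U y) \<le> B"
    and kl: "k \<noteq> l" and D: "D > 0" and E: "E \<subseteq> grid k D" and th: "\<theta> \<in> slopes k l D"
    and y: "y \<in> tubekey k l D \<theta> ` E" and b: "b \<in> {0..<int D}"
    and W: "W \<ge> 0" and C: "C \<ge> 0"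
    and sm: "\<And>e q. e \<in> E \<Longrightarrow> q \<in> ball (cell_center D e) ((\<kappa> + real CARD('n) + 2 * taylor_const TYPE('n)) / real D) \<Longrightarrow>
        norm (gradient U q) \<le> B * exp (- W)"
    and E': "E' \<subseteq> {e\<in>E. tubekey k l D \<theta> e = y}" "E' \<noteq> {}" "finite E'"
    and pot: "\<And>e. e \<in> E' \<Longrightarrow> (\<Sum>e'\<in>E'. log_kernel l D e e') \<le> C * real (card E')"
    and kap: "0 \<le> \<kappa>" "\<kappa> / real D \<le> 1"
    and q: "q \<in> ball (cell_center D (tcell k l D \<theta> (y, b))) (\<kappa> / real D)"
  shows "norm (gradient U q) \<le> 2 * real CARD('n) * B * exp (- line_expo C * W)"
proof -
  let ?n = "real CARD('n)" and ?K = "taylor_const TYPE('n)"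
  define f where "f = tcell k l D \<theta> (y, b)"
  have K: "?K \<ge> 6" "?K \<ge> 6 * ?n" by (rule taylor_const_ge)+
  have n: "?n \<ge> 1" by (rule card_ge_1)
  have f: "f \<in> cells k D" unfolding f_def by (rule tcell_cells[OF kl D E th y b])
  have th': "0 \<le> \<theta> i" "\<theta> i < int D" if "i \<noteq> k" "i \<noteq> l" for i
    using th that by (auto simp: slopes_def PiE_def Pi_def)
  define w :: "real^'n" where "w = (\<chi> i. if i = l then 1 else if i = k then 0 else of_int (\<theta> i) / real D)"
  have w: "\<bar>w $ i\<bar> \<le> 1" for i
  proof -
    have "\<bar>real_of_int (\<theta> i) / real D\<bar> \<le> 1" if "i \<noteq> k" "i \<noteq> l"
      using th'[OF that] D by (simp add: abs_divide divide_le_eq)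
    then show ?thesis by (simp add: w_def)
  qed
  define \<tau> where "\<tau> e = cell_center D e $ l" for e
  define p where "p = q - \<tau> f *\<^sub>R w"
  have tau_diff: "\<tau> e - \<tau> e' = (of_int (e l) - of_int (e' l)) / real D" for e e'
    by (simp add: \<tau>_def cell_center_def diff_divide_distrib add_divide_distrib)
  have fl: "f l = b" by (simp add: f_def tcell_def)
  have key: "tubekey k l D \<theta> e = y" "e \<in> E" "e \<in> grid k D" if "e \<in> E'" for e using E'(1) E that by auto
  have ei: "e i = y i + (\<theta> i * e l) div int D" if "e \<in> E'" "i \<noteq> k" "i \<noteq> l" for e i
    using fun_cong[OF key(1)[OF that(1)], of i] that by (simp add: tubekey_def)
  \<comment> \<open>Along a tube the cell centres follow a line of direction \<open>w\<close> only
    up to rounding, by less than one cell in each coordinate. This is the origin of the summand n in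
    the radius required around bad cells.\<close>
  have close: "norm (cell_center D e - cell_center D f - (\<tau> e - \<tau> f) *\<^sub>R w) \<le> ?n * (1 / real D)" if e: "e \<in> E'" for e
  proof (rule norm_le_card)
    fix i
    have c: "(cell_center D e - cell_center D f) $ i = (of_int (e i) - of_int (f i)) / real D"
      by (simp add: cell_center_def diff_divide_distrib add_divide_distrib)
    consider "i = l" | "i = k" "i \<noteq> l" | "i \<noteq> k" "i \<noteq> l" by auto
    then show "\<bar>(cell_center D e - cell_center D f - (\<tau> e - \<tau> f) *\<^sub>R w) $ i\<bar> \<le> 1 / real D"
    proof cases
      case 1
      then have "(cell_center D e - cell_center D f - (\<tau> e - \<tau> f) *\<^sub>R w) $ i = 0"
        by (simp add: w_def \<tau>_def)
      then show ?thesis by simp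
    next
      case 2
      have "e k = f k" using key(3)[OF e] f by (simp add: grid_def cells_def)
      then have "(cell_center D e - cell_center D f - (\<tau> e - \<tau> f) *\<^sub>R w) $ i = 0" using 2 by (simp add: w_def cell_center_def)
      then show ?thesis by simp
    next
      case 3
      define A where "A = (\<theta> i * e l) div int D - (\<theta> i * b) div int D"
      have "f i = y i + (\<theta> i * b) div int D" using 3 by (simp add: f_def tcell_def)
      then have ef: "of_int (e i) - of_int (f i) = real_of_int A" using ei[OF e 3] by (simp add: A_def)
      have "\<bar>A * int D - (\<theta> i * e l - \<theta> i * b)\<bar> < int D"
        unfolding A_def by (rule div_diff_bound) (use D in simp)
      then have "real_of_int \<bar>A * int D - (\<theta> i * e l - \<theta> i * b)\<bar> \<le> real_of_int (int D)"
        by (simp only: of_int_le_iff)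
      then have b1: "\<bar>real_of_int A * real D - of_int (\<theta> i) * (of_int (e l) - of_int b)\<bar> \<le> real D"
        by (simp add: right_diff_distrib)
      have "(cell_center D e - cell_center D f - (\<tau> e - \<tau> f) *\<^sub>R w) $ i =
          real_of_int A / real D - (of_int (e l) - of_int b) / real D * (of_int (\<theta> i) / real D)"
        using 3 c by (simp add: ef tau_diff fl w_def)
      also have "\<dots> = (real_of_int A * real D - of_int (\<theta> i) * (of_int (e l) - of_int b)) / (real D * real D)"
        using D by (simp add: field_simps)
      also have "\<bar>\<dots>\<bar> \<le> real D / (real D * real D)" unfolding abs_divide by (rule order_trans[OF eq_refl divide_right_mono[OF b1, of "real D * real D"]]) auto
      also have "\<dots> = 1 / real D" by simp
      finally show ?thesis .
    qed
  qed
  have ncc: "norm (cell_center D f) \<le> ?n * (3/2)" by (rule norm_le_card) (rule cell_center_bound[OF f D])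
  have t32: "\<bar>\<tau> f\<bar> \<le> 3/2" unfolding \<tau>_def by (rule cell_center_bound[OF f D])
  have "norm p \<le> ?K"
  proof -
    have "norm w \<le> ?n" using norm_le_card[of w 1] w by simp
    then have "\<bar>\<tau> f\<bar> * norm w \<le> 3/2 * ?n" by (intro mult_mono t32) auto
    then have "norm (\<tau> f *\<^sub>R w) \<le> 3/2 * ?n" by simp
    then have "norm p \<le> norm q + 3/2 * ?n" unfolding p_def using norm_triangle_ineq4[of q "\<tau> f *\<^sub>R w"] by linarith
    moreover have "norm q \<le> norm (cell_center D f) + dist (cell_center D f) q"
      using norm_triangle_sub[of q "cell_center D f"] by (simp add: dist_norm norm_minus_commute)
    moreover have "dist (cell_center D f) q < 1" using q kap by (simp add: f_def)
    ultimately show ?thesis using ncc K n by linarith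
  qed
  then have sub: "ball p (20 * ?K) \<subseteq> ball 0 \<rho>"
    using rho K by (intro ball_subset_ball_iff[THEN iffD2]) (simp add: dist_norm)
  have inj: "inj_on \<tau> E'"
  proof (rule inj_onI)
    fix e e' assume e: "e \<in> E'" "e' \<in> E'" "\<tau> e = \<tau> e'"
    have l: "e l = e' l" using tau_diff[of e e'] e(3) D by simp
    have "e i = e' i" for i
      using ei[OF e(1), of i] ei[OF e(2), of i] l key(3)[OF e(1)] key(3)[OF e(2)]
      by (cases "i = k \<or> i = l") (auto simp: grid_def)
    then show "e = e'" by auto
  qed
  define T where "T = \<tau> ` E'"
  have cT: "card T = card E'" by (simp add: T_def card_image[OF inj])
  have pd: "\<bar>partial_deriv j U q\<bar> \<le> 2 * B * exp (- line_expo C * W)" for j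
  proof -
    define v where "v = partial_deriv j U"
    have v: "harmonic_on S v" unfolding v_def by (rule harmonic_partial(1)[OF U])
    have "\<bar>(dder S w ^^ 0) v (p + \<tau> f *\<^sub>R w) / fact 0\<bar> \<le> 2 * B * exp (- line_expo C * W)"
    proof (rule line_smallness[OF v _ _ w _ _ _ _ _ _ W C])
      show "ball p (20 * ?K) \<subseteq> S" using sub S by blast
      show "\<bar>v z\<bar> \<le> B" if "z \<in> ball p (20 * ?K)" for z
        using order_trans[OF partial_le_gradient B] sub that unfolding v_def by blast
      show "finite T" "T \<noteq> {}" using E' by (auto simp: T_def)
      show "\<bar>s\<bar> \<le> 2" if s: "s \<in> T" for s
      proof -
        obtain e where e: "e \<in> E'" "s = \<tau> e" using s by (auto simp: T_def)
        have "0 \<le> e l" "e l < int D" using key(3)[OF e(1)] kl by (auto simp: grid_def)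
        then have "0 \<le> real_of_int (e l)" "real_of_int (e l) + 1 \<le> real D" by linarith+
        then have "0 \<le> (real_of_int (e l) + 1/2) / real D" "(real_of_int (e l) + 1/2) / real D \<le> 1"
          using D by (auto simp: divide_le_eq)
        then show ?thesis unfolding e(2) \<tau>_def cell_center_def vec_lambda_beta by linarith
      qed
      show "0 < 1 / real D" "1 / real D \<le> 1" using D by auto
      show "\<bar>\<tau> f\<bar> \<le> 2" using t32 by simp
      show "\<bar>v z\<bar> \<le> B * exp (- W)" if s: "s \<in> T" and z: "z \<in> ball (p + s *\<^sub>R w) (2 * ?K * (1 / real D))" for s z
      proof -
        obtain e where e: "e \<in> E'" "s = \<tau> e" using s by (auto simp: T_def)
        have "cell_center D e - (p + s *\<^sub>R w) = (cell_center D e - cell_center D f - (\<tau> e - \<tau> f) *\<^sub>R w) + (cell_center D f - q)"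
          by (simp add: p_def e algebra_simps)
        then have "norm (cell_center D e - (p + s *\<^sub>R w)) \<le> norm (cell_center D e - cell_center D f - (\<tau> e - \<tau> f) *\<^sub>R w) + norm (cell_center D f - q)"
          by (simp only: norm_triangle_ineq)
        moreover have "norm (cell_center D f - q) < \<kappa> / real D" using q by (simp add: f_def dist_norm)
        ultimately have "dist (cell_center D e) (p + s *\<^sub>R w) < ?n * (1 / real D) + \<kappa> / real D"
          using close[OF e(1)] unfolding dist_norm by linarith
        then have "dist (cell_center D e) z < ?n * (1 / real D) + \<kappa> / real D + 2 * ?K * (1 / real D)"
          using z dist_triangle[of "cell_center D e" z "p + s *\<^sub>R w"] by simp
        also have "\<dots> = (\<kappa> + ?n + 2 * ?K) / real D" by (simp add: add_divide_distrib)
        finally have "z \<in> ball (cell_center D e) ((\<kappa> + ?n + 2 * ?K) / real D)" by simp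
        from order_trans[OF partial_le_gradient sm[OF key(2)[OF e(1)] this]] show ?thesis by (simp add: v_def)
      qed
      show "(\<Sum>s\<in>T. ln (1 / max \<bar>s - r\<bar> (1 / real D))) \<le> C * real (card T)" if r: "r \<in> T" for r
      proof -
        obtain e where e: "e \<in> E'" "r = \<tau> e" using r by (auto simp: T_def)
        have "(\<Sum>s\<in>T. ln (1 / max \<bar>s - r\<bar> (1 / real D))) = (\<Sum>e'\<in>E'. ln (1 / max \<bar>\<tau> e' - \<tau> e\<bar> (1 / real D)))"
          unfolding T_def e by (simp add: sum.reindex[OF inj])
        also have "\<dots> \<le> (\<Sum>e'\<in>E'. log_kernel l D e e')"
        proof (rule sum_mono)
          fix e' assume "e' \<in> E'"
          have "\<bar>\<tau> e' - \<tau> e\<bar> = real_of_int \<bar>e l - e' l\<bar> / real D"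
            unfolding tau_diff by (simp add: abs_divide abs_minus_commute)
          moreover have "max (real_of_int \<bar>e l - e' l\<bar> / real D) (1 / real D) = max (real_of_int \<bar>e l - e' l\<bar>) 1 / real D"
            using D by (simp add: max_def divide_le_cancel)
          ultimately show "ln (1 / max \<bar>\<tau> e' - \<tau> e\<bar> (1 / real D)) \<le> log_kernel l D e e'" by (simp add: log_kernel_def)
        qed
        also have "\<dots> \<le> C * real (card E')" by (rule pot[OF e(1)])
        finally show ?thesis by (simp add: cT)
      qed
    qed
    then show ?thesis by (simp add: p_def v_def)
  qed
  have "norm (gradient U q) \<le> (\<Sum>j\<in>(UNIV::'n set). 2 * B * exp (- line_expo C * W))"
    by (rule order_trans[OF gradient_le_sum_partial sum_mono[OF pd]])
  then show ?thesis by simp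
qed

text \<open>The logarithm is the requirement of \<open>growth_smallness\<close>; the summand 1
  ensures \<open>N \<ge> 1\<close>, so that constants without a factor N can be absorbed at the
  end.\<close>

definition N_min :: "'n::finite itself \<Rightarrow> real" where
  "N_min T = 1 + 2 * ln (4 * real CARD('n))"

text \<open>In multiples of \<open>taylor_const\<close>: 20 for \<open>line_smallness\<close>, one
  for the base points of the lines, one for each coordinate sweep, and one spare.\<close>

definition R_big :: "'n::finite itself \<Rightarrow> real" where
  "R_big T = (22 + real CARD('n)) * taylor_const T"

lemma gradient_continuous:
  assumes "harmonic_on S U" shows "continuous_on S (\<lambda>y. norm (gradient U y))"
  unfolding gradient_def
  by (intro continuous_intros harmonic_continuous harmonic_partial(1)[OF assms])

text \<open>Everything is normalized to the unit cube with bad cells of side 3^-L. The threshold is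
  chosen before \<open>N\<close> and \<open>U\<close>, which is what makes it usable after
  rescaling. Badness and doubling enter as pointwise inequalities without suprema.\<close>

lemma core_contradiction:
  assumes n2: "CARD('n::finite) \<ge> 2" and \<delta>: "\<delta> > 0"
  shows "\<exists>L0 :: nat. \<forall>L N (U :: real^'n \<Rightarrow> real) S E k. L \<ge> L0 \<longrightarrow> N > N_min TYPE('n) \<longrightarrow> harmonic_on S U \<longrightarrow>
     cball 0 (R_big TYPE('n)) \<subseteq> S \<longrightarrow> finite E \<longrightarrow> E \<noteq> {} \<longrightarrow> E \<subseteq> grid k (3 ^ L) \<longrightarrow>
     frostman (real CARD('n) - 2 + \<delta>) L E \<longrightarrow>
     (\<forall>e\<in>E. \<exists>x r y. (\<forall>i. \<bar>x $ i - cell_center (3 ^ L) e $ i\<bar> \<le> 1 / 3 ^ L) \<and> 0 < r \<and> r \<le> 1 / 3 ^ L \<and>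
         y \<in> ball x (10 * real CARD('n) * r) \<and> (\<forall>z\<in>ball x r. exp N * norm (gradient U z) < norm (gradient U y))) \<longrightarrow>
     (\<forall>r M. 0 < r \<longrightarrow> r \<le> R_big TYPE('n) \<longrightarrow> (\<forall>z\<in>ball 0 r. norm (gradient U z) \<le> M) \<longrightarrow>
         (\<forall>z\<in>ball 0 (10 * real CARD('n) * r). norm (gradient U z) \<le> exp (2 * N) * M)) \<longrightarrow> False"
proof -
  let ?n = "real CARD('n)" and ?K = "taylor_const TYPE('n)"
  have n: "?n \<ge> 2" using n2 by simp
  have K: "?K \<ge> 6" "?K \<ge> 6 * ?n" by (rule taylor_const_ge)+
  define \<rho> where "\<rho> = R_big TYPE('n)"
  have rho: "\<rho> \<ge> (21 + ?n) * ?K" "\<rho> \<ge> 21 * ?K" "\<rho> > 21 * ?K + ?K"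
    using K n by (auto simp: \<rho>_def R_big_def algebra_simps add_pos_nonneg)
  define \<tau> where "\<tau> = 1 / (2 * ?n)"
  have tau: "\<tau> > 0" "\<tau> < 1" using n by (auto simp: \<tau>_def)
  \<comment> \<open>Number of doublings that lead from the ball of radius \<open>\<tau>\<close>, the
    range of \<open>hyperplane_propagation\<close>, beyond radius \<open>\<rho>\<close>. It depends
    on the dimension only.\<close>
  obtain J where J: "\<rho> / \<tau> < (10 * ?n) ^ J"
    using real_arch_pow[of "10 * ?n" "\<rho> / \<tau>"] n by auto
  \<comment> \<open>Radii in units of the cell side: \<open>hyperplane_propagation\<close> needs
    smallness at radius \<open>\<kappa>1\<close> around tube cells, and \<open>tube_small\<close>
    provides it from radius \<open>\<kappa>E\<close> around bad cells.\<close>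
  define \<kappa>1 where "\<kappa>1 = ?n + 1 + 2 * ?K * ?n"
  define \<kappa>E where "\<kappa>E = \<kappa>1 + ?n + 2 * ?K"
  have nK: "?K * ?n \<ge> 12" using mult_mono[OF K(1) n] K by simp
  have kap: "\<kappa>1 \<ge> 1" "\<kappa>E \<ge> \<kappa>1" using n K nK by (auto simp: \<kappa>1_def \<kappa>E_def)
  \<comment> \<open>\<open>\<Gamma> / D\<close> is the base of the power in
    \<open>growth_smallness\<close> at radius \<open>(\<kappa>E + 21 * ?n) / D\<close>. That radius
    covers the offset of at most \<open>?n / D\<close> between the bad point and the cell centre,
    and is at least \<open>20 * ?n * r\<close> for \<open>r \<le> 1 / D\<close>.\<close>
  define \<Gamma> where "\<Gamma> = 2 * ?K * (\<kappa>E + 21 * ?n)"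
  have Gam: "\<Gamma> \<ge> 12 * \<kappa>E" "\<Gamma> \<ge> 1"
  proof -
    have "12 * (\<kappa>E + 21 * ?n) \<le> \<Gamma>" unfolding \<Gamma>_def using K n kap by (intro mult_right_mono) auto
    then have "12 * \<kappa>E + 252 * ?n \<le> \<Gamma>" by (simp add: distrib_left)
    then show "\<Gamma> \<ge> 12 * \<kappa>E" using n by linarith
    then show "\<Gamma> \<ge> 1" using kap by linarith
  qed
  define C where "C = 32 * tube_const TYPE('n) \<delta>"
  have C: "C > 0" using tube_const_pos[OF \<delta>, where 'n='n] by (simp add: C_def)
  \<comment> \<open>Proportion of tube cells: \<open>D\<close> cells in each of at least (2 D)^(n-2)
    / (16 \<open>tube_const\<close>) tubes, against at most (3 D)^(n-1) cells in all.\<close>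
  define c where "c = 2 ^ (CARD('n) - 2) / (16 * tube_const TYPE('n) \<delta> * 3 ^ (CARD('n) - 1))"
  have c: "c > 0" using tube_const_pos[OF \<delta>, where 'n='n] by (simp add: c_def)
  \<comment> \<open>Product of the three exponents lost on the way, times ln 3 because
    \<open>D = 3 ^ L\<close>, halved by the choice of \<open>L1\<close>.\<close>
  define \<gamma> where "\<gamma> = sweep_expo (CARD('n) - 1) c * line_expo C * rate TYPE('n) * ln 3 / 2"
  have gam0: "sweep_expo (CARD('n) - 1) c > 0" by (rule sweep_expo_pos[OF c])
  have expo0: "line_expo C > 0" by (rule line_expo_pos) (use C in simp)
  have rate0: "rate TYPE('n) > 0" by (rule rate_pos)
  have \<gamma>: "\<gamma> > 0" unfolding \<gamma>_def using gam0 expo0 rate0 by simp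
  \<comment> \<open>Prefactor of \<open>hyperplane_propagation\<close> times \<open>2 * ?n\<close>
    from \<open>growth_smallness\<close> and \<open>2 * ?n\<close> from
    \<open>tube_small\<close>.\<close>
  define C5 where "C5 = 2 * ?n ^ 2 * 2 ^ CARD('n) * (2 * ?n * (2 * ?n))"
  have p1: "1 \<le> 2 * ?n ^ 2" using one_le_power[of ?n 2] n by linarith
  have p2: "(1::real) \<le> 2 ^ CARD('n)" by (rule one_le_power) simp
  have p3: "1 * 1 \<le> 2 * ?n * (2 * ?n)" by (rule mult_mono) (use n in auto)
  have "1 * 1 * (1 * 1) \<le> 2 * ?n ^ 2 * 2 ^ CARD('n) * (2 * ?n * (2 * ?n))"
    by (intro mult_mono p1 p2 p3) (use p1 p2 n in auto)
  then have C5: "C5 \<ge> 1" by (simp add: C5_def)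
  \<comment> \<open>With \<open>\<Gamma> ^ 2 \<le> D\<close> the base \<open>\<Gamma> / D\<close> is
    at most \<open>D powr (- 1/2)\<close>: the constant \<open>\<Gamma>\<close> costs half of the
    exponent and disappears.\<close>
  obtain L1 where L1: "\<Gamma> ^ 2 < 3 ^ L1" using real_arch_pow[of 3 "\<Gamma> ^ 2"] by auto
  obtain L2 :: nat where L2: "(2 * real J + ln C5) / \<gamma> < real L2" using reals_Archimedean2 by blast
  show ?thesis
  proof (rule exI[of _ "Suc (L1 + L2)"], intro allI impI)
    fix L N and U :: "real^'n \<Rightarrow> real" and S and E :: "('n \<Rightarrow> int) set" and k :: 'n
    assume L: "L \<ge> Suc (L1 + L2)" and N: "N > N_min TYPE('n)" and U: "harmonic_on S U"
      and S: "cball 0 (R_big TYPE('n)) \<subseteq> S" and E: "finite E" "E \<noteq> {}" "E \<subseteq> grid k (3 ^ L)"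
      and fr: "frostman (real CARD('n) - 2 + \<delta>) L E"
      and bad0: "\<forall>e\<in>E. \<exists>x r y. (\<forall>i. \<bar>x $ i - cell_center (3 ^ L) e $ i\<bar> \<le> 1 / 3 ^ L) \<and> 0 < r \<and> r \<le> 1 / 3 ^ L \<and>
         y \<in> ball x (10 * real CARD('n) * r) \<and> (\<forall>z\<in>ball x r. exp N * norm (gradient U z) < norm (gradient U y))"
      and dbl0: "\<forall>r M. 0 < r \<longrightarrow> r \<le> R_big TYPE('n) \<longrightarrow> (\<forall>z\<in>ball 0 r. norm (gradient U z) \<le> M) \<longrightarrow>
         (\<forall>z\<in>ball 0 (10 * real CARD('n) * r). norm (gradient U z) \<le> exp (2 * N) * M)"
    note bad = bad0[rule_format] and dbl = dbl0[rule_format]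
    define D :: nat where "D = 3 ^ L"
    have D0: "D > 0" "odd D" by (auto simp: D_def)
    have ln4: "ln (4 * ?n) \<ge> 0" using n by simp
    have N1: "N \<ge> 1" "N \<ge> 2 * ln (4 * ?n)" using N ln4 unfolding N_min_def by linarith+
    have DG: "\<Gamma> ^ 2 \<le> real D"
    proof -
      have "(3::real) ^ L1 \<le> 3 ^ L" using L by (intro power_increasing) auto
      moreover have "real D = 3 ^ L" by (simp add: D_def)
      ultimately show ?thesis using L1 by linarith
    qed
    have GG: "\<Gamma> \<le> \<Gamma> ^ 2" using self_le_power[of \<Gamma> 2] Gam by simp
    have D\<Gamma>: "\<Gamma> \<le> real D" using DG GG by linarith
    have kD: "\<kappa>E / real D \<le> 1" "\<kappa>1 / real D \<le> 1" using D\<Gamma> Gam kap D0 by (auto simp: divide_le_eq)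
    have small_sc: "\<Gamma> / real D < 1"
    proof -
      have "12 \<le> \<Gamma>" using Gam kap by linarith
      then have "\<Gamma> * 1 < \<Gamma> * \<Gamma>" by (intro mult_strict_left_mono) auto
      then show ?thesis using DG D0 by (simp add: power2_eq_square divide_less_eq)
    qed
    have "compact (cball (0::real^'n) \<rho>)" by simp
    moreover have "cball (0::real^'n) \<rho> \<noteq> {}" using rho K by simp
    moreover have "continuous_on (cball 0 \<rho>) (\<lambda>y. norm (gradient U y))"
      using continuous_on_subset[OF gradient_continuous[OF U]] S by (simp add: \<rho>_def)
    ultimately obtain ym where ym: "ym \<in> cball 0 \<rho>" "\<And>y. y \<in> cball 0 \<rho> \<Longrightarrow> norm (gradient U y) \<le> norm (gradient U ym)"
      using continuous_attains_sup by meson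
    \<comment> \<open>Normalization by the maximum over the closed ball. Being attained, it can be
      compared with itself once smallness has reached that ball.\<close>
    define B where "B = norm (gradient U ym)"
    have B: "norm (gradient U y) \<le> B" if "y \<in> ball 0 \<rho>" for y using ym(2)[of y] that by (simp add: B_def)
    have Sb: "ball 0 \<rho> \<subseteq> S" using S ball_subset_cball by (force simp: \<rho>_def)
    have B0: "B \<ge> 0" by (simp add: B_def)
    have ncc: "norm (cell_center D e) \<le> ?n * (3/2)" if "e \<in> E" for e
    proof (rule norm_le_card)
      have "e \<in> cells k D" using E(3) that by (force simp: grid_def cells_def D_def)
      then show "\<bar>cell_center D e $ i\<bar> \<le> 3/2" for i by (rule cell_center_bound) (rule D0)
    qed
    have badx: "\<exists>x r y. norm (x - cell_center D e) \<le> ?n / real D \<and> 0 < r \<and> r \<le> 1 / real D \<and> y \<in> ball x (10 * ?n * r) \<and>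
        (\<forall>z\<in>ball x r. exp N * norm (gradient U z) < norm (gradient U y)) \<and> ball x 1 \<subseteq> ball 0 \<rho>" if e: "e \<in> E" for e
    proof -
      obtain x r y where xy: "\<And>i. \<bar>x $ i - cell_center (3 ^ L) e $ i\<bar> \<le> 1 / 3 ^ L" "0 < r" "r \<le> 1 / 3 ^ L"
         "y \<in> ball x (10 * real CARD('n) * r)" "\<forall>z\<in>ball x r. exp N * norm (gradient U z) < norm (gradient U y)"
        using bad[OF e] by blast
      have "norm (x - cell_center D e) \<le> ?n * (1 / real D)"
        by (rule norm_le_card) (use xy(1) in \<open>simp add: D_def\<close>)
      then have xc: "norm (x - cell_center D e) \<le> ?n / real D" by simp
      also have "\<dots> \<le> ?n" using D0 by (simp add: divide_le_eq)
      finally have "norm x \<le> ?n * (3/2) + ?n" using ncc[OF e] norm_triangle_sub[of x "cell_center D e"] by linarith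
      then have "norm x + 1 \<le> \<rho>" using rho K n by linarith
      then have "ball x 1 \<subseteq> ball 0 \<rho>" by (intro ball_subset_ball_iff[THEN iffD2]) (simp add: dist_norm)
      then show ?thesis using xc xy by (intro exI[of _ x] exI[of _ r] exI[of _ y]) (auto simp: D_def)
    qed
    have Bpos: "B > 0"
    proof -
      obtain e where e: "e \<in> E" using E by auto
      obtain x r y where xy: "norm (x - cell_center D e) \<le> ?n / real D" "0 < r" "r \<le> 1 / real D" "y \<in> ball x (10 * ?n * r)"
        "\<forall>z\<in>ball x r. exp N * norm (gradient U z) < norm (gradient U y)" "ball x 1 \<subseteq> ball 0 \<rho>"
        using badx[OF e] by blast
      have "10 * ?n * r \<le> 1"
      proof -
        have "10 * ?n \<le> \<Gamma>" using Gam kap n nK by (simp add: \<kappa>E_def \<kappa>1_def)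
        then have "10 * ?n / real D \<le> 1" using D\<Gamma> D0 by (simp add: divide_le_eq)
        moreover have "10 * ?n * r \<le> 10 * ?n * (1 / real D)" using xy(3) n by (intro mult_left_mono) auto
        ultimately show ?thesis by simp
      qed
      then have "y \<in> ball 0 \<rho>" using xy(4,6) by (auto simp: subset_iff)
      moreover have "0 < norm (gradient U y)"
      proof -
        have "0 \<le> exp N * norm (gradient U x)" by simp
        also have "\<dots> < norm (gradient U y)" using xy(2,5) by simp
        finally show ?thesis .
      qed
      ultimately show ?thesis using B[of y] by linarith
    qed
    define W where "W = rate TYPE('n) * N * (real L * ln 3) / 2"
    have W0: "W \<ge> 0" using rate0 N1 by (simp add: W_def)
    define B1 where "B1 = 2 * ?n * B"
    have B1: "B \<le> B1" using mult_right_mono[of 1 "2 * ?n" B] n B0 by (simp add: B1_def)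
    have smE: "norm (gradient U q) \<le> B1 * exp (- W)" if e: "e \<in> E" and q: "q \<in> ball (cell_center D e) (\<kappa>E / real D)" for e q
    proof -
      obtain x r y where xy: "norm (x - cell_center D e) \<le> ?n / real D" "0 < r" "r \<le> 1 / real D" "y \<in> ball x (10 * ?n * r)"
        "\<forall>z\<in>ball x r. exp N * norm (gradient U z) < norm (gradient U y)" "ball x 1 \<subseteq> ball 0 \<rho>"
        using badx[OF e] by blast
      define s where "s = (\<kappa>E + 21 * ?n) / real D"
      have sG: "2 * ?K * s = \<Gamma> / real D" by (simp add: s_def \<Gamma>_def)
      have "norm (gradient U q) \<le> 2 * ?n * B * (2 * ?K * s / 1) powr (rate TYPE('n) * N)"
      proof (rule growth_smallness[OF U _ _ xy(2,4) _ N1(2)])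
        show "ball x 1 \<subseteq> S" using xy(6) Sb by blast
        show "norm (gradient U z) \<le> B" if "z \<in> ball x 1" for z using B xy(6) that by blast
        show "exp N * norm (gradient U z) < norm (gradient U y)" if "z \<in> ball x r" for z using xy(5) that by blast
        have "20 * ?n * r \<le> 20 * ?n * (1 / real D)" using xy(3) n by (intro mult_left_mono) auto
        also have "\<dots> \<le> s" using D0 kap n unfolding s_def by (simp add: divide_right_mono)
        finally show "20 * ?n * r \<le> s" .
        show "2 * ?K * s < 1" unfolding sG by (rule small_sc)
        have "dist x q \<le> dist (cell_center D e) x + dist (cell_center D e) q" by (rule dist_triangle3)
        also have "dist (cell_center D e) x \<le> ?n / real D" using xy(1) by (simp add: dist_norm norm_minus_commute)
        also have "dist (cell_center D e) q < \<kappa>E / real D" using q by simp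
        finally have "dist x q < ?n / real D + \<kappa>E / real D" by simp
        also have "\<dots> \<le> s" using n by (simp add: s_def add_divide_distrib[symmetric] divide_right_mono)
        finally show "q \<in> ball x s" by simp
      qed
      also have "(2 * ?K * s / 1) powr (rate TYPE('n) * N) \<le> exp (- W)"
      proof -
        have G1: "\<Gamma> / real D \<le> real D powr (- 1/2)"
        proof -
          have "\<Gamma> \<le> sqrt (real D)" using DG by (rule real_le_rsqrt)
          then have "\<Gamma> / real D \<le> sqrt (real D) / real D" by (rule divide_right_mono) simp
          also have "\<dots> = real D powr (1/2) / real D powr 1" using D0 by (simp add: powr_half_sqrt)
          also have "\<dots> = real D powr (- 1/2)" by (subst powr_diff[symmetric]) simp
          finally show ?thesis .
        qed
        have "(\<Gamma> / real D) powr (rate TYPE('n) * N) \<le> (real D powr (- 1/2)) powr (rate TYPE('n) * N)"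
          using G1 Gam rate0 N1 by (intro powr_mono2) auto
        also have "\<dots> = exp (- W)" using D0
          by (simp add: powr_powr powr_def W_def D_def ln_realpow)
        finally show ?thesis by (simp add: sG)
      qed
      finally show ?thesis using n B0 by (simp add: B1_def mult_left_mono)
    qed
    obtain l where l: "l \<noteq> k"
    proof -
      have "\<exists>l. l \<noteq> k"
      proof (rule ccontr)
        assume "\<not> (\<exists>l. l \<noteq> k)"
        then have "(UNIV::'n set) = {k}" by auto
        then have "CARD('n) = card {k}" by (rule arg_cong)
        then show False using n2 by simp
      qed
      then show thesis using that by blast
    qed
    obtain \<theta> Y where th: "\<theta> \<in> slopes k l D" and Y: "Y \<subseteq> tubekey k l D \<theta> ` E"
      and cY: "real (card Y) \<ge> (2 * real D) ^ (CARD('n) - 2) / (16 * tube_const TYPE('n) \<delta>)"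
      and Yp: "\<And>y. y \<in> Y \<Longrightarrow> \<exists>E'. E' \<subseteq> {e\<in>E. tubekey k l D \<theta> e = y} \<and> E' \<noteq> {} \<and>
        (\<forall>e\<in>E'. (\<Sum>e'\<in>E'. log_kernel l D e e') \<le> C * real (card E'))"
      using tube_selection[OF n2 l[symmetric] D_def _ E(1,2) E(3)[folded D_def] fr \<delta>] L unfolding C_def by auto
    define F where "F = tcell k l D \<theta> ` (Y \<times> {0..<int D})"
    have Fc: "F \<subseteq> cells k D"
      unfolding F_def using tcell_cells[OF l[symmetric] D0(1) E(3)[folded D_def] th] Y by auto
    have cF: "c * real (card (cells k D)) \<le> real (card F)"
    proof -
      have pw: "real D ^ (CARD('n) - 1) = real D ^ (CARD('n) - 2) * real D"
      proof -
        have "CARD('n) - 1 = Suc (CARD('n) - 2)" using n2 by simp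
        then show ?thesis by simp
      qed
      have "c * real (card (cells k D)) \<le> c * (3 * real D) ^ (CARD('n) - 1)"
        using c card_cells_le[of k D] by (intro mult_left_mono) auto
      also have "\<dots> = (2 * real D) ^ (CARD('n) - 2) / (16 * tube_const TYPE('n) \<delta>) * real D"
        by (simp add: c_def power_mult_distrib pw[unfolded One_nat_def])
      also have "\<dots> \<le> real (card Y) * real D" using cY by (intro mult_right_mono) auto
      finally show ?thesis unfolding F_def card_tcells[OF l[symmetric] D0(1) E(3)[folded D_def] th Y] by simp
    qed
    define B2 where "B2 = 2 * ?n * B1"
    have B2: "B1 \<le> B2" using mult_right_mono[of 1 "2 * ?n" B1] n B0 B1 by (simp add: B2_def)
    have W20: "line_expo C * W \<ge> 0" using expo0 W0 by simp
    have smF: "norm (gradient U q) \<le> B2 * exp (- (line_expo C * W))" if f: "f \<in> F" and q: "q \<in> ball (cell_center D f) (\<kappa>1 / real D)" for f q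
    proof -
      obtain y b where yb: "y \<in> Y" "b \<in> {0..<int D}" "f = tcell k l D \<theta> (y, b)" using f by (auto simp: F_def)
      obtain E' where E': "E' \<subseteq> {e\<in>E. tubekey k l D \<theta> e = y}" "E' \<noteq> {}"
        "\<And>e. e \<in> E' \<Longrightarrow> (\<Sum>e'\<in>E'. log_kernel l D e e') \<le> C * real (card E')" using Yp[OF yb(1)] by blast
      have finE': "finite E'" using E'(1) E(1) finite_subset by fastforce
      have "norm (gradient U q) \<le> 2 * ?n * B1 * exp (- line_expo C * W)"
      proof (rule tube_small[OF U Sb rho(2) _ l[symmetric] D0(1) E(3)[folded D_def] th _ yb(2) W0 _ _ E'(1,2) finE' E'(3)])
        show "norm (gradient U z) \<le> B1" if "z \<in> ball 0 \<rho>" for z using B[OF that] B1 by linarith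
        show "y \<in> tubekey k l D \<theta> ` E" using yb Y by blast
        show "0 \<le> C" using C by simp
        show "norm (gradient U z) \<le> B1 * exp (- W)" if "e \<in> E" "z \<in> ball (cell_center D e) ((\<kappa>1 + ?n + 2 * ?K) / real D)" for e z
          by (rule smE[OF that(1)]) (use that(2) in \<open>simp add: \<kappa>E_def\<close>)
        show "0 \<le> \<kappa>1" "\<kappa>1 / real D \<le> 1" using kap kD by auto
        show "q \<in> ball (cell_center D (tcell k l D \<theta> (y, b))) (\<kappa>1 / real D)" using q yb by simp
      qed
      then show ?thesis by (simp add: B2_def)
    qed
    define Q where "Q = 2 * ?n ^ 2 * 2 ^ CARD('n) * B2 * exp (- sweep_expo (CARD('n) - 1) c * (line_expo C * W))"
    have small0: "norm (gradient U y) \<le> Q" if "y \<in> ball 0 \<tau>" for y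
      unfolding Q_def
    proof (rule hyperplane_propagation[OF U Sb rho(1) _ Fc cF c D0(2) W20])
      show "norm (gradient U z) \<le> B2" if "z \<in> ball 0 \<rho>" for z using B[OF that] B1 B2 by linarith
      show "norm (gradient U q) \<le> B2 * exp (- (line_expo C * W))"
        if "f \<in> F" "q \<in> ball (cell_center D f) ((?n + 1 + 2 * ?K * ?n) / real D)" for f q
        using smF that by (simp add: \<kappa>1_def)
      show "(?n + 1 + 2 * ?K * ?n) / real D \<le> 1" using kD by (simp add: \<kappa>1_def)
      show "y \<in> ball 0 (1 / (2 * ?n))" using that by (simp add: \<tau>_def)
    qed
    \<comment> \<open>The doubling hypothesis is available only up to radius \<open>\<rho>\<close>;
      the first alternative records that the radius has already passed it, and the chain then stands
      still.\<close>
    have chain: "(\<exists>i\<le>j. \<tau> * (10 * ?n) ^ i > \<rho> \<and> (\<forall>y\<in>ball 0 (\<tau> * (10 * ?n) ^ i). norm (gradient U y) \<le> exp (2 * N * real i) * Q)) \<or>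
       (\<forall>y\<in>ball 0 (\<tau> * (10 * ?n) ^ j). norm (gradient U y) \<le> exp (2 * N * real j) * Q)" for j
    proof (induction j)
      case 0 then show ?case using small0 by simp
    next
      case (Suc j)
      show ?case
      proof (cases "\<exists>i\<le>j. \<tau> * (10 * ?n) ^ i > \<rho> \<and> (\<forall>y\<in>ball 0 (\<tau> * (10 * ?n) ^ i). norm (gradient U y) \<le> exp (2 * N * real i) * Q)")
        case True then show ?thesis by (meson le_SucI)
      next
        case False
        then have IH: "\<forall>y\<in>ball 0 (\<tau> * (10 * ?n) ^ j). norm (gradient U y) \<le> exp (2 * N * real j) * Q" using Suc.IH by blast
        then have le: "\<tau> * (10 * ?n) ^ j \<le> \<rho>" using False by force
        have "norm (gradient U y) \<le> exp (2 * N * real (Suc j)) * Q" if y: "y \<in> ball 0 (\<tau> * (10 * ?n) ^ Suc j)" for y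
        proof -
          have "norm (gradient U y) \<le> exp (2 * N) * (exp (2 * N * real j) * Q)"
          proof (rule dbl[of "\<tau> * (10 * ?n) ^ j"])
            show "0 < \<tau> * (10 * ?n) ^ j" using tau n by simp
            show "\<tau> * (10 * ?n) ^ j \<le> R_big TYPE('n)" using le by (simp add: \<rho>_def)
            show "norm (gradient U z) \<le> exp (2 * N * real j) * Q" if "z \<in> ball 0 (\<tau> * (10 * ?n) ^ j)" for z
              using IH that by blast
            have "\<tau> * (10 * ?n) ^ Suc j = 10 * real CARD('n) * (\<tau> * (10 * ?n) ^ j)" by (simp only: power_Suc ac_simps)
            then show "y \<in> ball 0 (10 * real CARD('n) * (\<tau> * (10 * ?n) ^ j))" using y by (simp only:)
          qed
          also have "\<dots> = exp (2 * N + 2 * N * real j) * Q" by (simp only: exp_add mult.assoc)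
          also have "2 * N + 2 * N * real j = 2 * N * real (Suc j)" by (simp add: algebra_simps)
          finally show ?thesis .
        qed
        then show ?thesis by blast
      qed
    qed
    have "\<exists>i\<le>J. \<tau> * (10 * ?n) ^ i > \<rho> \<and> (\<forall>y\<in>ball 0 (\<tau> * (10 * ?n) ^ i). norm (gradient U y) \<le> exp (2 * N * real i) * Q)"
    proof -
      have "\<tau> * (10 * ?n) ^ J > \<rho>" using J tau by (simp add: divide_less_eq mult.commute)
      then show ?thesis using chain[of J] by blast
    qed
    then obtain i where i: "i \<le> J" "\<tau> * (10 * ?n) ^ i > \<rho>"
      "\<And>y. y\<in>ball 0 (\<tau> * (10 * ?n) ^ i) \<Longrightarrow> norm (gradient U y) \<le> exp (2 * N * real i) * Q" by blast
    have Q0: "Q \<ge> 0" using order_trans[OF norm_ge_zero small0[of 0]] tau by simp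
    \<comment> \<open>The point \<open>ym\<close> lies in the last ball, so \<open>B\<close> is
      bounded by a small multiple of itself.\<close>
    have "B \<le> exp (2 * N * real i) * Q" unfolding B_def by (rule i(3)) (use ym(1) i(2) in auto)
    also have "\<dots> \<le> exp (2 * N * real J) * Q" using i(1) N1 Q0 by (intro mult_right_mono) auto
    also have "\<dots> = C5 * B * (exp (2 * N * real J) * exp (- (\<gamma> * N * real L)))"
    proof -
      have "sweep_expo (CARD('n) - 1) c * (line_expo C * W) = \<gamma> * N * real L" by (simp add: \<gamma>_def W_def)
      then show ?thesis by (simp add: Q_def C5_def B2_def B1_def)
    qed
    also have "\<dots> = B * exp (ln C5 + 2 * N * real J - \<gamma> * N * real L)"
      using C5 by (simp add: exp_add exp_diff exp_minus divide_inverse)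
    finally have "B * 1 \<le> B * exp (ln C5 + 2 * N * real J - \<gamma> * N * real L)" by simp
    then have "1 \<le> exp (ln C5 + 2 * N * real J - \<gamma> * N * real L)" using Bpos by (simp only: mult_le_cancel_left_pos)
    then have "0 \<le> ln C5 + 2 * N * real J - \<gamma> * N * real L" by simp
    then have fin: "N * (\<gamma> * real L - 2 * real J) \<le> ln C5" by (simp add: algebra_simps)
    have "(2 * real J + ln C5) / \<gamma> < real L" using L2 L by linarith
    then have big: "\<gamma> * real L - 2 * real J > ln C5" using \<gamma> by (simp add: divide_less_eq algebra_simps)
    have "ln C5 \<ge> 0" using C5 by simp
    then have "1 * (\<gamma> * real L - 2 * real J) \<le> N * (\<gamma> * real L - 2 * real J)" using N1 big by (intro mult_right_mono) auto
    from order_trans[OF this fin] show False using big by simp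
  qed
qed

subsection \<open>Selecting a triadic cube and rescaling\<close>

lemma finite_grid: "finite (grid k D)"
  by (rule finite_subset[OF _ finite_cells[of k D]]) (force simp: grid_def cells_def)

lemma grid_range:
  assumes e: "e \<in> grid k D" and D: "D > 0" shows "e i \<in> {0..<int D}"
proof (cases "i = k")
  case True
  have "0 \<le> (d - 1) div 2 \<and> (d - 1) div 2 < d" if "d > 0" for d :: int using that by presburger
  then show ?thesis using e D True by (simp add: grid_def)
qed (use e in \<open>simp add: grid_def\<close>)

lemma card_grid_le: "card (grid (k::'n::finite) D) \<le> D ^ CARD('n)" if "D > 0"
proof -
  have "grid k D \<subseteq> Pi\<^sub>E UNIV (\<lambda>_. {0..<int D})" using grid_range that by (force simp: PiE_def Pi_def extensional_def)
  then have "card (grid k D) \<le> card (Pi\<^sub>E (UNIV::'n set) (\<lambda>_. {0..<int D}))" by (intro card_mono finite_PiE) auto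
  then show ?thesis by (simp add: card_PiE)
qed

text \<open>The middle layer of the fine grid is also the middle layer within each triadic cube that
  contains it, so the hyperplane keeps its central position under rescaling. Here the odd, triadic
  subdivision matters.\<close>

lemma half_mod_pow3: "((3 ^ p - 1) div 2) mod 3 ^ L = ((3 ^ L - 1) div 2 :: int)" if "L \<le> p"
proof -
  have odd: "\<exists>h. (3::int) ^ j = 2 * h + 1 \<and> h \<ge> 0" for j
  proof -
    have "odd ((3::int) ^ j)" by simp
    then obtain h where "(3::int) ^ j = 2 * h + 1" by (rule oddE)
    moreover have "(3::int) ^ j > 0" by simp
    ultimately show ?thesis by (intro exI[of _ h]) linarith
  qed
  obtain h where h: "(3::int) ^ L = 2 * h + 1" "h \<ge> 0" using odd by blast
  obtain g where g: "(3::int) ^ (p - L) = 2 * g + 1" "g \<ge> 0" using odd by blast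
  have "(3::int) ^ p = 3 ^ (p - L) * 3 ^ L" using that by (simp add: power_add[symmetric])
  then have "(3::int) ^ p - 1 = 2 * (h + g * 3 ^ L)" by (simp add: g h algebra_simps)
  then have "((3::int) ^ p - 1) div 2 = h + g * 3 ^ L" by simp
  moreover have "((3::int) ^ L - 1) div 2 = h" using h by simp
  moreover have "(h + g * 3 ^ L) mod 3 ^ L = h" using h by simp
  ultimately show ?thesis by simp
qed

text \<open>The triadic cube maximizing (number of bad cells) times \<open>3 ^ (s j)\<close>, where \<open>3 ^ (- j)\<close>
  is its side, satisfies the Frostman condition with constant one.\<close>

lemma triadic_selection:
  fixes Bd :: "('n::finite \<Rightarrow> int) set"
  assumes Bd: "Bd \<subseteq> grid k (3 ^ p)" "Bd \<noteq> {}" and a0: "a0 \<le> p" and s: "s \<ge> 0"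
  obtains L b E where "L + a0 \<le> p" "E \<subseteq> grid k (3 ^ L)" "E \<noteq> {}" "finite E" "frostman s L E"
    "\<And>e. e \<in> E \<Longrightarrow> (\<lambda>i. b i * 3 ^ L + e i) \<in> Bd" "\<And>i. 0 \<le> b i \<and> b i < 3 ^ (p - L)"
    "real (card Bd) \<le> 3 ^ (a0 * CARD('n)) * (3 ^ (L * CARD('n)) * 3 powr (s * real (p - L)))"
proof -
  have finBd: "finite Bd" using Bd(1) finite_grid finite_subset by blast
  define cl where "cl j e0 = {e\<in>Bd. \<forall>i. e i div 3 ^ (p - j) = e0 i div 3 ^ (p - j)}" for j :: nat and e0
  have fcl: "finite (cl j e0)" for j e0 using finBd by (simp add: cl_def)
  define val where "val x = real (card (cl (fst x) (snd x))) * 3 powr (s * real (fst x))" for x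
  have fin: "finite ({a0..p} \<times> Bd)" using finBd by simp
  have ne: "{a0..p} \<times> Bd \<noteq> {}" using Bd a0 by auto
  have "\<exists>x\<in>{a0..p} \<times> Bd. \<forall>y\<in>{a0..p} \<times> Bd. val y \<le> val x"
  proof -
    have "Max (val ` ({a0..p} \<times> Bd)) \<in> val ` ({a0..p} \<times> Bd)" using fin ne by (intro Max_in) auto
    then obtain x where x: "x \<in> {a0..p} \<times> Bd" "val x = Max (val ` ({a0..p} \<times> Bd))" by auto
    then have "\<forall>y\<in>{a0..p} \<times> Bd. val y \<le> val x" using fin by simp
    then show ?thesis using x(1) by blast
  qed
  then obtain j e0 where je: "a0 \<le> j" "j \<le> p" "e0 \<in> Bd"
    and mx: "\<And>j' e'. a0 \<le> j' \<Longrightarrow> j' \<le> p \<Longrightarrow> e' \<in> Bd \<Longrightarrow> val (j', e') \<le> val (j, e0)" by force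
  \<comment> \<open>\<open>j\<close> counts from the coarse end and \<open>L\<close> from the fine
    end: the selected cube has \<open>3 ^ L\<close> cells on a side.\<close>
  define L where "L = p - j"
  define b where "b i = e0 i div 3 ^ L" for i
  have jL: "j = p - L" "L \<le> p" using je by (auto simp: L_def)
  define CL where "CL = cl j e0"
  have CL: "e \<in> CL \<longleftrightarrow> e \<in> Bd \<and> (\<forall>i. e i div 3 ^ L = b i)" for e
    by (simp add: CL_def cl_def b_def L_def)
  define md where "md e = (\<lambda>i. e i mod 3 ^ L)" for e :: "'n \<Rightarrow> int"
  define E where "E = md ` CL"
  have rec: "(\<lambda>i. b i * 3 ^ L + md e i) = e" if "e \<in> CL" for e
  proof
    fix i
    have bi: "b i = e i div 3 ^ L" using that CL by simp
    show "b i * 3 ^ L + md e i = e i" unfolding bi md_def by (rule div_mult_mod_eq)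
  qed
  have inj: "inj_on md CL"
  proof (rule inj_onI)
    fix e e' assume e: "e \<in> CL" "e' \<in> CL" "md e = md e'"
    show "e = e'" using rec[OF e(1)] rec[OF e(2)] unfolding e(3) by simp
  qed
  have cE: "card E = card CL" by (simp add: E_def card_image[OF inj])
  have e0CL: "e0 \<in> CL" unfolding CL b_def using je by simp
  have EB: "(\<lambda>i. b i * 3 ^ L + e i) \<in> Bd" if e: "e \<in> E" for e
  proof -
    obtain e1 where e1: "e1 \<in> CL" "e = md e1" using e by (auto simp: E_def)
    then show ?thesis using rec[OF e1(1)] CL by simp
  qed
  have Eg: "E \<subseteq> grid k (3 ^ L)"
  proof
    fix e assume "e \<in> E"
    then obtain e1 where e1: "e1 \<in> CL" "e = md e1" by (auto simp: E_def)
    have "e1 \<in> grid k (3 ^ p)" using e1(1) CL Bd(1) by blast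
    then have "e1 k = (3 ^ p - 1) div 2" by (simp add: grid_def)
    then have "e k = (3 ^ L - 1) div 2" using half_mod_pow3[OF jL(2)] by (simp add: e1 md_def)
    then show "e \<in> grid k (3 ^ L)" by (simp add: grid_def e1 md_def)
  qed
  have fr: "frostman s L E"
    unfolding frostman_def
  proof (intro allI impI)
    fix a b' assume a: "a \<le> L"
    define A where "A = {e\<in>CL. \<forall>i. md e i div 3 ^ a = b' i}"
    have "card {e\<in>E. \<forall>i. e i div 3 ^ a = b' i} = card (md ` A)" by (rule arg_cong[of _ _ card]) (auto simp: E_def A_def)
    also have "\<dots> = card A" using inj by (intro card_image inj_on_subset[OF inj]) (auto simp: A_def)
    finally have cA: "card {e\<in>E. \<forall>i. e i div 3 ^ a = b' i} = card A" .
    show "real (card {e\<in>E. \<forall>i. e i div 3 ^ a = b' i}) \<le> real (card E) * 3 powr (- s * real (L - a))"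
    proof (cases "A = {}")
      case True then show ?thesis by (simp add: cA)
    next
      case False
      then obtain e1 where e1: "e1 \<in> A" by auto
      have dv: "e i div 3 ^ a = b i * 3 ^ (L - a) + b' i" if "e \<in> A" for e i
      proof -
        have "e i = b i * 3 ^ L + md e i" using rec[of e] that by (auto simp: A_def fun_eq_iff)
        also have "(3::int) ^ L = 3 ^ (L - a) * 3 ^ a" using a by (simp add: power_add[symmetric])
        finally have "e i = md e i + (b i * 3 ^ (L - a)) * 3 ^ a" by simp
        then have "e i div 3 ^ a = b i * 3 ^ (L - a) + md e i div 3 ^ a" by (metis div_mult_self1 power_eq_0_iff zero_neq_numeral)
        then show ?thesis using that by (simp add: A_def)
      qed
      have pa: "p - (p - a) = a" using a jL by simp
      have "A \<subseteq> cl (p - a) e1"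
      proof
        fix e assume e: "e \<in> A"
        then show "e \<in> cl (p - a) e1" using dv[OF e] dv[OF e1] CL by (auto simp: cl_def pa A_def)
      qed
      then have "real (card A) \<le> real (card (cl (p - a) e1))" by (simp add: card_mono[OF fcl])
      moreover have "real (card (cl (p - a) e1)) * 3 powr (s * real (p - a)) \<le> real (card CL) * 3 powr (s * real j)"
      proof -
        have "e1 \<in> Bd" using e1 CL by (auto simp: A_def)
        then show ?thesis using mx[of "p - a" e1] a jL je by (simp add: val_def CL_def)
      qed
      ultimately have "real (card A) * 3 powr (s * real (p - a)) \<le> real (card CL) * 3 powr (s * real j)"
        by (meson mult_right_mono order_trans powr_ge_zero)
      then have "real (card A) * 3 powr (s * real (p - a)) * 3 powr (- s * real (p - a)) \<le>
          real (card CL) * 3 powr (s * real j) * 3 powr (- s * real (p - a))"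
        by (intro mult_right_mono) auto
      then have "real (card A) \<le> real (card CL) * 3 powr (s * real j - s * real (p - a))"
        by (simp add: mult.assoc powr_add[symmetric])
      moreover have "s * real j - s * real (p - a) = - s * real (L - a)"
        using a jL by (simp add: of_nat_diff algebra_simps)
      ultimately show ?thesis by (simp add: cA cE)
    qed
  qed
  have card1: "real (card Bd) \<le> 3 ^ (a0 * CARD('n)) * (3 ^ (L * CARD('n)) * 3 powr (s * real (p - L)))"
  proof -
    define g where "g e = (\<lambda>i. e i div 3 ^ (p - a0))" for e :: "'n \<Rightarrow> int"
    define PP where "PP = Pi\<^sub>E (UNIV::'n set) (\<lambda>_. {0..<(3::int) ^ a0})"
    have cPP: "card PP = 3 ^ (a0 * CARD('n))" by (simp add: PP_def card_PiE nat_power_eq power_mult)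
    have gPP: "g ` Bd \<subseteq> PP"
    proof (rule image_subsetI)
      fix e assume "e \<in> Bd"
      then have eg: "e \<in> grid k (3 ^ p)" using Bd by blast
      have "e i div 3 ^ (p - a0) \<in> {0..<3 ^ a0}" for i
      proof -
        have r: "0 \<le> e i" "e i < 3 ^ p" using grid_range[OF eg, of i] by auto
        have "(3::int) ^ p = 3 ^ a0 * 3 ^ (p - a0)" using a0 by (simp add: power_add[symmetric])
        then have "e i < 3 ^ a0 * 3 ^ (p - a0)" using r by simp
        moreover have "e i div 3 ^ (p - a0) * 3 ^ (p - a0) \<le> e i"
          by (metis add.commute div_mult_mod_eq le_add_same_cancel1 pos_mod_sign zero_less_numeral zero_less_power add_increasing2 order_refl)
        ultimately have "e i div 3 ^ (p - a0) * 3 ^ (p - a0) < 3 ^ a0 * 3 ^ (p - a0)" by linarith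
        then have "e i div 3 ^ (p - a0) < 3 ^ a0" by (simp add: mult_less_cancel_right)
        moreover have "0 \<le> e i div 3 ^ (p - a0)" using r by (simp add: pos_imp_zdiv_nonneg_iff)
        ultimately show ?thesis by simp
      qed
      then show "g e \<in> PP" by (simp add: PP_def g_def PiE_def Pi_def extensional_def)
    qed
    have finPP: "finite PP" by (simp add: PP_def finite_PiE)
    have each: "real (card {e\<in>Bd. g e = y}) \<le> val (j, e0)" if y: "y \<in> g ` Bd" for y
    proof -
      obtain e1 where e1: "e1 \<in> Bd" "y = g e1" using y by auto
      have "{e\<in>Bd. g e = y} = cl a0 e1" by (auto simp: cl_def g_def e1 fun_eq_iff)
      then have "real (card {e\<in>Bd. g e = y}) * 1 \<le> val (a0, e1)"
        unfolding val_def using s ge_one_powr_ge_zero[of 3 "s * real a0"] by (intro mult_mono) auto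
      also have "\<dots> \<le> val (j, e0)" by (rule mx) (use a0 e1 in auto)
      finally show ?thesis by simp
    qed
    have "real (card Bd) = (\<Sum>y\<in>g ` Bd. real (card {e\<in>Bd. g e = y}))"
    proof -
      have "(\<Sum>y\<in>g ` Bd. \<Sum>e\<in>{e\<in>Bd. g e = y}. (1::real)) = (\<Sum>e\<in>Bd. 1)"
        by (rule sum.group) (use finBd in auto)
      then show ?thesis by simp
    qed
    also have "\<dots> \<le> (\<Sum>y\<in>g ` Bd. val (j, e0))" by (rule sum_mono) (rule each)
    also have "\<dots> = real (card (g ` Bd)) * val (j, e0)" by simp
    also have "\<dots> \<le> 3 ^ (a0 * CARD('n)) * val (j, e0)"
    proof (rule mult_right_mono)
      have "card (g ` Bd) \<le> card PP" by (rule card_mono[OF finPP gPP])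
      then have "real (card (g ` Bd)) \<le> real (card PP)" by simp
      then show "real (card (g ` Bd)) \<le> 3 ^ (a0 * CARD('n))" by (simp add: cPP)
    qed (simp add: val_def)
    also have "val (j, e0) \<le> 3 ^ (L * CARD('n)) * 3 powr (s * real (p - L))"
    proof -
      have "card CL \<le> card (grid k (3 ^ L))" unfolding cE[symmetric] by (rule card_mono[OF finite_grid Eg])
      also have "\<dots> \<le> (3 ^ L) ^ CARD('n)" by (rule card_grid_le) simp
      finally have "real (card CL) \<le> 3 ^ (L * CARD('n))" by (metis of_nat_le_iff of_nat_numeral of_nat_power power_mult)
      then show ?thesis by (simp add: val_def CL_def jL mult_right_mono)
    qed
    finally show ?thesis by simp
  qed
  have brange: "0 \<le> b i \<and> b i < 3 ^ (p - L)" for i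
  proof -
    have eg: "e0 \<in> grid k (3 ^ p)" using je Bd by blast
    have r: "0 \<le> e0 i" "e0 i < 3 ^ p" using grid_range[OF eg, of i] by auto
    have "(3::int) ^ p = 3 ^ (p - L) * 3 ^ L" using jL by (simp add: power_add[symmetric])
    moreover have "b i * 3 ^ L + e0 i mod 3 ^ L = e0 i" unfolding b_def by (rule div_mult_mod_eq)
    moreover have "0 \<le> e0 i mod 3 ^ L" by simp
    ultimately have "b i * 3 ^ L < 3 ^ (p - L) * 3 ^ L" using r by linarith
    then have "b i < 3 ^ (p - L)" by (simp add: mult_less_cancel_right)
    then show ?thesis using r by (simp add: b_def pos_imp_zdiv_nonneg_iff)
  qed
  show thesis
  proof (rule that[of L E b])
    show "L + a0 \<le> p" using je by (simp add: L_def)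
    show "E \<noteq> {}" "finite E" using e0CL fcl by (auto simp: E_def CL_def)
  qed (use Eg fr EB brange card1 in auto)
qed

section \<open>Doubling indices as pointwise gradient inequalities\<close>

lemma sup_grad_nonneg: "r > 0 \<Longrightarrow> 0 \<le> sup_grad u x r"
  unfolding sup_grad_def by (rule SUP_upper2[of x]) auto

text \<open>The conventions of \<open>ereal\<close> work in favour: quotients by infinity and
  \<open>0 / 0\<close> are 0 and have \<open>ereal_ln\<close> equal to minus infinity, so the
  hypothesis excludes them, while division of a positive value by 0 gives infinity and the
  conclusion holds.\<close>

lemma ereal_ln_greater:
  assumes a: "0 \<le> a" and b: "0 \<le> b" and g: "ereal_ln (a / b) > ereal N"
  shows "ereal (exp N) * b < a"
proof -
  have q: "a / b > ereal (exp N)"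
  proof (cases "a / b")
    case (real x)
    then have "x > 0" "ln x > N" using g by (auto simp: ereal_ln_def split: if_splits)
    then have "x > exp N" by (metis exp_less_cancel_iff exp_ln)
    then show ?thesis using real by simp
  qed (use g in \<open>auto simp: ereal_ln_def\<close>)
  show ?thesis
  proof (cases b)
    case (real y)
    show ?thesis
    proof (cases "y = 0")
      case True
      then have "a \<noteq> 0" using q real by (auto simp: zero_ereal_def[symmetric])
      then show ?thesis using a real True by (simp add: zero_ereal_def[symmetric])
    next
      case False
      then have y: "y > 0" using b real by simp
      show ?thesis
      proof (cases a)
        case (real x)
        then have "exp N < x / y" using q \<open>b = ereal y\<close> y by simp
        then show ?thesis using real \<open>b = ereal y\<close> y by (simp add: less_divide_eq)
      next
        case PInf then show ?thesis using \<open>b = ereal y\<close> by simp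
      qed (use a in simp)
    qed
  next
    case PInf
    then have "a / b = 0" by simp
    then show ?thesis using q by simp
  qed (use b in simp)
qed

lemma ereal_ln_le:
  assumes a: "0 \<le> a" and b: "0 \<le> b" "b \<noteq> \<infinity>" and g: "ereal_ln (a / b) \<le> ereal N"
  shows "a \<le> ereal (exp N) * b"
proof -
  have q: "a / b \<le> ereal (exp N)"
  proof (cases "a / b")
    case (real x)
    show ?thesis
    proof (cases "x > 0")
      case True
      then have "ln x \<le> N" using g real by (auto simp: ereal_ln_def split: if_splits)
      then have "x \<le> exp N" using True by (metis exp_le_cancel_iff exp_ln)
      then show ?thesis using real by simp
    next
      case False
      then have "x \<le> exp N" by (meson exp_gt_zero less_imp_le not_le order_trans)
      then show ?thesis using real by simp
    qed
  qed (use g in \<open>auto simp: ereal_ln_def\<close>)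
  obtain y where y: "b = ereal y" using b by (cases b) auto
  show ?thesis
  proof (cases "y = 0")
    case True
    have "a = 0"
    proof (rule ccontr)
      assume "a \<noteq> 0"
      then have "a / b = \<infinity>" using a y True by (cases a) (auto simp: divide_ereal_def zero_ereal_def[symmetric])
      then show False using q by simp
    qed
    then show ?thesis using y True by (simp add: zero_ereal_def[symmetric])
  next
    case False
    then have y0: "y > 0" using b y by simp
    show ?thesis
    proof (cases a)
      case (real x)
      then have "x / y \<le> exp N" using q y y0 by simp
      then show ?thesis using real y y0 by (simp add: divide_le_eq)
    next
      case PInf
      then have "a / b = \<infinity>" using y y0 by simp
      then show ?thesis using q by simp
    qed (use a in simp)
  qed
qed

lemma doubling_index_greater:
  fixes u :: "real^'n::finite \<Rightarrow> real"
  assumes "doubling_index u q > ereal N"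
  shows "\<exists>x r y. x \<in> cube_set q \<and> 0 < r \<and> r \<le> side q \<and> y \<in> ball x (10 * real CARD('n) * r) \<and>
    (\<forall>z\<in>ball x r. exp N * norm (gradient u z) < norm (gradient u y))"
proof -
  obtain x r where xr: "x \<in> cube_set q" "0 < r" "r \<le> side q"
    "ereal_ln (sup_grad u x (10 * real CARD('n) * r) / sup_grad u x r) > ereal N"
    using assms unfolding doubling_index_def less_SUP_iff by auto
  have r10: "10 * real CARD('n) * r > 0" using xr(2) by simp
  have "ereal (exp N) * sup_grad u x r < sup_grad u x (10 * real CARD('n) * r)"
    by (rule ereal_ln_greater[OF sup_grad_nonneg[OF r10] sup_grad_nonneg[OF xr(2)] xr(4)])
  then obtain y where y: "y \<in> ball x (10 * real CARD('n) * r)" "ereal (exp N) * sup_grad u x r < ereal (norm (gradient u y))"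
    unfolding sup_grad_def[of u x "10 * real CARD('n) * r"] less_SUP_iff by auto
  have "exp N * norm (gradient u z) < norm (gradient u y)" if z: "z \<in> ball x r" for z
  proof -
    have "ereal (norm (gradient u z)) \<le> sup_grad u x r" unfolding sup_grad_def by (rule SUP_upper[OF z])
    then have "ereal (exp N) * ereal (norm (gradient u z)) \<le> ereal (exp N) * sup_grad u x r"
      by (intro ereal_mult_left_mono) auto
    from order_le_less_trans[OF this y(2)] show ?thesis by simp
  qed
  then show ?thesis using xr y by blast
qed

lemma doubling_index_le:
  fixes u :: "real^'n::finite \<Rightarrow> real"
  assumes d: "doubling_index u q \<le> ereal N" and x: "x \<in> cube_set q" and r: "0 < r" "r \<le> side q"
    and M: "\<And>z. z \<in> ball x r \<Longrightarrow> norm (gradient u z) \<le> M" and z: "z \<in> ball x (10 * real CARD('n) * r)"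
  shows "norm (gradient u z) \<le> exp N * M"
proof -
  have r10: "10 * real CARD('n) * r > 0" using r by simp
  have b: "sup_grad u x r \<le> ereal M" unfolding sup_grad_def by (rule SUP_least) (use M in simp)
  then have binf: "sup_grad u x r \<noteq> \<infinity>" by auto
  have "ereal_ln (sup_grad u x (10 * real CARD('n) * r) / sup_grad u x r) \<le> doubling_index u q"
    unfolding doubling_index_def by (rule SUP_upper2[of "(x, r)"]) (use x r in auto)
  then have "ereal_ln (sup_grad u x (10 * real CARD('n) * r) / sup_grad u x r) \<le> ereal N" using d by (rule order_trans)
  from ereal_ln_le[OF sup_grad_nonneg[OF r10] sup_grad_nonneg[OF r(1)] binf this]
  have "sup_grad u x (10 * real CARD('n) * r) \<le> ereal (exp N) * ereal M"
    using b by (meson ereal_mult_left_mono order_trans ereal_less_eq(5) exp_ge_zero)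
  moreover have "ereal (norm (gradient u z)) \<le> sup_grad u x (10 * real CARD('n) * r)"
    unfolding sup_grad_def by (rule SUP_upper[OF z])
  ultimately have "ereal (norm (gradient u z)) \<le> ereal (exp N * M)" by (metis order_trans times_ereal.simps(1))
  then show ?thesis by simp
qed

text \<open>Measured in cell sides from the lower face, the hyperplane is at height
  \<open>A + 1/2\<close>, strictly inside layer \<open>A\<close>; the neighbouring closed layers do
  not touch it.\<close>

lemma subcubes_hyperplane:
  assumes q: "q \<in> subcubes (2 * A + 1) unit_cube" and h: "cube_set q \<inter> {x. x $ k = 0} \<noteq> {}"
  shows "\<exists>e\<in>grid (k::'n::finite) (2 * A + 1). q = (cell_center (2 * A + 1) e, 1 / real (2 * A + 1))"
proof -
  define M where "M = 2 * A + 1"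
  have M: "real M > 0" by (simp add: M_def)
  obtain m :: "'n \<Rightarrow> nat" where m: "\<And>i. m i < M"
    "q = (\<chi> i. 0 - 1 / 2 + (real (m i) + 1 / 2) * (1 / real M), 1 / real M)"
    using q by (auto simp: subcubes_def unit_cube_def M_def)
  define e where "e i = int (m i)" for i
  have qe: "q = (cell_center M e, 1 / real M)" unfolding m(2) by (simp add: cell_center_def e_def vec_eq_iff)
  obtain x where x: "x \<in> cube_set q" "x $ k = 0" using h by auto
  have "\<bar>x $ k - cell_center M e $ k\<bar> \<le> 1 / real M / 2" using x(1) by (auto simp: cube_set_def qe)
  then have "\<bar>(real (m k) + 1/2) / real M - 1/2\<bar> \<le> 1 / real M / 2" using x(2) by (simp add: cell_center_def e_def abs_minus_commute)
  then have "\<bar>(real (m k) + 1/2) / real M - 1/2\<bar> * real M \<le> 1 / real M / 2 * real M" using M by (intro mult_right_mono) auto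
  moreover have "\<bar>(real (m k) + 1/2) / real M - 1/2\<bar> * real M = \<bar>real (m k) + 1/2 - real M / 2\<bar>"
  proof -
    have "(real (m k) + 1/2 - real M / 2) = ((real (m k) + 1/2) / real M - 1/2) * real M" using M by (simp add: left_diff_distrib)
    then show ?thesis using M by (simp only: abs_mult abs_of_pos)
  qed
  moreover have "1 / real M / 2 * real M = 1/2" using M by simp
  ultimately have "\<bar>real (m k) + 1/2 - real M / 2\<bar> \<le> 1/2" by linarith
  moreover have "real M = 2 * real A + 1" by (simp add: M_def)
  ultimately have "\<bar>real (m k) - real A\<bar> \<le> 1/2" by linarith
  then have "m k = A" by linarith
  then have "e k = (int M - 1) div 2" by (simp add: e_def M_def)
  moreover have "e i \<in> {0..<int M}" for i using m(1)[of i] by (simp add: e_def)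
  ultimately have "e \<in> grid k M" by (simp add: grid_def)
  then show ?thesis using qe by (auto simp: M_def)
qed

section \<open>Rescaling a triadic cube to the unit cube\<close>

lemma cell_center_rescale:
  "cell_center (3 ^ j) b + (1 / 3 ^ j) *\<^sub>R cell_center (3 ^ L) e = cell_center (3 ^ (j + L)) (\<lambda>i. b i * 3 ^ L + e i)"
proof -
  have "(of_int (b i) + 1/2) / 3 ^ j - 1/2 + 1 / 3 ^ j * ((of_int (e i) + 1/2) / 3 ^ L - 1/2)
      = (of_int (b i * 3 ^ L + e i) + 1/2) / 3 ^ (j + L) - (1/2 :: real)" for i
    by (simp add: power_add field_simps)
  then show ?thesis by (simp add: cell_center_def vec_eq_iff)
qed

lemma gradient_scale:
  fixes u :: "real^'n::finite \<Rightarrow> real"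
  assumes u: "harmonic_on \<Omega> u" and x: "z0 + \<rho> *\<^sub>R x \<in> \<Omega>" and rho: "\<rho> > 0"
  shows "norm (gradient (\<lambda>y. u (z0 + \<rho> *\<^sub>R y)) x) = \<rho> * norm (gradient u (z0 + \<rho> *\<^sub>R x))"
proof -
  have aff: "aff z0 (\<lambda>_. \<rho>) y = z0 + \<rho> *\<^sub>R y" for y :: "real^'n" by (simp add: aff_def vec_eq_iff)
  have "partial_deriv i (\<lambda>y. u (z0 + \<rho> *\<^sub>R y)) x = \<rho> * partial_deriv i u (z0 + \<rho> *\<^sub>R x)" for i
    using partial_deriv_aff[OF u, of z0 "\<lambda>_. \<rho>" x i] x by (simp add: aff)
  then have "gradient (\<lambda>y. u (z0 + \<rho> *\<^sub>R y)) x = \<rho> *\<^sub>R gradient u (z0 + \<rho> *\<^sub>R x)"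
    by (simp add: gradient_def vec_eq_iff)
  then show ?thesis using rho by simp
qed

lemma harmonic_scale:
  fixes u :: "real^'n::finite \<Rightarrow> real"
  assumes u: "harmonic_on \<Omega> u" and rho: "\<rho> > 0"
  shows "harmonic_on {x. z0 + \<rho> *\<^sub>R x \<in> \<Omega>} (\<lambda>y. u (z0 + \<rho> *\<^sub>R y))"
proof -
  have aff: "aff z0 (\<lambda>_. \<rho>) y = z0 + \<rho> *\<^sub>R y" for y :: "real^'n" by (simp add: aff_def vec_eq_iff)
  have op: "open {x. z0 + \<rho> *\<^sub>R x \<in> \<Omega>}"
    using open_vimage[OF harmonic_open[OF u], of "\<lambda>x. z0 + \<rho> *\<^sub>R x"] by (simp add: vimage_def continuous_intros)
  show ?thesis using harmonic_aff[OF u op, of z0 "\<lambda>_. \<rho>" \<rho>] rho by (simp add: aff)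
qed

theorem lemma2:
  assumes "CARD('n::finite) \<ge> 2"
  shows "\<exists>N0 :: real. \<forall>\<delta> \<eta> :: real. \<delta> > 0 \<longrightarrow> \<eta> > 0 \<longrightarrow>
    (\<exists>A0 :: real. \<forall>(A :: nat) (N :: real) (k :: 'n) (\<Omega> :: (real^'n) set) (u :: real^'n \<Rightarrow> real).
       real A > A0 \<longrightarrow>
       (\<exists>p. 2 * A + 1 = 3 ^ p) \<longrightarrow>
       N > N0 \<longrightarrow>
       harmonic_on \<Omega> u \<longrightarrow>
       \<not> u constant_on \<Omega> \<longrightarrow>
       cube_set (dilate 100 unit_cube) \<subseteq> \<Omega> \<longrightarrow>
       (\<forall>x \<in> cube_set (dilate 2 unit_cube). ball x (20 * real CARD('n)) \<subseteq> \<Omega>) \<longrightarrow>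
       doubling_index u (dilate 2 unit_cube) \<le> ereal (2 * N) \<longrightarrow>
       real (card {q \<in> subcubes (2 * A + 1) unit_cube.
                     cube_set q \<inter> {x. x $ k = 0} \<noteq> {} \<and> doubling_index u q > ereal N})
         < \<eta> * real (2 * A + 1) powr (real CARD('n) - 2 + \<delta>))"
proof (rule exI[of _ "N_min TYPE('n)"], intro allI impI)
  let ?n = "real CARD('n)" and ?R = "R_big TYPE('n)"
  fix \<delta> \<eta> :: real assume \<delta>: "\<delta> > 0" and \<eta>: "\<eta> > 0"
  have n2: "?n \<ge> 2" using assms by simp
  have R0: "?R > 0" unfolding R_big_def using taylor_const_ge(2)[where 'n='n] n2 by (intro mult_pos_pos) auto
  have \<delta>2: "\<delta> / 2 > 0" using \<delta> by simp
  obtain L0 where core: "\<forall>L N (U :: real^'n \<Rightarrow> real) S E k. L \<ge> L0 \<longrightarrow> N > N_min TYPE('n) \<longrightarrow> harmonic_on S U \<longrightarrow>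
     cball 0 ?R \<subseteq> S \<longrightarrow> finite E \<longrightarrow> E \<noteq> {} \<longrightarrow> E \<subseteq> grid k (3 ^ L) \<longrightarrow>
     frostman (?n - 2 + \<delta> / 2) L E \<longrightarrow>
     (\<forall>e\<in>E. \<exists>x r y. (\<forall>i. \<bar>x $ i - cell_center (3 ^ L) e $ i\<bar> \<le> 1 / 3 ^ L) \<and> 0 < r \<and> r \<le> 1 / 3 ^ L \<and>
         y \<in> ball x (10 * ?n * r) \<and> (\<forall>z\<in>ball x r. exp N * norm (gradient U z) < norm (gradient U y))) \<longrightarrow>
     (\<forall>r M. 0 < r \<longrightarrow> r \<le> ?R \<longrightarrow> (\<forall>z\<in>ball 0 r. norm (gradient U z) \<le> M) \<longrightarrow>
         (\<forall>z\<in>ball 0 (10 * ?n * r). norm (gradient U z) \<le> exp (2 * N) * M)) \<longrightarrow> False"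
    by (rule exE[OF core_contradiction[OF assms \<delta>2]])
  \<comment> \<open>One half of \<open>\<delta>\<close> becomes the surplus of the Frostman
    dimension over n - 2; the other half forces the selected cube to contain many scales.\<close>
  define s where "s = ?n - 2 + \<delta> / 2"
  have s0: "s \<ge> 0" using n2 \<delta> by (simp add: s_def)
  \<comment> \<open>Selected cubes have side at most 3^-a0, so radii up to \<open>?R\<close> in
    rescaled coordinates are at most 1 in the original ones, where the doubling index of the large
    cube applies.\<close>
  obtain a0 where a0: "?R < 3 ^ a0" using real_arch_pow[of 3 ?R] by auto
  define X :: real where "X = 3 ^ ((L0 + a0) * CARD('n)) / \<eta>"
  have X0: "X > 0" using \<eta> by (simp add: X_def)
  \<comment> \<open>The first entry gives \<open>X < M powr (\<delta> / 2)\<close>, which excludes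
    \<open>L < L0\<close>; the second gives \<open>a0 \<le> p\<close>.\<close>
  define A0 where "A0 = max (X powr (2 / \<delta>)) (3 ^ a0)"
  show "\<exists>A0 :: real. \<forall>(A :: nat) (N :: real) (k :: 'n) (\<Omega> :: (real^'n) set) (u :: real^'n \<Rightarrow> real).
       real A > A0 \<longrightarrow>
       (\<exists>p. 2 * A + 1 = 3 ^ p) \<longrightarrow>
       N > N_min TYPE('n) \<longrightarrow>
       harmonic_on \<Omega> u \<longrightarrow>
       \<not> u constant_on \<Omega> \<longrightarrow>
       cube_set (dilate 100 unit_cube) \<subseteq> \<Omega> \<longrightarrow>
       (\<forall>x \<in> cube_set (dilate 2 unit_cube). ball x (20 * real CARD('n)) \<subseteq> \<Omega>) \<longrightarrow>
       doubling_index u (dilate 2 unit_cube) \<le> ereal (2 * N) \<longrightarrow>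
       real (card {q \<in> subcubes (2 * A + 1) unit_cube.
                     cube_set q \<inter> {x. x $ k = 0} \<noteq> {} \<and> doubling_index u q > ereal N})
         < \<eta> * real (2 * A + 1) powr (real CARD('n) - 2 + \<delta>)"
  proof (rule exI[of _ A0], intro allI impI, rule ccontr)
    fix A N and k :: 'n and \<Omega> and u :: "real^'n \<Rightarrow> real"
    assume A: "A0 < real A" and ex: "\<exists>p. 2 * A + 1 = 3 ^ p" and N: "N > N_min TYPE('n)"
      and u: "harmonic_on \<Omega> u" and balls: "\<forall>x \<in> cube_set (dilate 2 unit_cube). ball x (20 * ?n) \<subseteq> \<Omega>"
      and dbl: "doubling_index u (dilate 2 unit_cube) \<le> ereal (2 * N)"
      and neg: "\<not> real (card {q \<in> subcubes (2 * A + 1) unit_cube.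
                     cube_set q \<inter> {x. x $ k = 0} \<noteq> {} \<and> doubling_index u q > ereal N})
         < \<eta> * real (2 * A + 1) powr (real CARD('n) - 2 + \<delta>)"
    obtain p where p: "2 * A + 1 = 3 ^ p" using ex by blast
    define M where "M = 2 * A + 1"
    have Mp: "M = 3 ^ p" "real M = 3 ^ p" using p by (auto simp: M_def)
    have MA: "real M > A0" using A by (simp add: M_def)
    have a0p: "a0 \<le> p"
    proof -
      have "(3::real) ^ a0 < 3 ^ p" using MA by (simp add: A0_def Mp)
      then show ?thesis by simp
    qed
    define Bd where "Bd = {e \<in> grid k M. doubling_index u (cell_center M e, 1 / real M) > ereal N}"
    have finBd: "finite Bd" by (simp add: Bd_def finite_grid)
    have "{q \<in> subcubes (2 * A + 1) unit_cube. cube_set q \<inter> {x. x $ k = 0} \<noteq> {} \<and> doubling_index u q > ereal N}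
        \<subseteq> (\<lambda>e. (cell_center M e, 1 / real M)) ` Bd"
      using subcubes_hyperplane[of _ A k] by (fastforce simp: Bd_def M_def)
    then have "card {q \<in> subcubes (2 * A + 1) unit_cube. cube_set q \<inter> {x. x $ k = 0} \<noteq> {} \<and> doubling_index u q > ereal N} \<le> card Bd"
      by (rule surj_card_le[OF finBd])
    then have many: "\<eta> * real M powr (?n - 2 + \<delta>) \<le> real (card Bd)" using neg by (simp add: M_def)
    have "0 < \<eta> * real M powr (?n - 2 + \<delta>)" using \<eta> by (simp add: M_def)
    then have ne: "Bd \<noteq> {}" using many by auto
    have sub: "Bd \<subseteq> grid k (3 ^ p)" by (auto simp: Bd_def Mp(1))
    obtain L b E where L: "L + a0 \<le> p" and E: "E \<subseteq> grid k (3 ^ L)" "E \<noteq> {}" "finite E" and fr: "frostman s L E"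
      and EB: "\<And>e. e \<in> E \<Longrightarrow> (\<lambda>i. b i * 3 ^ L + e i) \<in> Bd" and br: "\<And>i. 0 \<le> b i \<and> b i < 3 ^ (p - L)"
      and cB: "real (card Bd) \<le> 3 ^ (a0 * CARD('n)) * (3 ^ (L * CARD('n)) * 3 powr (s * real (p - L)))"
      by (rule triadic_selection[OF sub ne a0p s0]) (rule that; assumption)
    \<comment> \<open>For \<open>L < L0\<close> the bad cells would number at most a constant times
      3^(s p), whereas by assumption there are at least \<open>\<eta>\<close> times 3^((s + \<delta>
      / 2) p).\<close>
    have LL0: "L \<ge> L0"
    proof (rule ccontr)
      assume "\<not> L \<ge> L0"
      then have "(3::real) ^ (L * CARD('n)) \<le> 3 ^ (L0 * CARD('n))" by (intro power_increasing) auto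
      moreover have "3 powr (s * real (p - L)) \<le> 3 powr (s * real p)" using s0 by (intro powr_mono mult_left_mono) auto
      ultimately have "3 ^ (a0 * CARD('n)) * (3 ^ (L * CARD('n)) * 3 powr (s * real (p - L))) \<le>
         3 ^ (a0 * CARD('n)) * (3 ^ (L0 * CARD('n)) * 3 powr (s * real p))"
        by (intro mult_left_mono mult_mono) auto
      also have "\<dots> = \<eta> * X * 3 powr (s * real p)"
        using \<eta> by (simp add: X_def add_mult_distrib power_add)
      finally have "\<eta> * real M powr (?n - 2 + \<delta>) \<le> \<eta> * X * 3 powr (s * real p)" using many cB by linarith
      moreover have "real M powr (?n - 2 + \<delta>) = real M powr (\<delta> / 2) * 3 powr (s * real p)"
      proof -
        have "real M = 3 powr real p" by (simp add: Mp powr_realpow)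
        then show ?thesis by (simp add: powr_powr powr_add[symmetric] s_def algebra_simps)
      qed
      ultimately have "\<eta> * 3 powr (s * real p) * (real M powr (\<delta> / 2)) \<le> \<eta> * 3 powr (s * real p) * X" by (simp add: ac_simps)
      then have "real M powr (\<delta> / 2) \<le> X" using \<eta> by (simp add: mult_le_cancel_left_pos)
      moreover have "X < real M powr (\<delta> / 2)"
      proof -
        have "X = (X powr (2 / \<delta>)) powr (\<delta> / 2)" using X0 \<delta> by (simp add: powr_powr)
        also have "\<dots> < real M powr (\<delta> / 2)" using MA \<delta> by (intro powr_less_mono2) (auto simp: A0_def)
        finally show ?thesis .
      qed
      ultimately show False by simp
    qed
    define j where "j = p - L"
    have jp: "j + L = p" "a0 \<le> j" using L by (auto simp: j_def)
    define \<rho> :: real where "\<rho> = 1 / 3 ^ j"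
    \<comment> \<open>Centre of the selected cube, which the map taking x to z0 + \<rho> x makes the
      image of the unit cube. Doubling is used on balls around this point.\<close>
    define z0 where "z0 = cell_center (3 ^ j) b"
    have rho: "\<rho> > 0" by (simp add: \<rho>_def)
    have rhoR: "\<rho> * ?R \<le> 1"
    proof -
      have "(3::real) ^ a0 \<le> 3 ^ j" using jp by (intro power_increasing) auto
      then have "?R \<le> 3 ^ j" using a0 by linarith
      then show ?thesis by (simp add: \<rho>_def divide_le_eq)
    qed
    have z0: "z0 \<in> cube_set (dilate 2 unit_cube)"
    proof -
      have "\<bar>z0 $ i\<bar> \<le> 1" for i
      proof -
        have bi: "0 \<le> b i" "b i + 1 \<le> 3 ^ j" using br[of i] by (auto simp: j_def)
        have "real_of_int (b i + 1) \<le> real_of_int (3 ^ j)" unfolding of_int_le_iff by (rule bi)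
        then have "0 \<le> real_of_int (b i)" "real_of_int (b i) + 1 \<le> 3 ^ j" using bi by simp_all
        then have "0 \<le> (real_of_int (b i) + 1/2) / 3 ^ j" "(real_of_int (b i) + 1/2) / 3 ^ j \<le> 1" by (auto simp: divide_le_eq)
        then show ?thesis unfolding z0_def cell_center_def vec_lambda_beta of_nat_power of_nat_numeral by linarith
      qed
      then show ?thesis by (simp add: cube_set_def dilate_def unit_cube_def)
    qed
    define S where "S = {x. z0 + \<rho> *\<^sub>R x \<in> \<Omega>}"
    define U where "U x = u (z0 + \<rho> *\<^sub>R x)" for x
    have U: "harmonic_on S U" unfolding S_def U_def by (rule harmonic_scale[OF u rho])
    have Sball: "x \<in> S" if "\<rho> * norm x < 20 * ?n" for x
    proof -
      have "z0 + \<rho> *\<^sub>R x \<in> ball z0 (20 * ?n)" using that rho by (simp add: dist_norm)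
      then show ?thesis using balls z0 unfolding S_def by blast
    qed
    have G: "norm (gradient U x) = \<rho> * norm (gradient u (z0 + \<rho> *\<^sub>R x))" if "x \<in> S" for x
      unfolding U_def using gradient_scale[OF u _ rho, of z0 x] that by (simp add: S_def)
    have M3: "1 / real M = \<rho> / 3 ^ L" by (simp add: \<rho>_def Mp jp(1)[symmetric] power_add)
    show False
    proof (rule core[rule_format, OF LL0 N U _ E(3,2,1) fr[unfolded s_def]])
      show "cball 0 ?R \<subseteq> S"
      proof
        fix x :: "real^'n" assume "x \<in> cball 0 ?R"
        then have "\<rho> * norm x \<le> \<rho> * ?R" using rho by (intro mult_left_mono) auto
        then show "x \<in> S" by (intro Sball) (use rhoR n2 in linarith)
      qed
      fix e assume e: "e \<in> E"
      define f where "f = (\<lambda>i. b i * 3 ^ L + e i)"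
      have fB: "f \<in> Bd" unfolding f_def by (rule EB[OF e])
      have fc: "cell_center M f = z0 + \<rho> *\<^sub>R cell_center (3 ^ L) e"
        unfolding z0_def \<rho>_def f_def Mp(1) jp(1)[symmetric] by (rule cell_center_rescale[symmetric])
      obtain x r y where xry: "x \<in> cube_set (cell_center M f, 1 / real M)" "0 < r" "r \<le> 1 / real M" "y \<in> ball x (10 * ?n * r)"
        "\<forall>z\<in>ball x r. exp N * norm (gradient u z) < norm (gradient u y)"
        using doubling_index_greater[of N u "(cell_center M f, 1 / real M)"] fB by (auto simp: Bd_def)
      define x' y' where "x' = (1 / \<rho>) *\<^sub>R (x - z0)" and "y' = (1 / \<rho>) *\<^sub>R (y - z0)"
      have x: "x = z0 + \<rho> *\<^sub>R x'" and y: "y = z0 + \<rho> *\<^sub>R y'" using rho by (auto simp: x'_def y'_def)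
      have xi: "\<bar>x' $ i - cell_center (3 ^ L) e $ i\<bar> \<le> 1 / 3 ^ L" for i
      proof -
        have "\<bar>x $ i - cell_center M f $ i\<bar> \<le> \<rho> / 3 ^ L / 2" using xry(1) by (simp add: cube_set_def M3)
        moreover have "x $ i - cell_center M f $ i = \<rho> * (x' $ i - cell_center (3 ^ L) e $ i)" unfolding x fc by (simp add: right_diff_distrib)
        ultimately have "\<rho> * \<bar>x' $ i - cell_center (3 ^ L) e $ i\<bar> \<le> \<rho> * (1 / 3 ^ L / 2)" using rho by (simp add: abs_mult)
        then have "\<bar>x' $ i - cell_center (3 ^ L) e $ i\<bar> \<le> 1 / 3 ^ L / 2" using rho by (simp only: mult_le_cancel_left_pos)
        moreover have "c / 2 \<le> c" if "0 \<le> c" for c :: real using that by simp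
        ultimately show ?thesis by (rule order_trans) simp
      qed
      have dist_sc: "dist (z0 + \<rho> *\<^sub>R v) (z0 + \<rho> *\<^sub>R w) = \<rho> * dist v w" for v w :: "real^'n"
        using rho by (simp add: dist_norm scaleR_diff_right[symmetric])
      have nx: "norm x' \<le> ?n * (5/2)"
      proof (rule norm_le_card)
        fix i
        have "e \<in> cells k (3 ^ L)" using e E(1) by (force simp: grid_def cells_def)
        then have "\<bar>cell_center (3 ^ L) e $ i\<bar> \<le> 3/2" by (rule cell_center_bound) simp
        moreover have "1 / 3 ^ L \<le> (1::real)" by simp
        ultimately show "\<bar>x' $ i\<bar> \<le> 5/2" using xi[of i] by linarith
      qed
      have r': "r / \<rho> \<le> 1 / 3 ^ L" using xry(3) rho by (simp add: M3 pos_divide_le_eq mult.commute)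
      have r1: "r / \<rho> \<le> 1" by (rule order_trans[OF r']) simp
      \<comment> \<open>A bad point has norm at most 5 n / 2 after rescaling, and growth reaches at
        most 10 n further; both fit into the radius 20 n of the balls contained in the domain, since
        \<open>\<rho> \<le> 1\<close>.\<close>
      have inS: "v \<in> S" if v: "dist x' v < 10 * ?n" for v
      proof (rule Sball)
        have "norm v \<le> norm x' + dist x' v" using norm_triangle_sub[of v x'] by (simp add: dist_norm norm_minus_commute)
        then have "norm v < 20 * ?n" using nx v n2 by linarith
        moreover have "\<rho> * norm v \<le> 1 * norm v" by (rule mult_right_mono) (auto simp: \<rho>_def)
        ultimately show "\<rho> * norm v < 20 * ?n" by linarith
      qed
      have y'b: "dist x' y' < 10 * ?n * (r / \<rho>)"
        using xry(4) rho unfolding x y mem_ball dist_sc by (simp add: pos_less_divide_eq mult.commute)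
      have y10: "dist x' y' < 10 * ?n" using y'b mult_left_mono[OF r1, of "10 * ?n"] n2 by linarith
      have "exp N * norm (gradient U z) < norm (gradient U y')" if z: "z \<in> ball x' (r / \<rho>)" for z
      proof -
        have "dist x' z < 10 * ?n" using z r1 n2 by simp
        then have zS: "z \<in> S" by (rule inS)
        have "z0 + \<rho> *\<^sub>R z \<in> ball x r"
          using z rho unfolding x mem_ball dist_sc by (simp add: pos_less_divide_eq mult.commute)
        then have "\<rho> * (exp N * norm (gradient u (z0 + \<rho> *\<^sub>R z))) < \<rho> * norm (gradient u y)"
          using xry(5) rho by (intro mult_strict_left_mono) auto
        then show ?thesis unfolding G[OF zS] G[OF inS[OF y10]] y[symmetric] by (simp add: ac_simps)
      qed
      then show "\<exists>x r y. (\<forall>i. \<bar>x $ i - cell_center (3 ^ L) e $ i\<bar> \<le> 1 / 3 ^ L) \<and> 0 < r \<and> r \<le> 1 / 3 ^ L \<and>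
         y \<in> ball x (10 * ?n * r) \<and> (\<forall>z\<in>ball x r. exp N * norm (gradient U z) < norm (gradient U y))"
        using xi xry(2) rho r' y'b by (intro exI[of _ x'] exI[of _ "r / \<rho>"] exI[of _ y']) auto
    next
      fix r M' and z :: "real^'n"
      assume r: "0 < r" "r \<le> ?R" and M': "\<And>z. z \<in> ball 0 r \<Longrightarrow> norm (gradient U z) \<le> M'"
        and z: "z \<in> ball 0 (10 * ?n * r)"
      have rr: "\<rho> * r \<le> 1" using mult_left_mono[OF r(2), of \<rho>] rho rhoR by linarith
      have "\<rho> * norm z < \<rho> * (10 * ?n * r)" using z rho by simp
      also have "\<dots> = 10 * ?n * (\<rho> * r)" by simp
      also have "\<dots> \<le> 10 * ?n * 1" using rr n2 by (intro mult_left_mono) auto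
      finally have zn: "\<rho> * norm z < 10 * ?n" by simp
      have zS: "z \<in> S" by (rule Sball) (use zn n2 in linarith)
      have "norm (gradient u (z0 + \<rho> *\<^sub>R z)) \<le> exp (2 * N) * (M' / \<rho>)"
      proof (rule doubling_index_le[OF dbl z0])
        show "0 < \<rho> * r" using rho r by simp
        show "\<rho> * r \<le> side (dilate 2 unit_cube)" using rr by (simp add: dilate_def unit_cube_def)
        show "norm (gradient u v) \<le> M' / \<rho>" if v: "v \<in> ball z0 (\<rho> * r)" for v
        proof -
          define v' where "v' = (1 / \<rho>) *\<^sub>R (v - z0)"
          have v': "v = z0 + \<rho> *\<^sub>R v'" using rho by (simp add: v'_def)
          have "\<rho> * norm v' < \<rho> * r" using v rho unfolding v' by (simp add: dist_norm)
          then have "norm v' < r" using rho by simp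
          moreover have "v' \<in> S" by (rule Sball) (use \<open>\<rho> * norm v' < \<rho> * r\<close> rr n2 in linarith)
          ultimately have "\<rho> * norm (gradient u v) \<le> M'" using M'[of v'] G[of v'] by (simp add: v')
          then show ?thesis using rho by (simp add: pos_le_divide_eq mult.commute)
        qed
        show "z0 + \<rho> *\<^sub>R z \<in> ball z0 (10 * ?n * (\<rho> * r))"
          using z rho by (simp add: dist_norm mult.left_commute)
      qed
      then have "\<rho> * norm (gradient u (z0 + \<rho> *\<^sub>R z)) \<le> \<rho> * (exp (2 * N) * (M' / \<rho>))" using rho by (intro mult_left_mono) auto
      then show "norm (gradient U z) \<le> exp (2 * N) * M'" unfolding G[OF zS] using rho by simp
    qed
  qed
qed

end
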